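(* Let $q$ be even with $q \ge 8$. Then $m'_2(3,q) < q^2 - (\sqrt{5}-1)q + 5$.
   Context: A $k$-cap of the projective space $\mathrm{PG}(n,q)$, $n \ge 3$, is a set of $k$ points no three of which are collinear. A $k$-cap is complete if it is not contained in a $(k+1)$-cap. $m'_2(n,q)$ denotes the second largest value of $k$ for which there exists a complete $k$-cap in $\mathrm{PG}(n,q)$ (i.e. the largest size of a complete cap that is not of maximum size; for $q$ even, $q>2$, the maximum size of a cap in $\mathrm{PG}(3,q)$ is $q^2+1$). *)

theory Defs
  imports "HOL-Analysis.Analysis"
begin

text \<open>
  The projective space PG(n,q) is the lattice of subspaces of the vector space
  \<open>'a ^ 'n\<close>, where \<open>'a\<close> is a finite field with \<open>CARD('a) = q\<close> and \<open>CARD('n) = n + 1\<close>.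
  Incidence is set inclusion.
\<close>

definition pg_points :: "('a::{field,finite} ^ 'n) set set" where
  "pg_points = {P. vec.subspace P \<and> vec.dim P = 1}"

definition pg_lines :: "('a::{field,finite} ^ 'n) set set" where
  "pg_lines = {L. vec.subspace L \<and> vec.dim L = 2}"

definition pg_collinear :: "('a::{field,finite} ^ 'n) set set \<Rightarrow> bool" where
  "pg_collinear S \<longleftrightarrow> (\<exists>L\<in>pg_lines. \<forall>P\<in>S. P \<subseteq> L)"

definition is_cap :: "nat \<Rightarrow> ('a::{field,finite} ^ 'n) set set \<Rightarrow> bool" where
  "is_cap k K \<longleftrightarrow> K \<subseteq> pg_points \<and> card K = k \<and>
     (\<forall>T\<subseteq>K. card T = 3 \<longrightarrow> \<not> pg_collinear T)"

definition is_complete_cap :: "nat \<Rightarrow> ('a::{field,finite} ^ 'n) set set \<Rightarrow> bool" where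
  "is_complete_cap k K \<longleftrightarrow> is_cap k K \<and> \<not> (\<exists>K'. is_cap (k + 1) K' \<and> K \<subseteq> K')"

definition complete_cap_sizes :: "'a::{field,finite} itself \<Rightarrow> 'n::finite itself \<Rightarrow> nat set" where
  "complete_cap_sizes _ _ = {k. \<exists>K :: ('a ^ 'n) set set. is_complete_cap k K}"

text \<open>
  The largest and the second largest size of a complete cap. The set of sizes is always
  finite and nonempty; \<open>m2'\<close> is unspecified if all complete caps have the same size, so
  any proof of a bound on it has to provide a complete cap that is not of maximum size.
\<close>

definition m2 :: "'a::{field,finite} itself \<Rightarrow> 'n::finite itself \<Rightarrow> nat" where
  "m2 F N = Max (complete_cap_sizes F N)"

definition m2' :: "'a::{field,finite} itself \<Rightarrow> 'n::finite itself \<Rightarrow> nat" where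
  "m2' F N = Max (complete_cap_sizes F N - {m2 F N})"

end

theory Submission
  imports Defs
begin

text \<open>
  Let \<open>K\<close> be a complete cap of size \<open>k\<close> in PG(3,q), so that every point of \<open>K\<close> lies on
  \<open>t = q\<^sup>2 + q + 2 - k\<close> tangents, and let \<open>\<sigma>(Q)\<close> be the number of tangents through a point \<open>Q\<close>
  off \<open>K\<close>. A plane with \<open>m\<close> points of \<open>K\<close> contains \<open>s = q + 2 - m\<close> tangents at each of them.
  In even characteristic, Segre's lemma of tangents bounds the number of tangents of a planar arc
  through a point on a bisecant; adding this up over the planes on a bisecant gives \<open>\<sigma>(Q) \<le> t\<close>.

  Summing \<open>\<sigma> \<le> t\<close> over a plane gives \<open>m s q \<le> t (t - 1)\<close>, and summing it over a tangent \<open>g\<close> gives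
  \<open>\<Sum> s (s - 1) \<ge> q (q + 1)\<close> over the planes on \<open>g\<close>, where \<open>\<Sum> (s - 1) = t - 1\<close>. The second inequality
  yields \<open>t \<ge> q + 1\<close>, that is \<open>k \<le> q\<^sup>2 + 1\<close>. If \<open>t\<close> is at most \<open>\<surd>5 q - 3\<close>, the first one forces \<open>s \<le> 4\<close>
  or \<open>s \<ge> q - 2\<close> in every plane, and by the second one each tangent lies in a plane of the latter kind.
  When \<open>t > q + 1\<close>, the tangents at each point therefore fill up two planes almost
  completely, which leaves \<open>t = 2q\<close> and \<open>t = 2q + 1\<close>; both are impossible by counting.

  So a complete cap has \<open>q\<^sup>2 + 1\<close> points or satisfies the bound. The elliptic quadric is of the first
  kind. No cap with \<open>q\<^sup>2 + 1\<close> points contains a plane hyperoval, so every complete cap containing one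
  is of the second kind.
\<close>

section \<open>Tangents of a planar arc in even characteristic\<close>

text \<open>In terms of \<open>t\<close> the claim reads \<open>5 * q^2 < (t + 3)^2\<close>. The
  constant 5 is the first value of \<open>s\<close> to be excluded: for \<open>s = 5\<close> the
  number \<open>m s q\<close> is \<open>5 q (q - 3)\<close>, which exceeds \<open>t (t - 1)\<close>
  when \<open>t\<close> is at most \<open>sqrt 5 * q - 3\<close>. The values
  \<open>s \<le> 4\<close> stay open there, and the inequality for tangents has to deal with them.
  That inequality has force because it compares a quadratic sum with a linear one: the
  \<open>s (s - 1)\<close> on a tangent add up to about \<open>q^2\<close> at least, while the
  \<open>s - 1\<close> add up to less than \<open>sqrt 5 * q\<close>. So some \<open>s\<close> has
  the order of \<open>q\<close>, and nearly all lines through the point in that plane are tangents.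
  An ovoid has one such plane at each point; here \<open>t\<close> is too large for one and too
  small for three. The common line of the two planes decides how the proof ends. If it is a tangent,
  one of the planes has just one point of \<open>K\<close>, and the second moment of
  \<open>m\<close> is too small for so many sparse planes. If it is a bisecant, every further plane
  on it is a hyperoval plane, and then one plane has too many points without tangents.\<close>

lemma char_two:
  assumes "even CARD('a::{field,finite})"
  shows "(1::'a) + 1 = 0"
proof (rule ccontr)
  assume two: "(1::'a) + 1 \<noteq> 0"
  have neg: "- x \<noteq> x" if "x \<noteq> 0" for x :: 'a
  proof
    assume "- x = x"
    then have "x * (1 + 1) = 0"
      by (simp add: distrib_left) (metis add.right_inverse)
    then show False using two that by simp
  qed
  \<comment> \<open>If no nonzero element were its own negative, the pairs \<open>{x, - x}\<close>
    would partition the nonzero elements, and \<open>CARD('a) - 1\<close> would be even.\<close>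
  let ?C = "(\<lambda>x::'a. {x, - x}) ` (UNIV - {0})"
  have "2 * card ?C = card (\<Union>?C)"
  proof (rule card_partition)
    show "card c = 2" if "c \<in> ?C" for c
      using that neg by (metis (no_types, lifting) DiffE card_2_iff imageE insertI1)
    show "c1 \<inter> c2 = {}" if "c1 \<in> ?C" "c2 \<in> ?C" "c1 \<noteq> c2" for c1 c2
      using that by fastforce
  qed auto
  moreover have "\<Union>?C = UNIV - {0}" by auto
  moreover have "card (UNIV - {0::'a}) = CARD('a) - 1" by (simp add: card_Diff_singleton)
  moreover have "CARD('a) > 0" by simp
  ultimately have "2 * card ?C = CARD('a) - 1" "CARD('a) > 0" by simp_all
  then have "CARD('a) = 2 * card ?C + 1" by linarith
  then have "odd CARD('a)" by (metis even_plus_one_iff dvd_triv_left)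
  then show False using assms by simp
qed

text \<open>Lagrange interpolation writes \<open>p\<close> as a combination of the polynomials
  \<open>B i\<close>, all monic of degree \<open>card E - 1\<close>; the identity compares the
  coefficients at this degree.\<close>

lemma lagrange_lead_coeff:
  fixes p :: "'a::field poly" and f :: "'i \<Rightarrow> 'a"
  assumes fin: "finite E" and inj: "inj_on f E" and deg: "degree p < card E"
  shows "(\<Sum>i\<in>E. poly p (f i) / (\<Prod>j\<in>E - {i}. f i - f j)) = coeff p (card E - 1)"
proof -
  define B where "B i = (\<Prod>j\<in>E - {i}. [:- f j, 1:])" for i
  define c where "c i = poly p (f i) / (\<Prod>j\<in>E - {i}. f i - f j)" for i
  define L where "L = (\<Sum>i\<in>E. smult (c i) (B i))"
  have degB: "degree (B i) = card E - 1" if "i \<in> E" for i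
    using that fin by (simp add: B_def degree_prod_eq_sum_degree card_Diff_singleton)
  have leadB: "coeff (B i) (card E - 1) = 1" if "i \<in> E" for i
  proof -
    have "coeff (B i) (card E - 1) = lead_coeff (B i)" using degB[OF that] by simp
    also have "\<dots> = 1" by (simp add: B_def lead_coeff_prod)
    finally show ?thesis .
  qed
  have polyB: "poly (B i) (f j) = (if i = j then (\<Prod>j\<in>E - {i}. f i - f j) else 0)"
    if "i \<in> E" "j \<in> E" for i j
    using that fin by (auto simp: B_def poly_prod)
  have nz: "(\<Prod>j\<in>E - {i}. f i - f j) \<noteq> 0" if "i \<in> E" for i
    using that fin inj by (auto simp: inj_on_def)
  have ev: "poly L (f j) = poly p (f j)" if j: "j \<in> E" for j
  proof -
    have "poly L (f j) = (\<Sum>i\<in>E. if i = j then c i * (\<Prod>j\<in>E - {i}. f i - f j) else 0)"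
      unfolding L_def poly_sum poly_smult using j by (intro sum.cong) (auto simp: polyB)
    also have "\<dots> = poly p (f j)" using j fin nz[OF j] by (simp add: c_def)
    finally show ?thesis .
  qed
  have "degree L \<le> card E - 1"
    unfolding L_def using degB by (intro degree_sum_le) (auto simp: fin)
  then have degL: "degree L < card E" using deg by linarith
  have "L = p"
  proof (rule poly_eqI_degree[of "f ` E"])
    show "poly L x = poly p x" if "x \<in> f ` E" for x using that ev by auto
  qed (use degL deg card_image[OF inj] in auto)
  moreover have "coeff L (card E - 1) = (\<Sum>i\<in>E. c i)"
    unfolding L_def coeff_sum coeff_smult using leadB by simp
  ultimately show ?thesis by (simp add: c_def)
qed

text \<open>The equal terms at \<open>(p, r)\<close> and \<open>(r, p)\<close> cancel in
  characteristic 2.\<close>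

lemma sum_symmetric_off_diagonal:
  fixes T :: "'i \<Rightarrow> 'i \<Rightarrow> 'a::field"
  assumes two: "(1::'a) + 1 = 0" and fin: "finite E"
    and sym: "\<And>p r. p \<in> E \<Longrightarrow> r \<in> E \<Longrightarrow> p \<noteq> r \<Longrightarrow> T p r = T r p"
  shows "(\<Sum>p\<in>E. \<Sum>r\<in>E - {p}. T p r) = 0"
  using fin sym
proof (induction E rule: finite_induct)
  case (insert a E)
  have dbl: "z + z = 0" for z :: 'a
    using two by (metis mult_2 mult_zero_left one_add_one)
  have 1: "(\<Sum>r\<in>insert a E - {p}. T p r) = T a p + (\<Sum>r\<in>E - {p}. T p r)" if "p \<in> E" for p
  proof -
    have "insert a E - {p} = insert a (E - {p})" using that insert.hyps by auto
    moreover have "T p a = T a p" using insert.prems[of p a] insert.hyps that by auto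
    ultimately show ?thesis using insert.hyps by simp
  qed
  have "(\<Sum>p\<in>insert a E. \<Sum>r\<in>insert a E - {p}. T p r)
      = (\<Sum>r\<in>E. T a r) + (\<Sum>p\<in>E. \<Sum>r\<in>insert a E - {p}. T p r)"
    using insert.hyps by (simp add: Diff_insert_absorb)
  also have "(\<Sum>p\<in>E. \<Sum>r\<in>insert a E - {p}. T p r) = (\<Sum>p\<in>E. T a p) + (\<Sum>p\<in>E. \<Sum>r\<in>E - {p}. T p r)"
    using 1 by (simp add: sum.distrib)
  also have "(\<Sum>p\<in>E. \<Sum>r\<in>E - {p}. T p r) = 0"
    using insert.IH insert.prems by blast
  finally show ?case by (simp add: dbl)
qed simp

text \<open>
  \<open>S\<close> is the affine part of an arc that also contains the two points \<open>A\<close>, \<open>B\<close> at infinity of the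
  coordinate axes, and \<open>x + y\<close> takes a value only once precisely when the line through that point with
  slope 1 is a tangent. Let \<open>T p r\<close> be the term at the node \<open>r\<close> of the Lagrange interpolation of the
  tangent form at \<open>p\<close>, in a direction that is a root of this form. By the lemma of tangents
  (\<open>segre\<close>) it is symmetric in \<open>p\<close> and \<open>r\<close>, so the double sum vanishes in characteristic 2; by a
  second interpolation, of the tangent form at \<open>A\<close>, it is nonzero.
\<close>

lemma few_unique_sums:
  fixes x y :: "'i \<Rightarrow> 'a::{field,finite}"
  assumes two: "(1::'a) + 1 = 0" and finS: "finite S"
    and injx: "inj_on x S" and injy: "inj_on y S"
    and nocol: "\<And>p r w. \<lbrakk>p \<in> S; r \<in> S; w \<in> S; p \<noteq> r; p \<noteq> w; r \<noteq> w\<rbrakk>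
      \<Longrightarrow> (x p + x r) * (y p + y w) + (y p + y r) * (x p + x w) \<noteq> 0"
  shows "card {p \<in> S. \<forall>r\<in>S. x r + y r = x p + y p \<longrightarrow> r = p} + card S \<le> CARD('a)"
proof (rule ccontr)
  define U where "U = {p \<in> S. \<forall>r\<in>S. x r + y r = x p + y p \<longrightarrow> r = p}"
  define q n t where "q = CARD('a)" and "n = card S" and "t = q - n"
  assume "\<not> card {p \<in> S. \<forall>r\<in>S. x r + y r = x p + y p \<longrightarrow> r = p} + card S \<le> CARD('a)"
  then have big: "card U + n > q" by (simp add: U_def q_def n_def)
  have nq: "n \<le> q"
    using card_mono[of UNIV "x ` S"] card_image[OF injx] by (simp add: n_def q_def)
  \<comment> \<open>The arc has \<open>n + 2\<close> points, hence \<open>t = q - n\<close> tangents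
    at each of them. Tangent forms have degree \<open>t\<close>, so interpolating them takes
    \<open>t + 1\<close> nodes, and the assumption provides that many points in
    \<open>U\<close>.\<close>
  have "t + 1 \<le> card U" using big nq by (simp add: t_def)
  then obtain E where EU: "E \<subseteq> U" and cE: "card E = t + 1"
    by (meson obtain_subset_with_card_n)
  have ES: "E \<subseteq> S" using EU by (auto simp: U_def)
  then have finE: "finite E" using finS finite_subset by blast
  have dbl: "z + z = 0" for z :: 'a
    using two by (metis mult_2 mult_zero_left one_add_one)
  have diff: "z - w = z + w" for z w :: 'a
    using dbl[of w] by (simp add: diff_eq_eq add.assoc)
  have eq0: "z + w = 0 \<longleftrightarrow> z = w" for z w :: 'a
    using diff[of z w] by (metis eq_iff_diff_eq_0)
  have xne: "x p + x r \<noteq> 0" if "p \<in> S" "r \<in> S" "p \<noteq> r" for p r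
    using that injx by (auto simp: eq0 inj_on_def)
  have yne: "y p + y r \<noteq> 0" if "p \<in> S" "r \<in> S" "p \<noteq> r" for p r
    using that injy by (auto simp: eq0 inj_on_def)
  \<comment> \<open>The determinant that vanishes when the three affine points are collinear; signs
    disappear in characteristic 2.\<close>
  define D where "D p r w = (x p + x r) * (y p + y w) + (y p + y r) * (x p + x w)" for p r w
  have Dne: "D p r w \<noteq> 0" if "p \<in> S" "r \<in> S" "w \<in> S" "p \<noteq> r" "p \<noteq> w" "r \<noteq> w" for p r w
    using nocol[OF that] by (simp add: D_def)
  have Dsym: "D p r w = D r p w" for p r w
  proof -
    have "D p r w + D r p w = ((x p + x r) * (y p + y r) + (x p + x r) * (y p + y r)) 
        + ((x p + x r) * y w + (x p + x r) * y w) + ((y p + y r) * x w + (y p + y r) * x w)"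
      by (simp add: D_def algebra_simps)
    then have "D p r w + D r p w = 0" by (simp only: dbl)
    then show ?thesis by (simp add: eq0)
  qed
  define W where "W = (\<Prod>z\<in>UNIV - {0::'a}. z)"
  have Wne: "W \<noteq> 0" by (simp add: W_def)
  have Wshift: "(\<Prod>z\<in>UNIV - {c}. c + z) = W" for c
    unfolding W_def
    by (rule prod.reindex_bij_witness[of _ "\<lambda>z. c + z" "\<lambda>z. c + z"])
       (auto simp: add.assoc[symmetric] dbl eq0)
  \<comment> \<open>Lines through \<open>A\<close> have constant \<open>y\<close>, lines through
    \<open>B\<close> constant \<open>x\<close>. The values that \<open>y\<close> omits on
    \<open>S\<close> are therefore the tangents at \<open>A\<close>, and \<open>fA p\<close> is the
    product of their linear forms at \<open>p\<close>; likewise \<open>fB p\<close> for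
    \<open>B\<close>.\<close>
  define fA where "fA p = (\<Prod>c\<in>UNIV - y ` S. y p + c)" for p
  define fB where "fB p = (\<Prod>c\<in>UNIV - x ` S. x p + c)" for p
  have prodA: "fA p * (\<Prod>w\<in>S - {p}. y p + y w) = W" if p: "p \<in> S" for p
  proof -
    have "(\<Prod>w\<in>S - {p}. y p + y w) = (\<Prod>z\<in>y ` (S - {p}). y p + z)"
      using injy by (subst prod.reindex) (auto simp: inj_on_def)
    moreover have "UNIV - {y p} = (UNIV - y ` S) \<union> y ` (S - {p})"
      using p injy by (auto simp: inj_on_def)
    moreover have "(UNIV - y ` S) \<inter> y ` (S - {p}) = {}" by auto
    ultimately show ?thesis
      using Wshift[of "y p"] prod.union_disjoint[of "UNIV - y ` S" "y ` (S - {p})" "\<lambda>z. y p + z"]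
      by (simp add: fA_def)
  qed
  have prodB: "fB p * (\<Prod>w\<in>S - {p}. x p + x w) = W" if p: "p \<in> S" for p
  proof -
    have "(\<Prod>w\<in>S - {p}. x p + x w) = (\<Prod>z\<in>x ` (S - {p}). x p + z)"
      using injx by (subst prod.reindex) (auto simp: inj_on_def)
    moreover have "UNIV - {x p} = (UNIV - x ` S) \<union> x ` (S - {p})"
      using p injx by (auto simp: inj_on_def)
    moreover have "(UNIV - x ` S) \<inter> x ` (S - {p}) = {}" by auto
    ultimately show ?thesis
      using Wshift[of "x p"] prod.union_disjoint[of "UNIV - x ` S" "x ` (S - {p})" "\<lambda>z. x p + z"]
      by (simp add: fB_def)
  qed
  define sl where "sl p r = (y p + y r) / (x p + x r)" for p r
  \<comment> \<open>Slope 0 belongs to the line to \<open>A\<close> and the vertical line goes to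
    \<open>B\<close>; the other slopes that no secant at \<open>p\<close> uses are those of the
    \<open>t\<close> tangents at \<open>p\<close>.\<close>
  define M where "M p = UNIV - {0} - sl p ` (S - {p})" for p
  have slne: "sl p r \<noteq> 0" if "p \<in> S" "r \<in> S" "p \<noteq> r" for p r
    using xne[OF that] yne[OF that] by (simp add: sl_def)
  have sladd: "sl p r + sl p w = D p r w / ((x p + x r) * (x p + x w))"
    if "p \<in> S" "r \<in> S" "w \<in> S" "p \<noteq> r" "p \<noteq> w" for p r w
    using that xne[of p r] xne[of p w] by (simp add: sl_def D_def add_frac_eq mult_ac add_ac)
  have slinj: "inj_on (sl p) (S - {p})" if p: "p \<in> S" for p
  proof (rule inj_onI, rule ccontr)
    fix r w assume rw: "r \<in> S - {p}" "w \<in> S - {p}" "sl p r = sl p w" "r \<noteq> w"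
    then have "sl p r + sl p w = 0" by (simp add: dbl)
    then show False using rw p sladd[of p r w] Dne[of p r w] xne[of p r] xne[of p w] by auto
  qed
  have cardM: "card (M p) = t" if p: "p \<in> S" for p
  proof -
    have "sl p ` (S - {p}) \<subseteq> UNIV - {0}" using slne p by fastforce
    then have "card (M p) = card (UNIV - {0::'a}) - card (sl p ` (S - {p}))"
      unfolding M_def by (intro card_Diff_subset) auto
    also have "\<dots> = (q - 1) - (n - 1)"
      using p by (simp add: card_image[OF slinj[OF p]] q_def n_def card_Diff_singleton)
    moreover have "n \<ge> 1" using p finS by (auto simp: n_def Suc_le_eq card_gt_0_iff)
    ultimately show ?thesis using nq by (simp add: t_def)
  qed
  have oneM: "1 \<in> M p" if p: "p \<in> E" for p
  proof -
    have "sl p r \<noteq> 1" if r: "r \<in> S" "r \<noteq> p" for r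
    proof
      assume "sl p r = 1"
      then have "y p + y r = x p + x r" using xne[of p r] r p ES by (auto simp: sl_def divide_eq_1_iff)
      then have "(x r + y r) + (x p + y p) = 0"
        by (metis add.commute add.left_commute dbl)
      then show False using r p EU by (auto simp: U_def eq0 )
    qed
    then have "1 \<notin> sl p ` (S - {p})" by (metis DiffE imageE singletonI)
    then show ?thesis by (simp add: M_def)
  qed
  \<comment> \<open>The lemma of tangents for the triangle \<open>A\<close>, \<open>B\<close>,
    \<open>p\<close>: the product of all nonzero slopes at \<open>p\<close> splits into tangents and
    secants, and \<open>prodA\<close> and \<open>prodB\<close> remove the secants.\<close>
  have prodM: "fB p * (\<Prod>\<mu>\<in>M p. \<mu>) = W * fA p" if p: "p \<in> S" for p
  proof -
    have "(\<Prod>\<mu>\<in>M p. \<mu>) * (\<Prod>z\<in>sl p ` (S - {p}). z) = W"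
    proof -
      have "UNIV - {0} = M p \<union> sl p ` (S - {p})" using slne p by (fastforce simp: M_def)
      moreover have "M p \<inter> sl p ` (S - {p}) = {}" by (auto simp: M_def)
      ultimately show ?thesis unfolding W_def by (simp add: prod.union_disjoint)
    qed
    also have "(\<Prod>z\<in>sl p ` (S - {p}). z) = (\<Prod>w\<in>S - {p}. y p + y w) / (\<Prod>w\<in>S - {p}. x p + x w)"
      by (subst prod.reindex[OF slinj[OF p]]) (simp add: sl_def prod_dividef)
    finally have 1: "(\<Prod>\<mu>\<in>M p. \<mu>) * (\<Prod>w\<in>S - {p}. y p + y w) = W * (\<Prod>w\<in>S - {p}. x p + x w)"
      using prodB[OF p] Wne by (auto simp: field_simps)
    have "fB p * (\<Prod>\<mu>\<in>M p. \<mu>) * W = fB p * ((\<Prod>\<mu>\<in>M p. \<mu>) * (\<Prod>w\<in>S - {p}. y p + y w)) * fA p"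
      using prodA[OF p] by (simp add: mult_ac)
    also have "\<dots> = W * W * fA p"
      using prodB[OF p] unfolding 1 by (simp add: mult_ac)
    finally show ?thesis using Wne by simp
  qed
  define X where "X p r = x p + x r" for p r
  define Y where "Y p r = y p + y r" for p r
  \<comment> \<open>The tangent form at \<open>p\<close> as a polynomial in the inverse slope
    \<open>X / Y\<close>, where a tangent of slope \<open>\<mu>\<close> gives the root
    \<open>1 / \<mu>\<close>. The default \<open>\<xi> p p = 1\<close> is the direction of slope 1;
    for \<open>p\<close> in \<open>E\<close> it is a root, so the node \<open>p\<close> contributes
    nothing.\<close>
  define \<phi> where "\<phi> p = (\<Prod>\<mu>\<in>M p. [:1, \<mu>:])" for p
  define \<xi> where "\<xi> p r = (if r = p then 1 else X p r / Y p r)" for p r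
  \<comment> \<open>The factor \<open>\<xi> p r + 1\<close> comes from the node \<open>p\<close>.
    The factor \<open>fB p\<close> and the product of the \<open>Y p w\<close> are constant in
    \<open>r\<close>; they make the term symmetric.\<close>
  define T where "T p r = fB p * poly (\<phi> p) (\<xi> p r) / ((\<xi> p r + 1) * (\<Prod>w\<in>E - {p} - {r}. \<xi> p r + \<xi> p w))
      / (\<Prod>w\<in>E - {p}. Y p w)" for p r
  \<comment> \<open>The lemma of tangents for the triangle \<open>B\<close>, \<open>p\<close>,
    \<open>r\<close>: everything on the right is symmetric in \<open>p\<close> and \<open>r\<close>.
    It is \<open>Wshift\<close> at the slope \<open>\<delta>\<close> of the line \<open>pr\<close>,
    with the other slopes sorted into 0, tangents and secants.\<close>
  have segre: "fB p * poly (\<phi> p) (X p r / Y p r)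
      = W * W * X p r ^ (n - 2) / ((Y p r / X p r) ^ (t + 1) * X p r * (\<Prod>w\<in>S - {p,r}. D p r w))"
    if pr: "p \<in> S" "r \<in> S" "p \<noteq> r" for p r
  proof -
    define \<delta> where "\<delta> = sl p r"
    have \<delta>: "\<delta> \<noteq> 0" "X p r \<noteq> 0" "Y p r \<noteq> 0" "\<delta> = Y p r / X p r"
      using slne[OF pr] xne[OF pr] yne[OF pr] by (auto simp: \<delta>_def X_def Y_def sl_def)
    have im: "sl p ` (S - {p}) = insert \<delta> (sl p ` (S - {p,r}))"
      using pr by (auto simp: \<delta>_def)
    have "\<delta> \<notin> sl p ` (S - {p,r})"
    proof
      assume "\<delta> \<in> sl p ` (S - {p,r})"
      then obtain w where "w \<in> S - {p,r}" "sl p r = sl p w" by (auto simp: \<delta>_def)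
      then show False using slinj[OF pr(1)] pr by (auto dest!: inj_onD)
    qed
    moreover have "0 \<notin> sl p ` (S - {p,r})" using slne pr by fastforce
    ultimately have "UNIV - {\<delta>} = insert 0 (M p \<union> sl p ` (S - {p,r}))"
      using \<delta>(1) by (auto simp: M_def im)
    moreover have "M p \<inter> sl p ` (S - {p,r}) = {}" by (auto simp: M_def)
    moreover have "0 \<notin> M p \<union> sl p ` (S - {p,r})" using slne pr by (fastforce simp: M_def)
    ultimately have "W = \<delta> * ((\<Prod>\<mu>\<in>M p. \<delta> + \<mu>) * (\<Prod>z\<in>sl p ` (S - {p,r}). \<delta> + z))"
      using Wshift[of \<delta>] by (simp add: prod.union_disjoint)
    also have "(\<Prod>z\<in>sl p ` (S - {p,r}). \<delta> + z) = (\<Prod>w\<in>S - {p,r}. \<delta> + sl p w)"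
      by (subst prod.reindex) (auto intro: inj_on_subset[OF slinj[OF pr(1)]])
    also have "\<dots> = (\<Prod>w\<in>S - {p,r}. D p r w / (X p r * (x p + x w)))"
      unfolding \<delta>_def X_def using pr by (intro prod.cong) (auto simp: sladd)
    also have "\<dots> = (\<Prod>w\<in>S - {p,r}. D p r w) / (X p r ^ (n - 2) * (\<Prod>w\<in>S - {p,r}. x p + x w))"
      using pr by (simp add: prod_dividef prod.distrib n_def card_Diff_subset finS numeral_2_eq_2)
    finally have 1: "W = \<delta> * ((\<Prod>\<mu>\<in>M p. \<delta> + \<mu>) * ((\<Prod>w\<in>S - {p,r}. D p r w) / 
      (X p r ^ (n - 2) * (\<Prod>w\<in>S - {p,r}. x p + x w))))" .
    have "S - {p} = insert r (S - {p,r})" using pr by auto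
    then have 2: "fB p * (X p r * (\<Prod>w\<in>S - {p,r}. x p + x w)) = W"
      using prodB[OF pr(1)] finS by (simp add: X_def)
    have Dn: "(\<Prod>w\<in>S - {p,r}. D p r w) \<noteq> 0" using Dne pr finS by auto
    have Pn: "(\<Prod>w\<in>S - {p,r}. x p + x w) \<noteq> 0" using xne pr finS by auto
    have "poly (\<phi> p) (X p r / Y p r) = (\<Prod>\<mu>\<in>M p. (\<delta> + \<mu>) / \<delta>)"
    proof -
      have "X p r / Y p r = 1 / \<delta>" using \<delta> by simp
      then show ?thesis
        unfolding \<phi>_def poly_prod using \<delta>(1) by (intro prod.cong) (auto simp: add_divide_distrib)
    qed
    also have "\<dots> = (\<Prod>\<mu>\<in>M p. \<delta> + \<mu>) / \<delta> ^ t"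
      by (simp add: prod_dividef cardM[OF pr(1)])
    finally have 3: "(\<Prod>\<mu>\<in>M p. \<delta> + \<mu>) = poly (\<phi> p) (X p r / Y p r) * \<delta> ^ t" using \<delta> by simp
    define F where "F = poly (\<phi> p) (X p r / Y p r)"
    define PD where "PD = (\<Prod>w\<in>S - {p,r}. D p r w)"
    define PX where "PX = (\<Prod>w\<in>S - {p,r}. x p + x w)"
    define R where "R = X p r ^ (n - 2) * PX"
    have "R \<noteq> 0" using Pn \<delta>(2) by (simp add: R_def PX_def)
    moreover have "W = \<delta> ^ (t + 1) * F * PD / R"
      using 1 unfolding 3 F_def[symmetric] PD_def[symmetric] PX_def[symmetric] R_def[symmetric]
      by (simp add: mult_ac)
    ultimately have 4: "W * (X p r ^ (n - 2) * PX) = \<delta> ^ (t + 1) * F * PD"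
      by (simp add: R_def[symmetric])
    have 5: "fB p * F * (\<delta> ^ (t + 1) * X p r * PD) = W * W * X p r ^ (n - 2)"
    proof -
      have "fB p * F * (\<delta> ^ (t + 1) * X p r * PD) = fB p * X p r * (\<delta> ^ (t + 1) * F * PD)"
        by (simp add: mult_ac)
      also have "\<dots> = W * X p r ^ (n - 2) * (fB p * (X p r * PX))"
        unfolding 4[symmetric] by (simp add: mult_ac)
      also have "\<dots> = W * W * X p r ^ (n - 2)" using 2 by (simp add: PX_def mult_ac)
      finally show ?thesis .
    qed
    show ?thesis
      using 5 \<delta> Dn unfolding F_def[symmetric] PD_def[symmetric] \<delta>(4)[symmetric]
      by (subst eq_divide_eq) auto
  qed
  have T_sym: "T p r = T r p" if pr: "p \<in> E" "r \<in> E" "p \<noteq> r" for p r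
  proof -
    have T_eq: "T p r = W * W * X p r ^ (n - 2) / ((Y p r / X p r) ^ (t + 1) * X p r * (\<Prod>w\<in>S - {p,r}. D p r w))
       / ((X p r + Y p r) / Y p r * ((\<Prod>w\<in>E - {p,r}. D p r w) / Y p r ^ (t - 1)) * Y p r)"
      if pr: "p \<in> E" "r \<in> E" "p \<noteq> r" for p r
    proof -
      have prS: "p \<in> S" "r \<in> S" using pr ES by auto
      have Yn: "Y p w \<noteq> 0" if "w \<in> E" "w \<noteq> p" for w using yne that ES prS by (auto simp: Y_def)
      have E1: "E - {p} - {r} = E - {p,r}" by auto
      have E2: "E - {p} = insert r (E - {p,r})" using pr by auto
      have cE2: "card (E - {p,r}) = t - 1" using pr cE by (simp add: card_Diff_subset)
      \<comment> \<open>Clearing denominators turns each difference of nodes into the symmetric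
        determinant \<open>D p r w\<close>, up to powers of \<open>Y p r\<close>.\<close>
      have "(\<Prod>w\<in>E - {p,r}. \<xi> p r + \<xi> p w) * (\<Prod>w\<in>E - {p}. Y p w)
          = (\<Prod>w\<in>E - {p,r}. (\<xi> p r + \<xi> p w) * Y p w) * Y p r"
        unfolding E2 using finE by (simp add: prod.distrib mult_ac)
      also have "(\<Prod>w\<in>E - {p,r}. (\<xi> p r + \<xi> p w) * Y p w) = (\<Prod>w\<in>E - {p,r}. D p r w / Y p r)"
      proof (intro prod.cong refl)
        fix w assume w: "w \<in> E - {p,r}"
        have "(a / b + c / d) * d = (a * d + b * c) / b" if "b \<noteq> 0" "d \<noteq> 0" for a b c d :: 'a
          using that by (simp add: field_simps)
        from this[of "Y p r" "Y p w" "X p r" "X p w"]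
        show "(\<xi> p r + \<xi> p w) * Y p w = D p r w / Y p r"
          using pr Yn w by (simp add: \<xi>_def D_def X_def[symmetric] Y_def[symmetric])
      qed
      also have "\<dots> = (\<Prod>w\<in>E - {p,r}. D p r w) / Y p r ^ (t - 1)"
        by (simp add: prod_dividef cE2)
      finally have 1: "(\<Prod>w\<in>E - {p,r}. \<xi> p r + \<xi> p w) * (\<Prod>w\<in>E - {p}. Y p w)
         = (\<Prod>w\<in>E - {p,r}. D p r w) / Y p r ^ (t - 1) * Y p r" .
      have 2: "\<xi> p r + 1 = (X p r + Y p r) / Y p r"
        using pr Yn[of r] by (auto simp: \<xi>_def field_simps)
      have 3: "\<xi> p r = X p r / Y p r" using pr by (simp add: \<xi>_def)
      have "T p r = fB p * poly (\<phi> p) (\<xi> p r) / ((\<xi> p r + 1) * ((\<Prod>w\<in>E - {p,r}. \<xi> p r + \<xi> p w) * (\<Prod>w\<in>E - {p}. Y p w)))"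
        unfolding T_def E1 by (simp add: mult_ac)
      then show ?thesis unfolding 1 2 unfolding 3 segre[OF prS pr(3)] by (simp add: mult_ac)
    qed
    have "X r p = X p r" "Y r p = Y p r" "{r,p} = {p,r}" by (auto simp: X_def Y_def add.commute)
    moreover have "D r p w = D p r w" for w by (rule Dsym)
    ultimately show ?thesis using T_eq[of p r] T_eq[of r p] pr by simp
  qed
  \<comment> \<open>Interpolation of \<open>\<phi> p\<close> at \<open>t + 1\<close> nodes recovers
    its leading coefficient, the product of the tangent slopes at \<open>p\<close>, which
    \<open>prodM\<close> converts into \<open>fA p\<close>.\<close>
  have row: "W * (fA p / (\<Prod>w\<in>E - {p}. y p + y w)) = (\<Sum>r\<in>E - {p}. T p r)" if p: "p \<in> E" for p
  proof -
    have pS: "p \<in> S" using p ES by auto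
    have deg: "degree (\<phi> p) = t" 
      unfolding \<phi>_def by (subst degree_prod_eq_sum_degree) (auto simp: M_def cardM[OF pS, unfolded M_def])
    have lead: "coeff (\<phi> p) t = (\<Prod>\<mu>\<in>M p. \<mu>)"
    proof -
      have "coeff (\<phi> p) t = lead_coeff (\<phi> p)" using deg by simp
      also have "\<dots> = (\<Prod>\<mu>\<in>M p. \<mu>)" unfolding \<phi>_def lead_coeff_prod
        by (intro prod.cong) (auto simp: M_def)
      finally show ?thesis .
    qed
    have root: "poly (\<phi> p) 1 = 0"
      using oneM[OF p] two by (auto simp: \<phi>_def poly_prod prod_zero_iff intro!: bexI[of _ 1])
    have inj: "inj_on (\<xi> p) E"
    proof (rule inj_onI, rule ccontr)
      fix r w assume rw: "r \<in> E" "w \<in> E" "\<xi> p r = \<xi> p w" "r \<noteq> w"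
      have one: "\<xi> p r \<noteq> 1" if "r \<in> E" "r \<noteq> p" for r
      proof
        assume "\<xi> p r = 1"
        then have "sl p r = 1" using that yne[of p r] pS ES by (auto simp: \<xi>_def X_def Y_def sl_def divide_eq_1_iff)
        then show False using that oneM[OF p] ES by (auto simp: M_def)
      qed
      then have ne: "r \<noteq> p" "w \<noteq> p" using rw by (metis \<xi>_def)+
      have "sl p v = inverse (\<xi> p v)" if "v \<noteq> p" for v
        using that by (simp add: sl_def \<xi>_def X_def Y_def)
      then have "sl p r = sl p w" using rw ne by simp
      then show False using slinj[OF pS] rw ne ES by (auto simp: inj_on_def)
    qed
    have "(\<Prod>\<mu>\<in>M p. \<mu>) = (\<Sum>r\<in>E. poly (\<phi> p) (\<xi> p r) / (\<Prod>w\<in>E - {r}. \<xi> p r - \<xi> p w))"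
      using lagrange_lead_coeff[OF finE inj, of "\<phi> p"] deg lead cE by simp
    also have "\<dots> = (\<Sum>r\<in>E - {p}. poly (\<phi> p) (\<xi> p r) / (\<Prod>w\<in>E - {r}. \<xi> p r - \<xi> p w))"
      using p root by (subst sum.remove[OF finE p]) (simp add: \<xi>_def)
    also have "\<dots> = (\<Sum>r\<in>E - {p}. poly (\<phi> p) (\<xi> p r) / ((\<xi> p r + 1) * (\<Prod>w\<in>E - {p} - {r}. \<xi> p r + \<xi> p w)))"
    proof (intro sum.cong refl)
      fix r assume r: "r \<in> E - {p}"
      have "E - {r} = insert p (E - {p} - {r})" "\<xi> p p = 1" using r p by (auto simp: \<xi>_def)
      then show "poly (\<phi> p) (\<xi> p r) / (\<Prod>w\<in>E - {r}. \<xi> p r - \<xi> p w) = 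
        poly (\<phi> p) (\<xi> p r) / ((\<xi> p r + 1) * (\<Prod>w\<in>E - {p} - {r}. \<xi> p r + \<xi> p w))"
        using finE by (simp add: diff)
    qed
    finally have 1: "(\<Prod>\<mu>\<in>M p. \<mu>) = (\<Sum>r\<in>E - {p}. poly (\<phi> p) (\<xi> p r) / ((\<xi> p r + 1) * (\<Prod>w\<in>E - {p} - {r}. \<xi> p r + \<xi> p w)))" .
    have "W * fA p = fB p * (\<Prod>\<mu>\<in>M p. \<mu>)" using prodM[OF pS] by simp
    then have "W * (fA p / (\<Prod>w\<in>E - {p}. Y p w)) = fB p * (\<Prod>\<mu>\<in>M p. \<mu>) / (\<Prod>w\<in>E - {p}. Y p w)" by simp
    also have "\<dots> = (\<Sum>r\<in>E - {p}. T p r)"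
      unfolding 1 T_def sum_distrib_left sum_divide_distrib by simp
    finally show ?thesis by (simp add: Y_def)
  qed
  \<comment> \<open>The tangents at \<open>A\<close> form a monic polynomial of degree
    \<open>t\<close> in \<open>y\<close>, interpolated at the \<open>t + 1\<close> values of
    \<open>y\<close> on \<open>E\<close>.\<close>
  have "(\<Sum>p\<in>E. fA p / (\<Prod>w\<in>E - {p}. y p + y w)) = 1"
  proof -
    define \<psi> where "\<psi> = (\<Prod>c\<in>UNIV - y ` S. [:c, 1:])"
    have cc: "card (UNIV - y ` S) = t"
      using injy by (subst card_Diff_subset) (auto simp: t_def q_def n_def card_image)
    have deg: "degree \<psi> = t"
      unfolding \<psi>_def by (subst degree_prod_eq_sum_degree) (auto simp: cc)
    have "coeff \<psi> t = lead_coeff \<psi>" using deg by simp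
    also have "\<dots> = 1" unfolding \<psi>_def lead_coeff_prod by simp
    finally have lead: "coeff \<psi> t = 1" .
    have ev: "poly \<psi> (y p) = fA p" for p by (simp add: \<psi>_def fA_def poly_prod add.commute)
    have "inj_on y E" using injy ES by (auto intro: inj_on_subset)
    from lagrange_lead_coeff[OF finE this, of \<psi>] show ?thesis
      using deg lead cE by (simp add: ev diff)
  qed
  then have "W = (\<Sum>p\<in>E. W * (fA p / (\<Prod>w\<in>E - {p}. y p + y w)))"
    by (simp only: sum_distrib_left[symmetric] mult_1_right)
  also have "\<dots> = (\<Sum>p\<in>E. \<Sum>r\<in>E - {p}. T p r)" using row by simp
  also have "\<dots> = 0" by (rule sum_symmetric_off_diagonal[OF two finE T_sym])
  finally show False using Wne by simp
qed

section \<open>Caps in a projective space of dimension three\<close>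

lemma double_count:
  assumes "finite A" "finite B"
  shows "(\<Sum>a\<in>A. card {b \<in> B. R a b}) = (\<Sum>b\<in>B. card {a \<in> A. R a b})"
  using assms by (intro sum_multicount_gen) auto

lemma card_ex1:
  assumes "\<exists>!x. x \<in> A \<and> P x"
  shows "card {x \<in> A. P x} = 1"
proof -
  obtain x where "x \<in> A \<and> P x" "\<And>y. y \<in> A \<and> P y \<Longrightarrow> y = x" using assms by blast
  then have "{x \<in> A. P x} = {x}" by blast
  then show ?thesis by simp
qed

text \<open>The hypothesis on \<open>t\<close> negates the bound to be proved. The first inequality
  will exclude planes with \<open>5 \<le> s \<le> q - 3\<close>, the second a tangent on which all
  planes have \<open>s \<le> 4\<close>, the last a third plane with \<open>s \<ge> q - 2\<close> at
  a point.\<close>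

lemma tangent_numbers:
  fixes q t :: int
  assumes q: "q \<ge> 8" "even q" and t: "t \<ge> 0" "(t + 3)^2 \<le> 5 * q^2"
  shows "t * (t - 1) < 5 * q * (q - 3)" "4 * (t - 1) < q * (q + 1)" "t < 3 * q - 9"
proof -
  have small: "t < c" if "5 * q^2 < (c + 3)^2" "c \<ge> 0" for c
  proof -
    have "(t + 3)^2 < (c + 3)^2" using t that by linarith
    then show ?thesis using that power_less_imp_less_base[of "t + 3" 2 "c + 3"] by simp
  qed
  have mono: "t * (t - 1) \<le> c * (c - 1)" if "t \<le> c" "c \<ge> 1" for c
    using that t mult_mono[of t c "t - 1" "c - 1"] by (cases "t = 0") auto
  show "t < 3 * q - 9"
  proof (rule small)
    have "(q - 8) * (q - 1) \<ge> 0" using q by simp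
    then show "5 * q^2 < (3 * q - 9 + 3)^2" by (simp add: algebra_simps power2_eq_square)
  qed (use q in simp)
  show "4 * (t - 1) < q * (q + 1)"
  proof (rule ccontr)
    assume "\<not> 4 * (t - 1) < q * (q + 1)"
    then have "4 * (t + 3) \<ge> q^2 + q + 16" by (simp add: algebra_simps power2_eq_square)
    moreover have "(q - 4)^2 \<ge> 0" by simp
    then have "q^2 + q + 16 \<ge> 9 * q" by (simp add: algebra_simps power2_eq_square)
    ultimately have "4 * (t + 3) \<ge> 9 * q" by linarith
    then have "(4 * (t + 3))^2 \<ge> (9 * q)^2" using q by (intro power_mono) auto
    then have "16 * (t + 3)^2 \<ge> 81 * q^2" by (simp only: power_mult_distrib) simp
    then have "q^2 \<le> 0" using t by linarith
    then show False using q by simp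
  qed
  show "t * (t - 1) < 5 * q * (q - 3)"
  proof (cases "q \<ge> 20")
    case True
    show ?thesis
    proof (rule ccontr)
      assume "\<not> ?thesis"
      then have ge: "t * (t - 1) \<ge> 5 * q * (q - 3)" by simp
      \<comment> \<open>Difference of \<open>(t + 3)^2 \<le> 5 q^2\<close> and
        \<open>5 q (q - 3) \<le> t (t - 1)\<close>. So \<open>t\<close> is at most about
        \<open>15 q / 7\<close>, and \<open>(15 / 7)^2 < 5\<close> contradicts the second inequality
        for large \<open>q\<close>.\<close>
      then have "7 * t + 9 \<le> 15 * q" using t by (simp add: algebra_simps power2_eq_square)
      moreover have "t \<ge> 1" using ge True t by (cases "t = 0") (auto simp: mult_le_0_iff)
      ultimately have "(7 * t) * (7 * t - 7) \<le> (15 * q - 9) * (15 * q - 16)"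
        by (intro mult_mono) auto
      then have "49 * (t * (t - 1)) \<le> (15 * q - 9) * (15 * q - 16)" by (simp add: algebra_simps)
      then have "49 * (5 * q * (q - 3)) \<le> (15 * q - 9) * (15 * q - 16)" using ge by linarith
      then have "20 * (q * q) \<le> 360 * q + 144" by (simp add: algebra_simps)
      moreover have "q * q \<ge> 20 * q" using True by (intro mult_right_mono) auto
      ultimately show False using True by linarith
    qed
  next
    case False
    \<comment> \<open>For these \<open>q\<close> the real bound \<open>sqrt 5 * q - 3\<close> on
      \<open>t\<close> is slightly too weak; it has to be rounded down to an integer.\<close>
    then have "q = 8 \<or> q = 10 \<or> q = 12 \<or> q = 14 \<or> q = 16 \<or> q = 18" using q by presburger
    then show ?thesis
    proof (elim disjE)
      assume h: "q = 8"
      then have "t < 15" by (intro small) auto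
      then show ?thesis using mono[of 14] h by simp
    next
      assume h: "q = 10"
      then have "t < 20" by (intro small) auto
      then show ?thesis using mono[of 19] h by simp
    next
      assume h: "q = 12"
      then have "t < 24" by (intro small) auto
      then show ?thesis using mono[of 23] h by simp
    next
      assume h: "q = 14"
      then have "t < 29" by (intro small) auto
      then show ?thesis using mono[of 28] h by simp
    next
      assume h: "q = 16"
      then have "t < 33" by (intro small) auto
      then show ?thesis using mono[of 32] h by simp
    next
      assume h: "q = 18"
      then have "t < 38" by (intro small) auto
      then show ?thesis using mono[of 37] h by simp
    qed
  qed
qed

text \<open>The facts about PG(3,q) on which the counting rests. Lines and planes are sets of
  points, so that their sections with a cap are plain intersections; \<open>pg3_pts\<close> provides
  the instance.\<close>

locale pg3 =
  fixes Pts :: "'p set" and Lns Pls :: "'p set set" and q :: nat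
  assumes fin_Pts: "finite Pts"
    and q_ge2: "q \<ge> 2"
    and line_sub: "L \<in> Lns \<Longrightarrow> L \<subseteq> Pts"
    and plane_sub: "\<pi> \<in> Pls \<Longrightarrow> \<pi> \<subseteq> Pts"
    and card_line: "L \<in> Lns \<Longrightarrow> card L = q + 1"
    and card_plane: "\<pi> \<in> Pls \<Longrightarrow> card \<pi> = q^2 + q + 1"
    and card_Pts: "card Pts = (q^2 + 1) * (q + 1)"
    and line_ex1: "\<lbrakk>P \<in> Pts; R \<in> Pts; P \<noteq> R\<rbrakk> \<Longrightarrow> \<exists>!L. L \<in> Lns \<and> P \<in> L \<and> R \<in> L"
    and plane_ex1: "\<lbrakk>L \<in> Lns; R \<in> Pts; R \<notin> L\<rbrakk> \<Longrightarrow> \<exists>!\<pi>. \<pi> \<in> Pls \<and> L \<subseteq> \<pi> \<and> R \<in> \<pi>"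
    and line_in_plane: "\<lbrakk>\<pi> \<in> Pls; L \<in> Lns; P \<in> \<pi>; R \<in> \<pi>; P \<noteq> R; P \<in> L; R \<in> L\<rbrakk> \<Longrightarrow> L \<subseteq> \<pi>"
    and line_meets_plane: "\<lbrakk>L \<in> Lns; \<pi> \<in> Pls\<rbrakk> \<Longrightarrow> L \<inter> \<pi> \<noteq> {}"
    and coplanar_lines_meet: "\<lbrakk>\<pi> \<in> Pls; L \<in> Lns; L' \<in> Lns; L \<subseteq> \<pi>; L' \<subseteq> \<pi>\<rbrakk> \<Longrightarrow> L \<inter> L' \<noteq> {}"
begin

lemma fin_Lns: "finite Lns" and fin_Pls: "finite Pls"
  using fin_Pts line_sub plane_sub by (auto intro!: finite_subset[of _ "Pow Pts"])

lemma fin_line: "L \<in> Lns \<Longrightarrow> finite L"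
  using fin_Pts line_sub finite_subset by blast

lemma fin_plane: "\<pi> \<in> Pls \<Longrightarrow> finite \<pi>"
  using fin_Pts plane_sub finite_subset by blast

lemma line_unique:
  "\<lbrakk>L \<in> Lns; L' \<in> Lns; P \<in> L; R \<in> L; P \<in> L'; R \<in> L'; P \<noteq> R\<rbrakk> \<Longrightarrow> L = L'"
  using line_ex1[of P R] line_sub by blast

lemma card_lines_meet:
  assumes "L \<in> Lns" "L' \<in> Lns" "L \<noteq> L'"
  shows "card (L \<inter> L') \<le> 1"
proof -
  have "P = R" if "P \<in> L \<inter> L'" "R \<in> L \<inter> L'" for P R
    using line_unique[of L L' P R] assms that by auto
  then show ?thesis
    using fin_line[OF assms(1)] by (simp add: card_le_Suc0_iff_eq)
qed

lemma plane_unique: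
  "\<lbrakk>\<pi> \<in> Pls; \<pi>' \<in> Pls; L \<in> Lns; L \<subseteq> \<pi>; L \<subseteq> \<pi>'; R \<in> \<pi>; R \<in> \<pi>'; R \<notin> L\<rbrakk> \<Longrightarrow> \<pi> = \<pi>'"
  using plane_ex1[of L R] plane_sub by blast

lemma other_point_on_line:
  assumes "L \<in> Lns"
  obtains R where "R \<in> L" "R \<noteq> P"
proof -
  have "\<not> L \<subseteq> {P}"
    using card_line[OF assms] q_ge2 card_mono[of "{P}" L] by auto
  then show ?thesis using that by blast
qed

lemma plane_unique_lines:
  assumes "\<pi> \<in> Pls" "\<pi>' \<in> Pls" "L \<in> Lns" "L' \<in> Lns" "L \<noteq> L'" "P \<in> L" "P \<in> L'"
    "L \<subseteq> \<pi>" "L \<subseteq> \<pi>'" "L' \<subseteq> \<pi>" "L' \<subseteq> \<pi>'"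
  shows "\<pi> = \<pi>'"
proof -
  obtain R where R: "R \<in> L'" "R \<noteq> P" using other_point_on_line assms(4) by metis
  then have "R \<notin> L" using line_unique[of L L' P R] assms by auto
  then show ?thesis using plane_unique[of \<pi> \<pi>' L R] assms R by auto
qed

lemma plane_of_lines:
  assumes "L \<in> Lns" "L' \<in> Lns" "L \<noteq> L'" "P \<in> L" "P \<in> L'"
  shows "\<exists>!\<pi>. \<pi> \<in> Pls \<and> L \<subseteq> \<pi> \<and> L' \<subseteq> \<pi>"
proof -
  obtain R where R: "R \<in> L'" "R \<noteq> P" using other_point_on_line assms(2) by metis
  then have "R \<notin> L" using line_unique[of L L' P R] assms by auto
  moreover have "R \<in> Pts" using R assms line_sub by auto
  ultimately obtain \<pi> where pi: "\<pi> \<in> Pls" "L \<subseteq> \<pi>" "R \<in> \<pi>" using plane_ex1[of L R] assms by auto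
  then have "L' \<subseteq> \<pi>" using line_in_plane[of \<pi> L' P R] assms R by auto
  then show ?thesis using pi plane_unique_lines[of _ _ L L' P] assms by blast
qed

lemma card_line_plane:
  assumes "L \<in> Lns" "\<pi> \<in> Pls" "\<not> L \<subseteq> \<pi>"
  shows "card (L \<inter> \<pi>) = 1"
proof -
  have "P = R" if "P \<in> L \<inter> \<pi>" "R \<in> L \<inter> \<pi>" for P R
    using line_in_plane[of \<pi> L P R] assms that by auto
  then have "card (L \<inter> \<pi>) \<le> 1"
    using fin_line[OF assms(1)] by (simp add: card_le_Suc0_iff_eq)
  moreover have "card (L \<inter> \<pi>) \<noteq> 0"
    using line_meets_plane[OF assms(1,2)] fin_line[OF assms(1)] by simp
  ultimately show ?thesis by linarith
qed

lemma card_lines_pt: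
  assumes P: "P \<in> Pts"
  shows "card {L \<in> Lns. P \<in> L} = q^2 + q + 1"
proof -
  let ?B = "{L \<in> Lns. P \<in> L}"
  have "(\<Sum>R\<in>Pts - {P}. card {L \<in> ?B. R \<in> L}) = (\<Sum>L\<in>?B. card {R \<in> Pts - {P}. R \<in> L})"
    using fin_Pts fin_Lns by (intro double_count) auto
  moreover have "card {L \<in> ?B. R \<in> L} = 1" if "R \<in> Pts - {P}" for R
    using line_ex1[of P R] P that by (intro card_ex1) auto
  moreover have "card {R \<in> Pts - {P}. R \<in> L} = q" if "L \<in> ?B" for L
  proof -
    have "{R \<in> Pts - {P}. R \<in> L} = L - {P}" using that line_sub by auto
    then show ?thesis using that card_line by simp
  qed
  ultimately have "card (Pts - {P}) = card ?B * q" by simp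
  then have "card ?B * q = (q^2 + q + 1) * q"
    using P by (simp add: card_Pts algebra_simps power2_eq_square)
  moreover have "q \<noteq> 0" using q_ge2 by simp
  ultimately show ?thesis by (metis mult_right_cancel)
qed

lemma card_lines_pt_plane:
  assumes pi: "\<pi> \<in> Pls" and P: "P \<in> \<pi>"
  shows "card {L \<in> Lns. P \<in> L \<and> L \<subseteq> \<pi>} = q + 1"
proof -
  let ?B = "{L \<in> Lns. P \<in> L \<and> L \<subseteq> \<pi>}"
  have sub: "\<pi> \<subseteq> Pts" using pi plane_sub by auto
  have "(\<Sum>R\<in>\<pi> - {P}. card {L \<in> ?B. R \<in> L}) = (\<Sum>L\<in>?B. card {R \<in> \<pi> - {P}. R \<in> L})"
    using fin_plane[OF pi] fin_Lns by (intro double_count) auto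
  moreover have "card {L \<in> ?B. R \<in> L} = 1" if R: "R \<in> \<pi> - {P}" for R
  proof (rule card_ex1)
    obtain L where L: "L \<in> Lns" "P \<in> L" "R \<in> L" using line_ex1[of P R] P R sub by auto
    then have "L \<subseteq> \<pi>" using line_in_plane[of \<pi> L P R] pi P R by auto
    then show "\<exists>!L. L \<in> ?B \<and> R \<in> L" using L line_unique[of _ _ P R] R by blast
  qed
  moreover have "card {R \<in> \<pi> - {P}. R \<in> L} = q" if "L \<in> ?B" for L
  proof -
    have "{R \<in> \<pi> - {P}. R \<in> L} = L - {P}" using that by auto
    then show ?thesis using that card_line by simp
  qed
  ultimately have "card (\<pi> - {P}) = card ?B * q" by simp
  then have "card ?B * q = (q + 1) * q"
    using P by (simp add: card_plane[OF pi] algebra_simps power2_eq_square)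
  moreover have "q \<noteq> 0" using q_ge2 by simp
  ultimately show ?thesis by (metis mult_right_cancel)
qed

lemma card_planes_line:
  assumes L: "L \<in> Lns"
  shows "card {\<pi> \<in> Pls. L \<subseteq> \<pi>} = q + 1"
proof -
  let ?B = "{\<pi> \<in> Pls. L \<subseteq> \<pi>}"
  have "(\<Sum>R\<in>Pts - L. card {\<pi> \<in> ?B. R \<in> \<pi>}) = (\<Sum>\<pi>\<in>?B. card {R \<in> Pts - L. R \<in> \<pi>})"
    using fin_Pts fin_Pls by (intro double_count) auto
  moreover have "card {\<pi> \<in> ?B. R \<in> \<pi>} = 1" if R: "R \<in> Pts - L" for R
    using plane_ex1[of L R] L R by (intro card_ex1) auto
  moreover have "card {R \<in> Pts - L. R \<in> \<pi>} = q^2" if pi: "\<pi> \<in> ?B" for \<pi>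
  proof -
    have "{R \<in> Pts - L. R \<in> \<pi>} = \<pi> - L" using pi plane_sub by auto
    then show ?thesis using pi card_line[OF L] card_plane fin_line[OF L] by (simp add: card_Diff_subset)
  qed
  ultimately have "card (Pts - L) = card ?B * q^2" by simp
  moreover have "card (Pts - L) = (q + 1) * q^2"
    using line_sub[OF L] fin_line[OF L] card_line[OF L]
    by (simp add: card_Pts card_Diff_subset algebra_simps power2_eq_square)
  moreover have "q^2 \<noteq> 0" using q_ge2 by simp
  ultimately show ?thesis by (metis mult_right_cancel)
qed

lemma card_planes_two_pts:
  assumes "P \<in> Pts" "R \<in> Pts" "P \<noteq> R"
  shows "card {\<pi> \<in> Pls. P \<in> \<pi> \<and> R \<in> \<pi>} = q + 1"
proof -
  obtain L where L: "L \<in> Lns" "P \<in> L" "R \<in> L" using line_ex1[OF assms] by auto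
  have "{\<pi> \<in> Pls. P \<in> \<pi> \<and> R \<in> \<pi>} = {\<pi> \<in> Pls. L \<subseteq> \<pi>}"
    using L line_in_plane[of _ L P R] assms(3) by blast
  then show ?thesis using card_planes_line[OF L(1)] by simp
qed

lemma card_planes_pt:
  assumes P: "P \<in> Pts"
  shows "card {\<pi> \<in> Pls. P \<in> \<pi>} = q^2 + q + 1"
proof -
  let ?A = "{L \<in> Lns. P \<in> L}" and ?B = "{\<pi> \<in> Pls. P \<in> \<pi>}"
  have "(\<Sum>L\<in>?A. card {\<pi> \<in> ?B. L \<subseteq> \<pi>}) = (\<Sum>\<pi>\<in>?B. card {L \<in> ?A. L \<subseteq> \<pi>})"
    using fin_Lns fin_Pls by (intro double_count) auto
  moreover have "card {\<pi> \<in> ?B. L \<subseteq> \<pi>} = q + 1" if "L \<in> ?A" for L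
  proof -
    have "{\<pi> \<in> ?B. L \<subseteq> \<pi>} = {\<pi> \<in> Pls. L \<subseteq> \<pi>}" using that by auto
    then show ?thesis using card_planes_line that by simp
  qed
  moreover have "card {L \<in> ?A. L \<subseteq> \<pi>} = q + 1" if "\<pi> \<in> ?B" for \<pi>
    using card_lines_pt_plane[of \<pi> P] that by (simp add: conj_assoc)
  ultimately have "card ?A * (q + 1) = card ?B * (q + 1)" by simp
  then have "card ?A = card ?B" by (metis mult_right_cancel add_is_0 one_neq_zero)
  then show ?thesis using card_lines_pt[OF P] by simp
qed

lemma card_Pls: "card Pls = (q^2 + 1) * (q + 1)"
proof -
  have "(\<Sum>P\<in>Pts. card {\<pi> \<in> Pls. P \<in> \<pi>}) = (\<Sum>\<pi>\<in>Pls. card {P \<in> Pts. P \<in> \<pi>})"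
    using fin_Pts fin_Pls by (intro double_count) auto
  moreover have "card {P \<in> Pts. P \<in> \<pi>} = q^2 + q + 1" if "\<pi> \<in> Pls" for \<pi>
  proof -
    have "{P \<in> Pts. P \<in> \<pi>} = \<pi>" using that plane_sub by auto
    then show ?thesis using card_plane that by simp
  qed
  ultimately have "card Pts * (q^2 + q + 1) = card Pls * (q^2 + q + 1)"
    using card_planes_pt by simp
  then have "card Pts = card Pls" by (metis mult_right_cancel add_is_0 one_neq_zero)
  then show ?thesis using card_Pts by simp
qed

text \<open>A line \<open>h\<close> of the second plane that misses \<open>P\<close> meets the first
  plane in a point \<open>R\<close>, and the line \<open>PR\<close> lies in both planes.\<close>

lemma planes_meet:
  assumes "\<pi> \<in> Pls" "\<pi>' \<in> Pls" "P \<in> \<pi>" "P \<in> \<pi>'"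
  obtains L where "L \<in> Lns" "P \<in> L" "L \<subseteq> \<pi>" "L \<subseteq> \<pi>'"
proof -
  have "card {L \<in> Lns. P \<in> L \<and> L \<subseteq> \<pi>'} \<noteq> 0" using card_lines_pt_plane[OF assms(2,4)] by simp
  then obtain L1 where L1: "L1 \<in> Lns" "P \<in> L1" "L1 \<subseteq> \<pi>'" by (auto simp: card_eq_0_iff)
  obtain R1 where R1: "R1 \<in> L1" "R1 \<noteq> P" using other_point_on_line L1(1) by metis
  have "\<not> \<pi>' \<subseteq> L1"
    using card_mono[of L1 \<pi>'] fin_line[OF L1(1)] card_line[OF L1(1)] card_plane[OF assms(2)] q_ge2 by auto
  then obtain R2 where R2: "R2 \<in> \<pi>'" "R2 \<notin> L1" by auto
  have pts: "R1 \<in> Pts" "R2 \<in> Pts" using R1 R2 L1 assms line_sub plane_sub by blast+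
  have "R1 \<noteq> R2" using R1 R2 by auto
  then obtain h where h: "h \<in> Lns" "R1 \<in> h" "R2 \<in> h" using line_ex1[OF pts] by auto
  have "P \<notin> h" using line_unique[of h L1 P R1] h L1 R1 R2 by auto
  have hs: "h \<subseteq> \<pi>'" using line_in_plane[of \<pi>' h R1 R2] assms h R1 R2 L1 \<open>R1 \<noteq> R2\<close> by auto
  obtain R where R: "R \<in> h" "R \<in> \<pi>" using line_meets_plane[OF h(1) assms(1)] by auto
  then have "R \<noteq> P" using \<open>P \<notin> h\<close> by auto
  then obtain L where L: "L \<in> Lns" "P \<in> L" "R \<in> L"
    using line_ex1[of P R] R hs assms plane_sub by (metis subsetD)
  moreover have "L \<subseteq> \<pi>" using line_in_plane[of \<pi> L P R] L R assms \<open>R \<noteq> P\<close> by auto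
  moreover have "L \<subseteq> \<pi>'" using line_in_plane[of \<pi>' L P R] L R hs assms \<open>R \<noteq> P\<close> by auto
  ultimately show ?thesis using that by blast
qed

end

section \<open>Tangents and plane sections of a cap\<close>

locale pg3_cap = pg3 +
  fixes K :: "'a set"
  assumes K_sub: "K \<subseteq> Pts"
    and cap: "L \<in> Lns \<Longrightarrow> card (L \<inter> K) \<le> 2"
begin

definition m :: "'a set \<Rightarrow> nat" where "m \<pi> = card (\<pi> \<inter> K)"

definition tangents :: "'a \<Rightarrow> 'a set set" where "tangents P = {L \<in> Lns. L \<inter> K = {P}}"

definition tangents_in :: "'a \<Rightarrow> 'a set \<Rightarrow> 'a set set" where
  "tangents_in P \<pi> = {L \<in> tangents P. L \<subseteq> \<pi>}"

definition \<sigma> :: "'a \<Rightarrow> nat" where "\<sigma> Q = card {L \<in> Lns. Q \<in> L \<and> card (L \<inter> K) = 1}"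

lemma fin_K: "finite K"
  using fin_Pts K_sub finite_subset by blast

lemma fin_tangents: "finite (tangents P)" "finite (tangents_in P \<pi>)"
  using fin_Lns by (auto simp: tangents_def tangents_in_def)

lemma tangentsD: "g \<in> tangents P \<Longrightarrow> g \<in> Lns \<and> P \<in> g \<and> P \<in> K"
  unfolding tangents_def by blast

lemma secant_card:
  assumes "L \<in> Lns" "P \<in> L" "P \<in> K" "L \<notin> tangents P"
  shows "card (L \<inter> K) = 2"
proof -
  have "L \<inter> K \<noteq> {P}" using assms(1,4) by (simp add: tangents_def)
  then have "\<not> L \<inter> K \<subseteq> {P}" using assms(2,3) by blast
  then obtain R where "R \<in> L \<inter> K" "R \<noteq> P" by auto
  then have "card {P, R} \<le> card (L \<inter> K)" using assms fin_K by (intro card_mono) auto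
  then show ?thesis using cap[OF assms(1)] \<open>R \<noteq> P\<close> by simp
qed

text \<open>A line of the pencil \<open>B\<close> that is not a tangent carries exactly one further
  point of \<open>K\<close>, and different lines share only \<open>P\<close>. Used for all lines
  through \<open>P\<close> and for those in a plane.\<close>

lemma card_tangents_aux:
  assumes P: "P \<in> K" and B: "B \<subseteq> {L \<in> Lns. P \<in> L}"
  shows "card {L \<in> B. L \<in> tangents P} + card (K \<inter> \<Union>B - {P}) = card B"
proof -
  have finB: "finite B" using B fin_Lns finite_subset by fastforce
  have "(\<Sum>R\<in>K \<inter> \<Union>B - {P}. card {L \<in> B. R \<in> L}) = (\<Sum>L\<in>B. card {R \<in> K \<inter> \<Union>B - {P}. R \<in> L})"
    using fin_K finB by (intro double_count) auto
  moreover have "card {L \<in> B. R \<in> L} = 1" if R: "R \<in> K \<inter> \<Union>B - {P}" for R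
  proof (rule card_ex1)
    obtain L where L: "L \<in> B" "R \<in> L" using R by auto
    have "L' = L" if "L' \<in> B" "R \<in> L'" for L'
      using line_unique[of L' L P R] that B R L by blast
    then show "\<exists>!L. L \<in> B \<and> R \<in> L" using L by blast
  qed
  moreover have "card {R \<in> K \<inter> \<Union>B - {P}. R \<in> L} = (if L \<notin> tangents P then 1 else 0)" if L: "L \<in> B" for L
  proof -
    have eq: "{R \<in> K \<inter> \<Union>B - {P}. R \<in> L} = L \<inter> K - {P}" using L by auto
    have LL: "L \<in> Lns" "P \<in> L" using L B by auto
    show ?thesis
    proof (cases "L \<in> tangents P")
      case True
      then show ?thesis unfolding eq by (simp add: tangents_def)
    next
      case False
      then show ?thesis unfolding eq using secant_card[OF LL P False] LL P by simp
    qed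
  qed
  ultimately have "card (K \<inter> \<Union>B - {P}) = (\<Sum>L\<in>B. if L \<notin> tangents P then 1 else 0)" by simp
  also have "\<dots> = card {L \<in> B. L \<notin> tangents P}"
    using sum.inter_filter[OF finB, of "\<lambda>_. 1::nat" "\<lambda>L. L \<notin> tangents P"] by simp
  finally have 1: "card (K \<inter> \<Union>B - {P}) = card {L \<in> B. L \<notin> tangents P}" .
  have "card B = card ({L \<in> B. L \<in> tangents P} \<union> {L \<in> B. L \<notin> tangents P})"
    by (rule arg_cong[of _ _ card]) auto
  also have "\<dots> = card {L \<in> B. L \<in> tangents P} + card {L \<in> B. L \<notin> tangents P}"
    using finB by (intro card_Un_disjoint) auto
  finally show ?thesis using 1 by simp
qed

lemma card_tangents:
  assumes P: "P \<in> K"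
  shows "card (tangents P) + card K = q^2 + q + 2"
proof -
  let ?B = "{L \<in> Lns. P \<in> L}"
  have PP: "P \<in> Pts" using P K_sub by auto
  have "K \<inter> \<Union>?B - {P} = K - {P}"
  proof (intro equalityI subsetI)
    fix R assume R: "R \<in> K - {P}"
    then obtain L where "L \<in> Lns" "P \<in> L" "R \<in> L" using line_ex1[of P R] PP K_sub by auto
    then show "R \<in> K \<inter> \<Union>?B - {P}" using R by auto
  qed auto
  moreover have "{L \<in> ?B. L \<in> tangents P} = tangents P" by (auto simp: tangents_def)
  ultimately have "card (tangents P) + card (K - {P}) = q^2 + q + 1"
    using card_tangents_aux[OF P order_refl] card_lines_pt[OF PP] by simp
  moreover have "card (K - {P}) + 1 = card K" using P fin_K by (metis Suc_eq_plus1 card_Suc_Diff1)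
  ultimately show ?thesis by simp
qed

lemma card_tangents_in:
  assumes pi: "\<pi> \<in> Pls" and P: "P \<in> K" "P \<in> \<pi>"
  shows "card (tangents_in P \<pi>) + m \<pi> = q + 2"
proof -
  let ?B = "{L \<in> Lns. P \<in> L \<and> L \<subseteq> \<pi>}"
  have sub: "\<pi> \<subseteq> Pts" using pi plane_sub by auto
  have "K \<inter> \<Union>?B - {P} = (\<pi> \<inter> K) - {P}"
  proof (intro equalityI subsetI)
    fix R assume R: "R \<in> (\<pi> \<inter> K) - {P}"
    then obtain L where "L \<in> Lns" "P \<in> L" "R \<in> L" using line_ex1[of P R] P sub by auto
    then show "R \<in> K \<inter> \<Union>?B - {P}" using R line_in_plane[of \<pi> L P R] pi P by auto
  qed auto
  moreover have "{L \<in> ?B. L \<in> tangents P} = tangents_in P \<pi>" by (auto simp: tangents_def tangents_in_def)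
  moreover have "?B \<subseteq> {L \<in> Lns. P \<in> L}" by auto
  ultimately have "card (tangents_in P \<pi>) + card (\<pi> \<inter> K - {P}) = q + 1"
    using card_tangents_aux[OF P(1), of ?B] card_lines_pt_plane[OF pi P(2)] by simp
  moreover have "card (\<pi> \<inter> K - {P}) + 1 = m \<pi>"
    using P fin_K unfolding m_def by (metis Int_iff Suc_eq_plus1 card_Suc_Diff1 finite_Int)
  ultimately show ?thesis by simp
qed

lemma m_pos: "P \<in> K \<Longrightarrow> P \<in> \<pi> \<Longrightarrow> m \<pi> \<ge> 1"
  using fin_K by (auto simp: m_def Suc_le_eq card_gt_0_iff)

lemma m_le: "\<pi> \<in> Pls \<Longrightarrow> m \<pi> \<le> q + 2"
proof (cases "\<pi> \<inter> K = {}")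
  case False
  assume pi: "\<pi> \<in> Pls"
  obtain P where "P \<in> K" "P \<in> \<pi>" using False by auto
  then show ?thesis using card_tangents_in[OF pi] by fastforce
qed (simp add: m_def)

text \<open>A point of \<open>K\<close> on \<open>L\<close> lies in all \<open>q + 1\<close> planes
  on \<open>L\<close>, any other point in exactly one.\<close>

lemma sum_m_line:
  assumes L: "L \<in> Lns"
  shows "(\<Sum>\<pi>\<in>{\<pi> \<in> Pls. L \<subseteq> \<pi>}. m \<pi>) = card K + q * card (L \<inter> K)"
proof -
  let ?B = "{\<pi> \<in> Pls. L \<subseteq> \<pi>}"
  have "(\<Sum>R\<in>K. card {\<pi> \<in> ?B. R \<in> \<pi>}) = (\<Sum>\<pi>\<in>?B. card {R \<in> K. R \<in> \<pi>})"
    using fin_K fin_Pls by (intro double_count) auto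
  also have "\<dots> = (\<Sum>\<pi>\<in>?B. m \<pi>)"
    unfolding m_def by (intro sum.cong arg_cong[of _ _ card]) auto
  finally have 1: "(\<Sum>\<pi>\<in>?B. m \<pi>) = (\<Sum>R\<in>K. card {\<pi> \<in> ?B. R \<in> \<pi>})" by simp
  have 2: "card {\<pi> \<in> ?B. R \<in> \<pi>} = (if R \<in> L then q + 1 else 1)" if R: "R \<in> K" for R
  proof (cases "R \<in> L")
    case True
    then have "{\<pi> \<in> ?B. R \<in> \<pi>} = ?B" by auto
    then show ?thesis using True card_planes_line[OF L] by simp
  next
    case False
    then show ?thesis using plane_ex1[of L R] L R K_sub by (simp, intro card_ex1[simplified]) auto
  qed
  have "(\<Sum>\<pi>\<in>?B. m \<pi>) = (\<Sum>R\<in>K. 1 + q * (if R \<in> L then 1 else 0))"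
    unfolding 1 using 2 by (intro sum.cong) auto
  also have "\<dots> = card K + q * (\<Sum>R\<in>K. if R \<in> L then 1 else 0)"
    by (simp only: sum.distrib sum_distrib_left[symmetric]) simp
  also have "(\<Sum>R\<in>K. if R \<in> L then 1 else 0) = card (L \<inter> K)"
    using fin_K by (simp add: sum.If_cases Int_commute)
  finally show ?thesis .
qed

text \<open>Each tangent has a unique point of contact, so its incidences with \<open>X\<close> can
  be grouped by that point.\<close>

lemma sum_sigma:
  assumes X: "finite X"
  shows "(\<Sum>Q\<in>X. \<sigma> Q) = (\<Sum>P\<in>K. \<Sum>g\<in>tangents P. card (X \<inter> g))"
proof -
  let ?T = "{L \<in> Lns. card (L \<inter> K) = 1}"
  have T: "?T = (\<Union>P\<in>K. tangents P)"
    by (auto simp: tangents_def card_1_singleton_iff)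
  have "(\<Sum>Q\<in>X. \<sigma> Q) = (\<Sum>Q\<in>X. card {L \<in> ?T. Q \<in> L})"
    unfolding \<sigma>_def by (intro sum.cong arg_cong[of _ _ card]) auto
  also have "\<dots> = (\<Sum>g\<in>?T. card {Q \<in> X. Q \<in> g})"
    using X fin_Lns by (intro double_count) auto
  also have "\<dots> = (\<Sum>g\<in>?T. card (X \<inter> g))"
    by (intro sum.cong arg_cong[of _ _ card]) auto
  also have "\<dots> = (\<Sum>P\<in>K. \<Sum>g\<in>tangents P. card (X \<inter> g))"
    unfolding T using fin_K fin_tangents
    by (intro sum.UNION_disjoint) (auto simp: tangents_def)
  finally show ?thesis .
qed

text \<open>Incident pairs of a point of \<open>K\<close> and a plane, weighted by \<open>f\<close>.
  The weights 1 and \<open>m\<close> yield the first two moments of \<open>m\<close>; a general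
  weight lets \<open>sum_weights_ge\<close> add up what is known at each point.\<close>

lemma sum_m_all: "(\<Sum>\<pi>\<in>Pls. f \<pi> * m \<pi>) = (\<Sum>P\<in>K. \<Sum>\<pi>\<in>{\<pi> \<in> Pls. P \<in> \<pi>}. f \<pi>)"
proof -
  have "(\<Sum>\<pi>\<in>Pls. f \<pi> * m \<pi>) = (\<Sum>\<pi>\<in>Pls. \<Sum>P\<in>K. if P \<in> \<pi> then f \<pi> else 0)"
    using fin_K by (intro sum.cong refl) (simp add: m_def sum.If_cases Int_def conj_commute mult.commute)
  also have "\<dots> = (\<Sum>P\<in>K. \<Sum>\<pi>\<in>Pls. if P \<in> \<pi> then f \<pi> else 0)" by (rule sum.swap)
  also have "\<dots> = (\<Sum>P\<in>K. \<Sum>\<pi>\<in>{\<pi> \<in> Pls. P \<in> \<pi>}. f \<pi>)"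
    using fin_Pls by (simp add: sum.inter_filter)
  finally show ?thesis .
qed

lemma sum_m: "(\<Sum>\<pi>\<in>Pls. m \<pi>) = card K * (q^2 + q + 1)"
  using sum_m_all[of "\<lambda>_. 1"] card_planes_pt K_sub by (simp add: subset_eq)

lemma sum_m_pt:
  assumes P: "P \<in> K"
  shows "(\<Sum>\<pi>\<in>{\<pi> \<in> Pls. P \<in> \<pi>}. m \<pi>) = q^2 + q + 1 + (card K - 1) * (q + 1)"
proof -
  let ?B = "{\<pi> \<in> Pls. P \<in> \<pi>}"
  have "(\<Sum>R\<in>K. card {\<pi> \<in> ?B. R \<in> \<pi>}) = (\<Sum>\<pi>\<in>?B. card {R \<in> K. R \<in> \<pi>})"
    using fin_K fin_Pls by (intro double_count) auto
  also have "\<dots> = (\<Sum>\<pi>\<in>?B. m \<pi>)"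
    unfolding m_def by (intro sum.cong arg_cong[of _ _ card]) auto
  finally have 1: "(\<Sum>\<pi>\<in>?B. m \<pi>) = (\<Sum>R\<in>K. card {\<pi> \<in> ?B. R \<in> \<pi>})" by simp
  have "card {\<pi> \<in> ?B. R \<in> \<pi>} = q + 1" if "R \<in> K - {P}" for R
    using card_planes_two_pts[of P R] that P K_sub by auto
  moreover have "card {\<pi> \<in> ?B. P \<in> \<pi>} = q^2 + q + 1"
    using card_planes_pt[of P] P K_sub by auto
  ultimately show ?thesis unfolding 1 using sum.remove[OF fin_K P, of "\<lambda>R. card {\<pi> \<in> ?B. R \<in> \<pi>}"] P fin_K
    by simp
qed

lemma sum_m_squared: "(\<Sum>\<pi>\<in>Pls. m \<pi> * m \<pi>) = card K * (q^2 + q + 1 + (card K - 1) * (q + 1))"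
  using sum_m_all[of m] sum_m_pt by simp

lemma plane_of_line_pt:
  assumes "L \<in> Lns" "S \<in> K" "S \<notin> L"
  obtains \<pi> where "\<pi> \<in> Pls" "L \<subseteq> \<pi>" "S \<in> \<pi>"
  using plane_ex1[of L S] assms K_sub by blast

end

text \<open>Characteristic 2 enters only through \<open>planar\<close>; \<open>even_q\<close> just spares the numerical case \<open>q = 9\<close>.\<close>

locale pg3_complete_cap = pg3_cap +
  assumes q_ge8: "q \<ge> 8"
    and even_q: "even q"
    and planar: "\<lbrakk>\<pi> \<in> Pls; L \<in> Lns; L \<subseteq> \<pi>; card (L \<inter> K) = 2; Q \<in> L; Q \<notin> K\<rbrakk>
      \<Longrightarrow> card {g \<in> Lns. g \<subseteq> \<pi> \<and> Q \<in> g \<and> card (g \<inter> K) = 1} + card (\<pi> \<inter> K) \<le> q + 2"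
    and complete: "\<lbrakk>Q \<in> Pts; Q \<notin> K\<rbrakk> \<Longrightarrow> \<exists>L\<in>Lns. Q \<in> L \<and> card (L \<inter> K) = 2"
begin

section \<open>The two basic inequalities for complete caps\<close>

definition t :: nat where "t = q^2 + q + 2 - card K"

lemma t_card: "t + card K = q^2 + q + 2"
proof (cases "K = {}")
  case False
  then obtain P where "P \<in> K" by auto
  then show ?thesis using card_tangents by (force simp: t_def)
next
  case True
  then have "card K = 0" by simp
  then show ?thesis by (simp add: t_def)
qed

lemma card_tangents_t: "P \<in> K \<Longrightarrow> card (tangents P) = t"
  using card_tangents t_card by fastforce

text \<open>By completeness \<open>Q\<close> lies on a bisecant \<open>L\<close>, and each tangent
  through \<open>Q\<close> lies in one plane on \<open>L\<close>. Such a plane has at most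
  \<open>q + 2 - m\<close> of them; since the \<open>m\<close> add up to
  \<open>card K + 2 q\<close>, the total is at most
  \<open>(q + 1) (q + 2) - card K - 2 q = t\<close>.\<close>

lemma sigma_le:
  assumes Q: "Q \<in> Pts" "Q \<notin> K"
  shows "\<sigma> Q \<le> t"
proof -
  obtain L where L: "L \<in> Lns" "Q \<in> L" "card (L \<inter> K) = 2" using complete[OF Q] by auto
  let ?A = "{g \<in> Lns. Q \<in> g \<and> card (g \<inter> K) = 1}" and ?B = "{\<pi> \<in> Pls. L \<subseteq> \<pi>}"
  have "(\<Sum>g\<in>?A. card {\<pi> \<in> ?B. g \<subseteq> \<pi>}) = (\<Sum>\<pi>\<in>?B. card {g \<in> ?A. g \<subseteq> \<pi>})"
    using fin_Lns fin_Pls by (intro double_count) auto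
  moreover have "card {\<pi> \<in> ?B. g \<subseteq> \<pi>} = 1" if g: "g \<in> ?A" for g
  proof (rule card_ex1)
    have "g \<noteq> L" using g L by auto
    then show "\<exists>!\<pi>. \<pi> \<in> ?B \<and> g \<subseteq> \<pi>" using plane_of_lines[of L g Q] g L by auto
  qed
  ultimately have "\<sigma> Q = (\<Sum>\<pi>\<in>?B. card {g \<in> ?A. g \<subseteq> \<pi>})" by (simp add: \<sigma>_def)
  then have "\<sigma> Q + (card K + q * 2) = (\<Sum>\<pi>\<in>?B. card {g \<in> ?A. g \<subseteq> \<pi>} + m \<pi>)"
    using sum_m_line[OF L(1)] L(3) by (simp add: sum.distrib)
  also have "\<dots> \<le> (\<Sum>\<pi>\<in>?B. q + 2)"
  proof (rule sum_mono)
    fix \<pi> assume pi: "\<pi> \<in> ?B"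
    have "{g \<in> ?A. g \<subseteq> \<pi>} = {g \<in> Lns. g \<subseteq> \<pi> \<and> Q \<in> g \<and> card (g \<inter> K) = 1}" by auto
    then show "card {g \<in> ?A. g \<subseteq> \<pi>} + m \<pi> \<le> q + 2"
      using planar[of \<pi> L Q] pi L Q by (simp add: m_def)
  qed
  also have "\<dots> = (q + 1) * (q + 2)" using card_planes_line[OF L(1)] by simp
  finally show ?thesis using t_card by (simp add: algebra_simps power2_eq_square)
qed

text \<open>A tangent at a point off the plane meets the plane once, off \<open>K\<close>. A tangent
  at a point of the plane contributes \<open>q\<close> points if it lies in the plane and none
  otherwise.\<close>

lemma plane_sum_sigma:
  assumes pi: "\<pi> \<in> Pls"
  shows "(\<Sum>Q\<in>\<pi> - K. \<sigma> Q) = (card K - m \<pi>) * t + m \<pi> * ((q + 2 - m \<pi>) * q)"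
proof -
  have fin: "finite (\<pi> - K)" using fin_plane[OF pi] by auto
  have val: "(\<Sum>g\<in>tangents P. card ((\<pi> - K) \<inter> g)) = (if P \<in> \<pi> then (q + 2 - m \<pi>) * q else t)"
    if P: "P \<in> K" for P
  proof (cases "P \<in> \<pi>")
    case True
    have "card ((\<pi> - K) \<inter> g) = (if g \<subseteq> \<pi> then q else 0)" if g: "g \<in> tangents P" for g
    proof -
      have gl: "g \<in> Lns" "g \<inter> K = {P}" using g by (auto simp: tangents_def)
      show ?thesis
      proof (cases "g \<subseteq> \<pi>")
        case True
        then have "(\<pi> - K) \<inter> g = g - {P}" using gl by auto
        moreover have "P \<in> g" using gl by auto
        ultimately show ?thesis using True card_line[OF gl(1)] fin_line[OF gl(1)] by simp
      next
        case False
        have "Q = P" if "Q \<in> \<pi>" "Q \<in> g" for Q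
          using line_in_plane[of \<pi> g P Q] False that gl pi \<open>P \<in> \<pi>\<close> by auto
        then have "(\<pi> - K) \<inter> g = {}" using P by auto
        then show ?thesis using False by simp
      qed
    qed
    then have "(\<Sum>g\<in>tangents P. card ((\<pi> - K) \<inter> g)) = (\<Sum>g\<in>tangents P. if g \<subseteq> \<pi> then q else 0)" by simp
    also have "\<dots> = card (tangents_in P \<pi>) * q"
      using sum.inter_filter[OF fin_tangents(1)[of P], of "\<lambda>_. q" "\<lambda>g. g \<subseteq> \<pi>"] by (simp add: tangents_in_def)
    also have "card (tangents_in P \<pi>) = q + 2 - m \<pi>" using card_tangents_in[OF pi P True] by simp
    finally show ?thesis using True by simp
  next
    case False
    have "card ((\<pi> - K) \<inter> g) = 1" if g: "g \<in> tangents P" for g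
    proof -
      have gl: "g \<in> Lns" "g \<inter> K = {P}" using g by (auto simp: tangents_def)
      have "(\<pi> - K) \<inter> g = g \<inter> \<pi>" using gl False by auto
      moreover have "\<not> g \<subseteq> \<pi>" using gl False by auto
      ultimately show ?thesis using card_line_plane[OF gl(1) pi] by simp
    qed
    then show ?thesis using False card_tangents_t[OF P] by simp
  qed
  have "(\<Sum>Q\<in>\<pi> - K. \<sigma> Q) = (\<Sum>P\<in>K. if P \<in> \<pi> then (q + 2 - m \<pi>) * q else t)"
    unfolding sum_sigma[OF fin] using val by (intro sum.cong) auto
  also have "\<dots> = card (K \<inter> \<pi>) * ((q + 2 - m \<pi>) * q) + card (K - \<pi>) * t"
    using fin_K by (simp add: sum.If_cases Diff_eq Int_def Compl_eq)
  also have "card (K - \<pi>) = card K - m \<pi>"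
    using fin_K by (metis Int_commute card_Diff_subset_Int finite_Int m_def)
  finally show ?thesis by (simp add: m_def Int_commute)
qed

lemma m_le_K: "m \<pi> \<le> card K"
  unfolding m_def using fin_K by (intro card_mono) auto

lemma card_plane_off:
  assumes pi: "\<pi> \<in> Pls"
  shows "card (\<pi> - K) + m \<pi> = q^2 + q + 1"
proof -
  have "card (\<pi> - K) = card \<pi> - m \<pi>" unfolding m_def
    using fin_plane[OF pi] by (metis card_Diff_subset_Int finite_Int)
  moreover have "m \<pi> \<le> card \<pi>" unfolding m_def using fin_plane[OF pi] by (intro card_mono) auto
  ultimately show ?thesis using card_plane[OF pi] by simp
qed

text \<open>In \<open>plane_sum_sigma\<close> each point contributes at most \<open>t\<close>, and
  those of \<open>Z\<close> nothing. The set \<open>Z\<close> is empty in \<open>s_bound\<close>; in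
  \<open>no_hyper_line\<close> it consists of points on three lines without tangents.\<close>

lemma plane_ineq:
  assumes pi: "\<pi> \<in> Pls" and Z: "Z \<subseteq> \<pi> - K" "\<And>Q. Q \<in> Z \<Longrightarrow> \<sigma> Q = 0"
  shows "m \<pi> * ((q + 2 - m \<pi>) * q) + t * card K + t * card Z \<le> t * (q^2 + q + 1)"
proof -
  have fin: "finite (\<pi> - K)" using fin_plane[OF pi] by auto
  then have finZ: "finite Z" using Z finite_subset by blast
  have "(\<Sum>Q\<in>\<pi> - K. \<sigma> Q) = (\<Sum>Q\<in>\<pi> - K - Z. \<sigma> Q)"
    using fin Z by (intro sum.mono_neutral_right) auto
  also have "\<dots> \<le> (\<Sum>Q\<in>\<pi> - K - Z. t)"
    using sigma_le plane_sub[OF pi] by (intro sum_mono) auto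
  also have "\<dots> = t * (card (\<pi> - K) - card Z)"
    using finZ Z by (simp add: card_Diff_subset)
  finally have "(card K - m \<pi>) * t + m \<pi> * ((q + 2 - m \<pi>) * q) \<le> t * (card (\<pi> - K) - card Z)"
    using plane_sum_sigma[OF pi] by simp
  moreover have "card Z \<le> card (\<pi> - K)" using fin Z by (intro card_mono) auto
  moreover have "(card K - m \<pi>) * t + m \<pi> * t = card K * t"
    using m_le_K by (simp flip: add_mult_distrib)
  moreover have "t * (card (\<pi> - K) - card Z) + t * card Z = t * card (\<pi> - K)"
    using calculation(2) by (simp flip: add_mult_distrib2)
  moreover have "t * card (\<pi> - K) + t * m \<pi> = t * (q^2 + q + 1)"
    using card_plane_off[OF pi] by (simp flip: add_mult_distrib2)
  ultimately show ?thesis by (simp add: mult.commute)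
qed

text \<open>The number of tangents in the plane at each of its points of \<open>K\<close>. It is an
  integer because differences such as \<open>s - 1\<close> are summed; a plane that misses
  \<open>K\<close> gets \<open>q + 2\<close>.\<close>

definition s :: "'a set \<Rightarrow> int" where "s \<pi> = int q + 2 - int (m \<pi>)"

lemma card_tangents_in_s: "\<lbrakk>\<pi> \<in> Pls; P \<in> K; P \<in> \<pi>\<rbrakk> \<Longrightarrow> int (card (tangents_in P \<pi>)) = s \<pi>"
  using card_tangents_in by (fastforce simp: s_def)

lemma s_le_t:
  assumes "\<pi> \<in> Pls" "P \<in> K" "P \<in> \<pi>"
  shows "s \<pi> \<le> int t"
proof -
  have "card (tangents_in P \<pi>) \<le> card (tangents P)"
    using fin_tangents by (intro card_mono) (auto simp: tangents_in_def)
  then show ?thesis using card_tangents_in_s[OF assms] card_tangents_t[OF assms(2)] by simp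
qed

lemma s_le: "\<lbrakk>P \<in> K; P \<in> \<pi>\<rbrakk> \<Longrightarrow> s \<pi> \<le> int q + 1"
  using m_pos[of P \<pi>] by (simp add: s_def)

lemma s_ge1:
  assumes "\<pi> \<in> Pls" "g \<in> tangents P" "g \<subseteq> \<pi>"
  shows "s \<pi> \<ge> 1"
proof -
  have "P \<in> K" "P \<in> \<pi>" using assms(2,3) tangentsD by blast+
  moreover have "card (tangents_in P \<pi>) > 0"
    using assms fin_tangents(2)[of P \<pi>] by (auto simp: card_gt_0_iff tangents_in_def)
  ultimately show ?thesis using card_tangents_in_s[of \<pi> P] assms(1) by simp
qed

text \<open>This is \<open>plane_ineq\<close> with \<open>Z\<close> empty, after
  \<open>card K\<close> is expressed by \<open>t\<close>. The left side is a concave quadratic in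
  \<open>s\<close>, hence small only near the ends of the range of \<open>s\<close>.\<close>

lemma s_bound:
  assumes pi: "\<pi> \<in> Pls"
  shows "(int q + 2 - s \<pi>) * s \<pi> * int q \<le> int t * (int t - 1)"
proof -
  have "s \<pi> = int (q + 2 - m \<pi>)" using m_le[OF pi] by (simp add: s_def of_nat_diff)
  moreover have "int (m \<pi> * ((q + 2 - m \<pi>) * q) + t * card K) \<le> int (t * (q^2 + q + 1))"
    using plane_ineq[OF pi, of "{}"] by (simp del: of_nat_add of_nat_mult)
  ultimately have "int (m \<pi>) * (s \<pi> * int q) + int t * int (card K) \<le> int t * (int q^2 + int q + 1)"
    by (simp only: of_nat_add of_nat_mult of_nat_power of_nat_1)
  moreover have "int (card K) = int q^2 + int q + 2 - int t"
    using t_card by (metis add_diff_cancel_left' of_nat_add of_nat_numeral of_nat_power add.commute)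
  ultimately show ?thesis by (simp add: s_def algebra_simps)
qed

text \<open>Each of the \<open>t - 1\<close> other tangents at \<open>P\<close> spans one plane with
  \<open>g\<close>. The calculation uses \<open>sum_m_line\<close> instead.\<close>

lemma sum_s_tangent:
  assumes g: "g \<in> tangents P"
  shows "(\<Sum>\<pi>\<in>{\<pi> \<in> Pls. g \<subseteq> \<pi>}. s \<pi> - 1) = int t - 1"
proof -
  have gl: "g \<in> Lns" "card (g \<inter> K) = 1" using g by (auto simp: tangents_def)
  let ?B = "{\<pi> \<in> Pls. g \<subseteq> \<pi>}"
  have "(\<Sum>\<pi>\<in>?B. s \<pi> - 1) = (\<Sum>\<pi>\<in>?B. (int q + 1) - int (m \<pi>))"
    by (intro sum.cong) (auto simp: s_def)
  also have "\<dots> = (int q + 1) * (int q + 1) - int (card K + q)"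
    using sum_m_line[OF gl(1)] card_planes_line[OF gl(1)] gl(2)
    by (simp add: sum_subtractf algebra_simps flip: of_nat_sum)
  also have "\<dots> = int t - 1"
  proof -
    have "int t + int (card K) = int q^2 + int q + 2"
      using t_card by (metis of_nat_add of_nat_numeral of_nat_power)
    then show ?thesis by (simp add: algebra_simps power2_eq_square)
  qed
  finally show ?thesis .
qed

text \<open>Count tangents through the \<open>q\<close> points of \<open>g\<close> other than
  \<open>P\<close>: there are at most \<open>q t\<close> incidences. The line \<open>g\<close> gives
  \<open>q\<close> of them. A tangent at another point \<open>R\<close> of \<open>K\<close> meets
  \<open>g\<close> exactly if it lies in the plane spanned by \<open>g\<close> and \<open>R\<close>,
  so \<open>R\<close> gives \<open>s\<close> of that plane, which has
  \<open>m - 1 = q + 1 - s\<close> such points. Writing \<open>(q + 1 - s) s\<close> as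
  \<open>q + q (s - 1) - s (s - 1)\<close> makes the linear part computable by
  \<open>sum_s_tangent\<close>.\<close>

lemma tangent_ineq:
  assumes g: "g \<in> tangents P"
  shows "int q * (int q + 1) \<le> (\<Sum>\<pi>\<in>{\<pi> \<in> Pls. g \<subseteq> \<pi>}. s \<pi> * (s \<pi> - 1))"
proof -
  let ?B = "{\<pi> \<in> Pls. g \<subseteq> \<pi>}"
  have gl: "g \<in> Lns" "g \<inter> K = {P}" "P \<in> g" "P \<in> K" using tangentsD[OF g] g by (simp_all add: tangents_def)
  define X where "X = g - {P}"
  have finX: "finite X" using fin_line[OF gl(1)] by (simp add: X_def)
  have cardX: "card X = q" using card_line[OF gl(1)] gl by (simp add: X_def)
  define c where "c R = (\<Sum>h\<in>tangents R. card (X \<inter> h))" for R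
  have "(\<Sum>Q\<in>X. \<sigma> Q) \<le> (\<Sum>Q\<in>X. t)"
    using sigma_le line_sub[OF gl(1)] gl(2) by (intro sum_mono) (auto simp: X_def)
  then have le: "(\<Sum>R\<in>K. c R) \<le> q * t"
    by (simp add: sum_sigma[OF finX] cardX c_def)
  have cP: "c P = q"
  proof -
    have "card (X \<inter> h) = 0" if "h \<in> tangents P - {g}" for h
    proof -
      have "X \<inter> h = {}" 
        using line_unique[of h g P] that gl by (auto simp: X_def tangents_def)
      then show ?thesis by simp
    qed
    moreover have "X \<inter> g = X" by (auto simp: X_def)
    ultimately show ?thesis
      unfolding c_def using sum.remove[OF fin_tangents(1) g, of "\<lambda>h. card (X \<inter> h)"] cardX by simp
  qed
  have cR: "int (c R) = s \<pi>" if pi: "\<pi> \<in> ?B" and R: "R \<in> \<pi> \<inter> K - {P}" for R \<pi>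
  proof -
    have "card (X \<inter> h) = (if h \<subseteq> \<pi> then 1 else 0)" if h: "h \<in> tangents R" for h
    proof -
      have hl: "h \<in> Lns" "h \<inter> K = {R}" "R \<in> h" using h by (auto simp: tangents_def)
      have "P \<notin> h" using hl gl R by auto
      then have Xh: "X \<inter> h = g \<inter> h" by (auto simp: X_def)
      show ?thesis
      proof (cases "h \<subseteq> \<pi>")
        case True
        have "g \<noteq> h" using \<open>P \<notin> h\<close> gl by auto
        then have "card (g \<inter> h) \<le> 1" using card_lines_meet[OF gl(1) hl(1)] by simp
        moreover have "card (g \<inter> h) \<noteq> 0"
          using coplanar_lines_meet[of \<pi> g h] pi gl hl True fin_line[OF gl(1)] by simp
        ultimately show ?thesis using True Xh by simp
      next
        case False
        have "R \<notin> g" using gl R by auto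
        then have "g \<inter> h = {}" using line_in_plane[of \<pi> h R] False hl pi R by auto
        then show ?thesis using False Xh by simp
      qed
    qed
    then have "c R = (\<Sum>h\<in>tangents R. if h \<subseteq> \<pi> then 1 else 0)" by (simp add: c_def)
    also have "\<dots> = card (tangents_in R \<pi>)"
      using sum.inter_filter[OF fin_tangents(1)[of R], of "\<lambda>_. 1::nat" "\<lambda>g. g \<subseteq> \<pi>"] by (simp add: tangents_in_def)
    finally show ?thesis using card_tangents_in_s[of \<pi> R] pi R by simp
  qed
  have Kd: "K - {P} = (\<Union>\<pi>\<in>?B. \<pi> \<inter> K - {P})"
  proof (intro equalityI subsetI)
    fix R assume R: "R \<in> K - {P}"
    then have "R \<notin> g" using gl by auto
    then show "R \<in> (\<Union>\<pi>\<in>?B. \<pi> \<inter> K - {P})" using plane_ex1[of g R] gl R K_sub by blast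
  qed auto
  have "(\<Sum>R\<in>K - {P}. int (c R)) = (\<Sum>\<pi>\<in>?B. \<Sum>R\<in>\<pi> \<inter> K - {P}. int (c R))"
    unfolding Kd
  proof (rule sum.UNION_disjoint)
    show "\<forall>i\<in>?B. \<forall>j\<in>?B. i \<noteq> j \<longrightarrow> (i \<inter> K - {P}) \<inter> (j \<inter> K - {P}) = {}"
    proof (intro ballI impI, rule ccontr)
      fix i j assume ij: "i \<in> ?B" "j \<in> ?B" "i \<noteq> j" "(i \<inter> K - {P}) \<inter> (j \<inter> K - {P}) \<noteq> {}"
      then obtain R where "R \<in> i" "R \<in> j" "R \<in> K" "R \<noteq> P" by auto
      moreover then have "R \<notin> g" using gl by auto
      ultimately show False using plane_unique[of i j g R] ij gl by auto
    qed
  qed (use fin_Pls fin_K in auto)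
  also have "\<dots> = (\<Sum>\<pi>\<in>?B. (int q + 1 - s \<pi>) * s \<pi>)"
  proof (intro sum.cong refl)
    fix \<pi> assume pi: "\<pi> \<in> ?B"
    have "card (\<pi> \<inter> K - {P}) + 1 = m \<pi>"
      using pi gl fin_K unfolding m_def by (metis (no_types, lifting) Int_iff Suc_eq_plus1 card_Suc_Diff1 finite_Int mem_Collect_eq subsetD)
    then have "int (card (\<pi> \<inter> K - {P})) = int q + 1 - s \<pi>" by (simp add: s_def)
    moreover have "(\<Sum>R\<in>\<pi> \<inter> K - {P}. int (c R)) = (\<Sum>R\<in>\<pi> \<inter> K - {P}. s \<pi>)"
      using cR[OF pi] by (intro sum.cong) auto
    ultimately show "(\<Sum>R\<in>\<pi> \<inter> K - {P}. int (c R)) = (int q + 1 - s \<pi>) * s \<pi>" by simp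
  qed
  also have "\<dots> = (\<Sum>\<pi>\<in>?B. int q + int q * (s \<pi> - 1) - s \<pi> * (s \<pi> - 1))"
    by (intro sum.cong) (auto simp: algebra_simps)
  also have "\<dots> = (int q + 1) * int q + int q * (int t - 1) - (\<Sum>\<pi>\<in>?B. s \<pi> * (s \<pi> - 1))"
  proof -
    define u where "u \<pi> = s \<pi> - 1" for \<pi>
    have "(\<Sum>\<pi>\<in>?B. u \<pi>) = int t - 1" using sum_s_tangent[OF g] by (simp only: u_def)
    moreover have "(\<Sum>\<pi>\<in>?B. int q + int q * u \<pi> - s \<pi> * u \<pi>)
        = int (card ?B) * int q + int q * (\<Sum>\<pi>\<in>?B. u \<pi>) - (\<Sum>\<pi>\<in>?B. s \<pi> * u \<pi>)"
      by (simp add: sum.distrib sum_subtractf sum_distrib_left)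
    ultimately show ?thesis using card_planes_line[OF gl(1)] by (simp only: u_def) simp
  qed
  finally have 1: "(\<Sum>R\<in>K - {P}. int (c R)) = (int q + 1) * int q + int q * (int t - 1) - (\<Sum>\<pi>\<in>?B. s \<pi> * (s \<pi> - 1))" .
  have "int (\<Sum>R\<in>K. c R) = int q + (\<Sum>R\<in>K - {P}. int (c R))"
    using sum.remove[OF fin_K gl(4), of c] cP by simp
  moreover have "int (\<Sum>R\<in>K. c R) \<le> int (q * t)" using le by (simp del: of_nat_sum of_nat_mult)
  ultimately show ?thesis using 1 by (simp add: algebra_simps)
qed

section \<open>The lower bound for \<open>t\<close>, and plane sections in the case of
  equality\<close>

lemma exists_plane: "P \<in> Pts \<Longrightarrow> \<exists>\<pi>\<in>Pls. P \<in> \<pi>"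
  using card_planes_pt by (metis (no_types, lifting) Suc_eq_plus1 card_eq_0_iff empty_Collect_eq nat.simps(3))

text \<open>Without tangents every plane has 0 or \<open>q + 2\<close> points of \<open>K\<close>.
  Summed over the planes on an external line this makes \<open>q + 2\<close> divide
  \<open>card K = q^2 + q + 2\<close>, hence divide 4.\<close>

lemma t_pos: "t > 0"
proof (rule ccontr)
  assume "\<not> t > 0"
  then have t0: "t = 0" by simp
  then have kK: "card K = q^2 + q + 2" using t_card by simp
  then have "K \<noteq> {}" by auto
  have noT: "tangents P = {}" for P
    using card_tangents_t t0 fin_tangents(1) tangentsD by (metis card_0_eq equals0I)
  have m0: "m \<pi> = 0 \<or> m \<pi> = q + 2" if pi: "\<pi> \<in> Pls" for \<pi>
  proof (cases "\<pi> \<inter> K = {}")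
    case False
    then obtain P where "P \<in> K" "P \<in> \<pi>" by auto
    then show ?thesis using card_tangents_in[OF pi, of P] noT by (simp add: tangents_in_def)
  qed (simp add: m_def)
  obtain P where P: "P \<in> K" using \<open>K \<noteq> {}\<close> by auto
  obtain \<pi> where pi: "\<pi> \<in> Pls" "P \<in> \<pi>" using exists_plane P K_sub by blast
  have mpi: "m \<pi> = q + 2" using m0[OF pi(1)] m_pos[OF P pi(2)] by auto
  have "card (\<pi> - K) > 0" using card_plane_off[OF pi(1)] mpi q_ge8
    by (cases "card (\<pi> - K) = 0") (auto simp: power2_eq_square)
  then obtain Q where Q: "Q \<in> \<pi>" "Q \<notin> K" by (metis DiffE card_gt_0_iff ex_in_conv)
  let ?B = "{L \<in> Lns. Q \<in> L \<and> L \<subseteq> \<pi>}"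
  \<comment> \<open>Otherwise all \<open>q + 1\<close> lines through \<open>Q\<close> in the plane
    would be bisecants, giving \<open>2 (q + 1)\<close> points instead of
    \<open>q + 2\<close>.\<close>
  have "\<exists>L\<in>?B. L \<inter> K = {}"
  proof (rule ccontr)
    assume no: "\<not> (\<exists>L\<in>?B. L \<inter> K = {})"
    have 2: "card {R \<in> \<pi> \<inter> K. R \<in> L} = 2" if L: "L \<in> ?B" for L
    proof -
      obtain R where R: "R \<in> L" "R \<in> K" using no L by blast
      have "{R \<in> \<pi> \<inter> K. R \<in> L} = L \<inter> K" using L by auto
      then show ?thesis using secant_card[of L R] L R noT by simp
    qed
    have "(\<Sum>R\<in>\<pi> \<inter> K. card {L \<in> ?B. R \<in> L}) = (\<Sum>L\<in>?B. card {R \<in> \<pi> \<inter> K. R \<in> L})"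
      using fin_K fin_Lns by (intro double_count) auto
    moreover have "card {L \<in> ?B. R \<in> L} = 1" if R: "R \<in> \<pi> \<inter> K" for R
    proof (rule card_ex1)
      have RQ: "R \<noteq> Q" "R \<in> Pts" "Q \<in> Pts" using R Q K_sub plane_sub[OF pi(1)] by auto
      then obtain L where L: "L \<in> Lns" "Q \<in> L" "R \<in> L" using line_ex1[of Q R] by auto
      then have "L \<subseteq> \<pi>" using line_in_plane[of \<pi> L Q R] pi Q R RQ by auto
      then have "L \<in> ?B \<and> R \<in> L" using L by simp
      moreover have "L' = L" if "L' \<in> ?B \<and> R \<in> L'" for L'
        using line_unique[of L' L Q R] that L RQ by auto
      ultimately show "\<exists>!L. L \<in> ?B \<and> R \<in> L" by (rule ex1I)
    qed
    ultimately have "card (\<pi> \<inter> K) = card ?B * 2" using 2 by simp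
    then show False using mpi card_lines_pt_plane[OF pi(1) Q(1)] q_ge8 by (simp add: m_def)
  qed
  then obtain L where L: "L \<in> Lns" "L \<inter> K = {}" by auto
  have "q + 2 dvd (\<Sum>\<pi>\<in>{\<pi> \<in> Pls. L \<subseteq> \<pi>}. m \<pi>)"
    using m0 by (intro dvd_sum) fastforce
  then have "q + 2 dvd q^2 + q + 2" using sum_m_line[OF L(1)] L(2) kK by simp
  then have "q + 2 dvd q^2 + q + 2 + (q + 2)" by (metis dvd_add dvd_refl)
  moreover have "q^2 + q + 2 + (q + 2) = (q + 2) * q + 4" by (simp add: power2_eq_square algebra_simps)
  ultimately have "q + 2 dvd 4" by (metis dvd_add_right_iff dvd_triv_left)
  then show False using q_ge8 by (auto dest!: dvd_imp_le)
qed

lemma K_nonempty: "K \<noteq> {}"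
proof
  assume "K = {}"
  have "Pts \<noteq> {}" using card_Pts by auto
  then obtain Q where "Q \<in> Pts" by auto
  then show False using complete[of Q] \<open>K = {}\<close> by auto
qed

lemma tangent_exists:
  assumes "P \<in> K" obtains g where "g \<in> tangents P"
  using card_tangents_t[OF assms] t_pos by (metis card_gt_0_iff ex_in_conv)

text \<open>One factor of \<open>s (s - 1)\<close> in \<open>tangent_ineq\<close> is replaced by the
  bound; the other is nonnegative since \<open>g\<close> itself counts in every plane on it.\<close>

lemma sum_s_le:
  assumes g: "g \<in> tangents P" and c: "\<And>\<pi>. \<lbrakk>\<pi> \<in> Pls; g \<subseteq> \<pi>\<rbrakk> \<Longrightarrow> s \<pi> \<le> c"
  shows "int q * (int q + 1) \<le> c * (int t - 1)"
proof -
  let ?B = "{\<pi> \<in> Pls. g \<subseteq> \<pi>}"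
  have "int q * (int q + 1) \<le> (\<Sum>\<pi>\<in>?B. s \<pi> * (s \<pi> - 1))" by (rule tangent_ineq[OF g])
  also have "\<dots> \<le> (\<Sum>\<pi>\<in>?B. c * (s \<pi> - 1))"
  proof (intro sum_mono mult_right_mono)
    show "s \<pi> \<le> c" "0 \<le> s \<pi> - 1" if "\<pi> \<in> ?B" for \<pi>
      using that c[of \<pi>] s_ge1[of \<pi>, OF _ g] by auto
  qed
  also have "\<dots> = c * (int t - 1)" using sum_s_tangent[OF g] by (simp flip: sum_distrib_left)
  finally show ?thesis .
qed

text \<open>A plane holds at most \<open>t\<close> tangents at a point, so \<open>sum_s_le\<close>
  applies with \<open>c = t\<close> and gives \<open>q (q + 1) \<le> t (t - 1)\<close>.\<close>

lemma t_ge: "t \<ge> q + 1"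
proof (rule ccontr)
  assume "\<not> t \<ge> q + 1"
  then have "int t \<le> int q" by simp
  obtain P where P: "P \<in> K" using K_nonempty by auto
  obtain g where g: "g \<in> tangents P" using tangent_exists P by blast
  have "s \<pi> \<le> int t" if "\<pi> \<in> Pls" "g \<subseteq> \<pi>" for \<pi>
    using s_le_t[of \<pi> P] that P tangentsD[OF g] by auto
  then have "int q * (int q + 1) \<le> int t * (int t - 1)" by (rule sum_s_le[OF g])
  also have "\<dots> \<le> int q * (int t - 1)" using \<open>int t \<le> int q\<close> t_pos by (intro mult_right_mono) auto
  also have "\<dots> \<le> int q * int q" using \<open>int t \<le> int q\<close> by (intro mult_left_mono) auto
  finally show False using q_ge8 by (simp add: algebra_simps)
qed

text \<open>If \<open>s \<le> q\<close> on all planes through a tangent, \<open>sum_s_le\<close>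
  would give \<open>q (q + 1) \<le> q^2\<close>. So some plane \<open>\<alpha>\<close> has only
  tangents as lines through \<open>P\<close>; every plane through \<open>P\<close> meets it in one
  of these, whereas a hyperoval plane contains no tangent.\<close>

lemma plane_ovoid:
  assumes tq: "t = q + 1" and pi: "\<pi> \<in> Pls"
  shows "m \<pi> \<le> q + 1"
proof (rule ccontr)
  assume "\<not> m \<pi> \<le> q + 1"
  then have m2: "m \<pi> = q + 2" using m_le[OF pi] by simp
  then obtain P where P: "P \<in> K" "P \<in> \<pi>" unfolding m_def
    by (metis Int_iff add_is_0 card.empty ex_in_conv zero_neq_numeral)
  obtain g where g: "g \<in> tangents P" using tangent_exists P by blast
  have gl: "g \<in> Lns" "P \<in> g" using tangentsD[OF g] by auto
  have "\<exists>\<alpha>\<in>Pls. g \<subseteq> \<alpha> \<and> s \<alpha> = int q + 1"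
  proof (rule ccontr)
    assume no: "\<not> ?thesis"
    have "s \<alpha> \<le> int q" if "\<alpha> \<in> Pls" "g \<subseteq> \<alpha>" for \<alpha>
      using s_le_t[of \<alpha> P] that P gl no tq by force
    then have "int q * (int q + 1) \<le> int q * (int t - 1)" by (rule sum_s_le[OF g])
    then show False using tq q_ge8 by (simp add: algebra_simps)
  qed
  then obtain \<alpha> where a: "\<alpha> \<in> Pls" "g \<subseteq> \<alpha>" "s \<alpha> = int q + 1" by auto
  then have Pa: "P \<in> \<alpha>" using gl by auto
  have "tangents_in P \<alpha> = {L \<in> Lns. P \<in> L \<and> L \<subseteq> \<alpha>}"
    using card_tangents_in_s[OF a(1) P(1) Pa] card_lines_pt_plane[OF a(1) Pa] a fin_Lns
    by (intro card_subset_eq) (auto simp: tangents_in_def tangents_def)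
  moreover obtain L where L: "L \<in> Lns" "P \<in> L" "L \<subseteq> \<pi>" "L \<subseteq> \<alpha>"
    using planes_meet[OF pi a(1) P(2) Pa] by auto
  ultimately have "L \<in> tangents_in P \<pi>" by (auto simp: tangents_in_def)
  then have "card (tangents_in P \<pi>) > 0" using fin_tangents by (auto simp: card_gt_0_iff)
  then show False using card_tangents_in[OF pi P] m2 by simp
qed

section \<open>Points whose tangents are covered by two planes\<close>

lemma card_tangents_in_Int:
  assumes "\<alpha> \<in> Pls" "\<beta> \<in> Pls" "\<alpha> \<noteq> \<beta>"
  shows "card (tangents_in P \<alpha> \<inter> tangents_in P \<beta>) \<le> 1"
proof -
  have "g = h" if "g \<in> tangents_in P \<alpha> \<inter> tangents_in P \<beta>" "h \<in> tangents_in P \<alpha> \<inter> tangents_in P \<beta>" for g h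
    using plane_unique_lines[of \<alpha> \<beta> g h P] that assms tangentsD by (auto simp: tangents_in_def)
  then show ?thesis using fin_tangents by (simp add: card_le_Suc0_iff_eq)
qed


lemma card_two_planes:
  assumes "\<alpha> \<in> Pls" "\<beta> \<in> Pls" "P \<in> \<alpha>" "P \<in> \<beta>" "P \<in> K"
    "tangents P = tangents_in P \<alpha> \<union> tangents_in P \<beta>"
  shows "int t + int (card (tangents_in P \<alpha> \<inter> tangents_in P \<beta>)) = s \<alpha> + s \<beta>"
  using card_Un_Int[OF fin_tangents(2) fin_tangents(2), of P \<alpha> P \<beta>] assms
    card_tangents_t[of P] card_tangents_in_s[of \<alpha> P] card_tangents_in_s[of \<beta> P] by simp

text \<open>Apply \<open>tangent_ineq\<close> to a tangent \<open>g\<close> in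
  \<open>\<alpha>\<close> but not in \<open>\<beta>\<close>. Another plane on \<open>g\<close> meets
  \<open>\<alpha>\<close> and \<open>\<beta>\<close> in one line each, so it has
  \<open>s \<le> 2\<close>, and the terms outside \<open>\<alpha>\<close> become linear.\<close>

lemma long_plane_ineq:
  assumes ab: "\<alpha> \<in> Pls" "\<beta> \<in> Pls" "P \<in> \<alpha>" "P \<in> \<beta>" "P \<in> K" "\<alpha> \<noteq> \<beta>"
    and s: "s \<alpha> \<ge> int q - 2"
    and cover: "tangents P = tangents_in P \<alpha> \<union> tangents_in P \<beta>"
  shows "int q * (int q + 1) \<le> s \<alpha> * s \<alpha> - 3 * s \<alpha> + 2 * int t"
proof -
  have "\<not> tangents_in P \<alpha> \<subseteq> tangents_in P \<beta>"
  proof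
    assume "tangents_in P \<alpha> \<subseteq> tangents_in P \<beta>"
    then have "tangents_in P \<alpha> \<inter> tangents_in P \<beta> = tangents_in P \<alpha>" by auto
    then have "card (tangents_in P \<alpha>) \<le> 1" using card_tangents_in_Int[OF ab(1,2,6), of P] by simp
    then show False using card_tangents_in_s[OF ab(1,5,3)] s q_ge8 by simp
  qed
  then obtain g where g: "g \<in> tangents P" "g \<subseteq> \<alpha>" "\<not> g \<subseteq> \<beta>" by (auto simp: tangents_in_def)
  let ?B = "{\<pi> \<in> Pls. g \<subseteq> \<pi>}"
  have fin: "finite ?B" using fin_Pls by simp
  have aB: "\<alpha> \<in> ?B" using g ab by simp
  have two: "s \<pi> * (s \<pi> - 1) \<le> 2 * (s \<pi> - 1)" if pi: "\<pi> \<in> ?B - {\<alpha>}" for \<pi>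
  proof -
    have Ppi: "P \<in> \<pi>" using pi g tangentsD[OF g(1)] by auto
    have "\<pi> \<noteq> \<beta>" using pi g by auto
    have "tangents_in P \<pi> \<subseteq> (tangents_in P \<alpha> \<inter> tangents_in P \<pi>) \<union> (tangents_in P \<beta> \<inter> tangents_in P \<pi>)"
      using cover by (auto simp: tangents_in_def)
    then have "card (tangents_in P \<pi>) \<le> card ((tangents_in P \<alpha> \<inter> tangents_in P \<pi>) \<union> (tangents_in P \<beta> \<inter> tangents_in P \<pi>))"
      using fin_tangents by (intro card_mono) auto
    also have "\<dots> \<le> 1 + 1"
      using card_Un_le card_tangents_in_Int[of \<alpha> \<pi> P] card_tangents_in_Int[of \<beta> \<pi> P] ab pi \<open>\<pi> \<noteq> \<beta>\<close>
      by (intro order_trans[OF card_Un_le] add_mono) auto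
    finally have "s \<pi> \<le> 2" using card_tangents_in_s[of \<pi> P] pi ab Ppi by simp
    moreover have "s \<pi> \<ge> 1" using s_ge1[of \<pi> g P] pi g by simp
    ultimately show ?thesis by (intro mult_right_mono) auto
  qed
  have "int q * (int q + 1) \<le> (\<Sum>\<pi>\<in>?B. s \<pi> * (s \<pi> - 1))" by (rule tangent_ineq[OF g(1)])
  also have "\<dots> = s \<alpha> * (s \<alpha> - 1) + (\<Sum>\<pi>\<in>?B - {\<alpha>}. s \<pi> * (s \<pi> - 1))"
    by (rule sum.remove[OF fin aB])
  also have "(\<Sum>\<pi>\<in>?B - {\<alpha>}. s \<pi> * (s \<pi> - 1)) \<le> (\<Sum>\<pi>\<in>?B - {\<alpha>}. 2 * (s \<pi> - 1))"
    by (rule sum_mono[OF two])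
  also have "(\<Sum>\<pi>\<in>?B - {\<alpha>}. 2 * (s \<pi> - 1)) = 2 * (int t - 1 - (s \<alpha> - 1))"
  proof -
    have "(\<Sum>\<pi>\<in>?B - {\<alpha>}. s \<pi> - 1) = int t - 1 - (s \<alpha> - 1)"
      using sum.remove[OF fin aB, of "\<lambda>\<pi>. s \<pi> - 1"] sum_s_tangent[OF g(1)] by linarith
    then show ?thesis by (simp only: sum_distrib_left[symmetric])
  qed
  finally show ?thesis by (simp add: algebra_simps)
qed

lemma full_plane:
  assumes a: "\<alpha> \<in> Pls" "P \<in> K" "P \<in> \<alpha>" "s \<alpha> = int q + 1"
  shows "tangents_in P \<alpha> = {L \<in> Lns. P \<in> L \<and> L \<subseteq> \<alpha>}"
  using card_tangents_in_s[OF a(1-3)] card_lines_pt_plane[OF a(1,3)] a fin_Lns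
  by (intro card_subset_eq) (auto simp: tangents_in_def tangents_def)

text \<open>
  The weight \<open>(q - m) (q + 1 - m)\<close> vanishes on the typical planes, those with \<open>q\<close> or \<open>q + 1\<close> points,
  and is about \<open>q\<^sup>2\<close> on planes with very few points. Its total is about \<open>q\<^sup>4\<close>, which is too little
  for two planes with at most two points through each point of \<open>K\<close>, one of them a tangent plane.
\<close>

lemma sum_weights_ge:
  assumes "\<And>P. P \<in> K \<Longrightarrow> \<exists>\<alpha>\<in>Pls. \<exists>\<beta>\<in>Pls. P \<in> \<alpha> \<and> P \<in> \<beta> \<and> \<alpha> \<noteq> \<beta> \<and> m \<alpha> = 1 \<and> (m \<beta> = 1 \<or> m \<beta> = 2)"
  shows "int (card K) * ((int q - 1) * (3 * int q - 2))
    \<le> 2 * (\<Sum>\<pi>\<in>Pls. (int q - int (m \<pi>)) * (int q + 1 - int (m \<pi>)))"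
proof -
  define w :: "'a set \<Rightarrow> nat" where
    \<comment> \<open>Twice the weight of the plane divided by \<open>m\<close>, so that the points
      of a sparse plane together return twice its weight. The factor 2 avoids a fraction at
      \<open>m = 2\<close>.\<close>
    "w \<pi> = (if m \<pi> = 1 then 2 * q * (q - 1) else if m \<pi> = 2 then (q - 1) * (q - 2) else 0)" for \<pi>
  have e: "int (2 * q * (q - 1)) = 2 * int q * (int q - 1)"
    "int ((q - 1) * (q - 2)) = (int q - 1) * (int q - 2)"
    using q_ge8 by (simp_all add: of_nat_diff)
  have w2: "(q - 1) * (q - 2) \<le> 2 * q * (q - 1)"
    by (metis diff_le_self le_trans mult.commute mult_le_mono1 mult_le_mono2 mult_2 le_add1)
  have "2 * q * (q - 1) + (q - 1) * (q - 2) \<le> (\<Sum>\<pi>\<in>{\<pi> \<in> Pls. P \<in> \<pi>}. w \<pi>)" if P: "P \<in> K" for P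
  proof -
    obtain \<alpha> \<beta> where ab: "\<alpha> \<in> Pls" "\<beta> \<in> Pls" "P \<in> \<alpha>" "P \<in> \<beta>" "\<alpha> \<noteq> \<beta>" "m \<alpha> = 1" "m \<beta> = 1 \<or> m \<beta> = 2"
      using assms[OF P] by blast
    have "2 * q * (q - 1) + (q - 1) * (q - 2) \<le> w \<alpha> + w \<beta>"
      using ab w2 by (auto simp: w_def)
    also have "\<dots> = (\<Sum>\<pi>\<in>{\<alpha>, \<beta>}. w \<pi>)" using ab by simp
    also have "\<dots> \<le> (\<Sum>\<pi>\<in>{\<pi> \<in> Pls. P \<in> \<pi>}. w \<pi>)"
      using ab fin_Pls by (intro sum_mono2) auto
    finally show ?thesis .
  qed
  then have "(\<Sum>P\<in>K. 2 * q * (q - 1) + (q - 1) * (q - 2)) \<le> (\<Sum>P\<in>K. \<Sum>\<pi>\<in>{\<pi> \<in> Pls. P \<in> \<pi>}. w \<pi>)"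
    by (rule sum_mono)
  then have "int (card K * (2 * q * (q - 1) + (q - 1) * (q - 2))) \<le> int (\<Sum>\<pi>\<in>Pls. w \<pi> * m \<pi>)"
    unfolding sum_m_all by (simp only: zle_int sum_constant of_nat_id)
  also have "\<dots> = (\<Sum>\<pi>\<in>Pls. int (w \<pi> * m \<pi>))" by simp
  also have "\<dots> \<le> (\<Sum>\<pi>\<in>Pls. 2 * ((int q - int (m \<pi>)) * (int q + 1 - int (m \<pi>))))"
  proof (rule sum_mono)
    fix \<pi> assume "\<pi> \<in> Pls"
    have nonneg: "(x::int) * (x + 1) \<ge> 0" for x
    proof (cases "x \<ge> 0")
      case False
      then show ?thesis by (intro mult_nonpos_nonpos) auto
    qed simp
    have "2 * ((int q - int (m \<pi>)) * (int q + 1 - int (m \<pi>))) \<ge> 0"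
      using nonneg[of "int q - int (m \<pi>)"] by (simp add: algebra_simps)
    moreover have "int (w \<pi> * m \<pi>) = (if m \<pi> = 1 then 2 * int q * (int q - 1)
        else if m \<pi> = 2 then (int q - 1) * (int q - 2) * 2 else 0)"
      unfolding w_def using e by (simp del: of_nat_mult)
    ultimately show "int (w \<pi> * m \<pi>) \<le> 2 * ((int q - int (m \<pi>)) * (int q + 1 - int (m \<pi>)))"
      by (auto simp: algebra_simps)
  qed
  also have "\<dots> = 2 * (\<Sum>\<pi>\<in>Pls. (int q - int (m \<pi>)) * (int q + 1 - int (m \<pi>)))"
    by (simp only: sum_distrib_left)
  finally show ?thesis unfolding of_nat_mult[of "card K"] of_nat_add e by (simp add: algebra_simps)
qed

text \<open>The number of planes and the first two moments of \<open>m\<close> determine the total,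
  so it depends only on \<open>q\<close> and \<open>card K\<close>.\<close>

lemma sum_weights_eq:
  "(\<Sum>\<pi>\<in>Pls. (int q - int (m \<pi>)) * (int q + 1 - int (m \<pi>)))
    = int q * (int q + 1) * ((int q ^ 2 + 1) * (int q + 1)) - 2 * int q * (int (card K) * (int q ^ 2 + int q + 1))
      + int (card K) * (int (card K) - 1) * (int q + 1)"
proof -
  have "card K \<ge> 1" using K_nonempty fin_K by (simp add: Suc_le_eq card_gt_0_iff)
  then have sq: "(\<Sum>\<pi>\<in>Pls. int (m \<pi>) * int (m \<pi>))
      = int (card K) * (int q ^ 2 + int q + 1 + (int (card K) - 1) * (int q + 1))"
    using arg_cong[OF sum_m_squared, of int] by (simp add: of_nat_diff) (simp add: algebra_simps)
  have lin: "(\<Sum>\<pi>\<in>Pls. int (m \<pi>)) = int (card K) * (int q ^ 2 + int q + 1)"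
    using arg_cong[OF sum_m, of int] by (simp add: algebra_simps)
  have const: "int (card Pls) = (int q ^ 2 + 1) * (int q + 1)"
    using arg_cong[OF card_Pls, of int] by (simp add: algebra_simps)
  have "(\<Sum>\<pi>\<in>Pls. (int q - int (m \<pi>)) * (int q + 1 - int (m \<pi>)))
    = (\<Sum>\<pi>\<in>Pls. int q * (int q + 1) - (2 * int q + 1) * int (m \<pi>) + int (m \<pi>) * int (m \<pi>))"
    by (intro sum.cong) (auto simp: algebra_simps)
  also have "\<dots> = int (card Pls) * (int q * (int q + 1)) - (2 * int q + 1) * (\<Sum>\<pi>\<in>Pls. int (m \<pi>))
      + (\<Sum>\<pi>\<in>Pls. int (m \<pi>) * int (m \<pi>))"
    by (simp add: sum.distrib sum_subtractf sum_distrib_left)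
  finally show ?thesis unfolding sq lin const by (simp add: algebra_simps)
qed

text \<open>
  The bisecants \<open>L\<close> that occur when the two planes of tangents at \<open>P\<close> meet in a line that is not
  a tangent: the planes on \<open>L\<close> are these two planes and planes meeting \<open>K\<close> in a hyperoval.
\<close>

definition hyper_line :: "'a \<Rightarrow> 'a set \<Rightarrow> bool" where
  "hyper_line P L \<longleftrightarrow> L \<in> Lns \<and> P \<in> L \<and> card (L \<inter> K) = 2 \<and>
    (\<forall>\<pi>\<in>Pls. L \<subseteq> \<pi> \<longrightarrow> m \<pi> = 2 \<or> m \<pi> = q + 2) \<and>
    (\<forall>\<pi>\<in>Pls. P \<in> \<pi> \<and> m \<pi> = q + 2 \<longrightarrow> L \<subseteq> \<pi>)"

text \<open>A tangent through \<open>Q\<close> would touch \<open>K\<close> at a point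
  \<open>R\<close> off \<open>L\<close>. The plane spanned by \<open>L\<close> and \<open>R\<close>
  then has at least three points of \<open>K\<close>, so it is a hyperoval plane and contains no
  tangent.\<close>

lemma hyper_line_sigma:
  assumes "hyper_line P L" "Q \<in> L" "Q \<notin> K"
  shows "\<sigma> Q = 0"
proof -
  have L: "L \<in> Lns" "P \<in> L" "card (L \<inter> K) = 2" and
    pl: "\<And>\<pi>. \<lbrakk>\<pi> \<in> Pls; L \<subseteq> \<pi>\<rbrakk> \<Longrightarrow> m \<pi> = 2 \<or> m \<pi> = q + 2"
    using assms(1) by (auto simp: hyper_line_def)
  have "{g \<in> Lns. Q \<in> g \<and> card (g \<inter> K) = 1} = {}"
  proof (rule ccontr)
    assume "\<not> ?thesis"
    then obtain g R where g: "g \<in> Lns" "Q \<in> g" "g \<inter> K = {R}" by (auto simp: card_1_singleton_iff)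
    have R: "R \<in> K" "R \<in> g" "R \<noteq> Q" using g assms(3) by auto
    have "R \<notin> L"
    proof
      assume "R \<in> L"
      then have "g = L" using line_unique[of g L Q R] g L R assms(2) by auto
      then show False using g(3) L(3) by simp
    qed
    then obtain \<pi> where pi: "\<pi> \<in> Pls" "L \<subseteq> \<pi>" "R \<in> \<pi>" using plane_of_line_pt[OF L(1) R(1)] by auto
    have "card (insert R (L \<inter> K)) \<le> m \<pi>"
      unfolding m_def using pi R fin_K by (intro card_mono) auto
    then have "m \<pi> \<ge> 3" using \<open>R \<notin> L\<close> L(3) fin_K by simp
    then have "m \<pi> = q + 2" using pl[OF pi(1,2)] by auto
    then have "tangents_in R \<pi> = {}"
      using card_tangents_in[OF pi(1) R(1) pi(3)] fin_tangents(2)[of R \<pi>] by simp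
    moreover have "g \<subseteq> \<pi>" using line_in_plane[of \<pi> g Q R] pi g R assms(2) by auto
    then have "g \<in> tangents_in R \<pi>" using g by (simp add: tangents_in_def tangents_def)
    ultimately show False by simp
  qed
  then show ?thesis unfolding \<sigma>_def by (metis card.empty)
qed

section \<open>Excluding caps with \<open>q + 1 < t\<close> and
  \<open>t + 3 \<le> sqrt 5 * q\<close>\<close>

context
  assumes t_gt: "q + 1 < t" and t_upper: "(t + 3)^2 \<le> 5 * q^2"
begin

lemma t_numbers:
  "int t * (int t - 1) < 5 * int q * (int q - 3)" "4 * (int t - 1) < int q * (int q + 1)"
  "int t < 3 * int q - 9"
proof -
  have "int ((t + 3)^2) \<le> int (5 * q^2)" using t_upper by (simp only: zle_int)
  then have "(int t + 3)^2 \<le> 5 * int q^2" by simp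
  then show "int t * (int t - 1) < 5 * int q * (int q - 3)" "4 * (int t - 1) < int q * (int q + 1)"
    "int t < 3 * int q - 9"
    using tangent_numbers[of "int q" "int t"] q_ge8 even_q by auto
qed

text \<open>The quadratic \<open>(q + 2 - s) s\<close> equals \<open>5 (q - 3)\<close> at
  \<open>s = 5\<close> and \<open>s = q - 3\<close> and is no smaller in between;
  \<open>s_bound\<close> does not allow that.\<close>

lemma s_dichotomy:
  assumes "\<pi> \<in> Pls"
  shows "s \<pi> \<le> 4 \<or> s \<pi> \<ge> int q - 2"
proof (rule ccontr)
  assume "\<not> ?thesis"
  then have "0 \<le> (s \<pi> - 5) * (int q - 3 - s \<pi>)" by simp
  then have "5 * (int q - 3) \<le> (int q + 2 - s \<pi>) * s \<pi>" by (simp add: algebra_simps)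
  then have "5 * (int q - 3) * int q \<le> (int q + 2 - s \<pi>) * s \<pi> * int q"
    by (intro mult_right_mono) auto
  also have "\<dots> \<le> int t * (int t - 1)" by (rule s_bound[OF assms])
  finally show False using t_numbers(1) by (simp add: algebra_simps)
qed

lemma long_plane:
  assumes g: "g \<in> tangents P"
  shows "\<exists>\<pi>\<in>Pls. g \<subseteq> \<pi> \<and> s \<pi> \<ge> int q - 2"
proof (rule ccontr)
  assume "\<not> ?thesis"
  then have "s \<pi> \<le> 4" if "\<pi> \<in> Pls" "g \<subseteq> \<pi>" for \<pi> using s_dichotomy[of \<pi>] that by auto
  then have "int q * (int q + 1) \<le> 4 * (int t - 1)" by (rule sum_s_le[OF g])
  then show False using t_numbers(2) by simp
qed

text \<open>One plane has at most \<open>q + 1 < t\<close> tangents at \<open>P\<close>. Three would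
  have at least \<open>3 (q - 2) - 3\<close> together, since any two share at most one line through
  \<open>P\<close>, and this is more than \<open>t\<close>.\<close>

lemma two_long_planes:
  assumes P: "P \<in> K"
  obtains \<alpha> \<beta> where "\<alpha> \<in> Pls" "\<beta> \<in> Pls" "P \<in> \<alpha>" "P \<in> \<beta>" "\<alpha> \<noteq> \<beta>"
    "s \<alpha> \<ge> int q - 2" "s \<beta> \<ge> int q - 2" "tangents P = tangents_in P \<alpha> \<union> tangents_in P \<beta>"
proof -
  obtain g where g: "g \<in> tangents P" using tangent_exists P by blast
  obtain \<alpha> where a: "\<alpha> \<in> Pls" "g \<subseteq> \<alpha>" "s \<alpha> \<ge> int q - 2" using long_plane[OF g] by auto
  have Pa: "P \<in> \<alpha>" using a tangentsD[OF g] by auto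
  have "\<not> tangents P \<subseteq> tangents_in P \<alpha>"
  proof
    assume "tangents P \<subseteq> tangents_in P \<alpha>"
    then have "t \<le> card (tangents_in P \<alpha>)"
      using card_mono[OF fin_tangents(2), of "tangents P" P \<alpha>] card_tangents_t[OF P] by simp
    then show False using card_tangents_in_s[OF a(1) P Pa] s_le[OF P Pa] t_gt by simp
  qed
  then obtain h where h: "h \<in> tangents P" "\<not> h \<subseteq> \<alpha>" by (auto simp: tangents_in_def)
  obtain \<beta> where b: "\<beta> \<in> Pls" "h \<subseteq> \<beta>" "s \<beta> \<ge> int q - 2" using long_plane[OF h(1)] by auto
  have Pb: "P \<in> \<beta>" using b tangentsD[OF h(1)] by auto
  have ab: "\<alpha> \<noteq> \<beta>" using h b by auto
  have "tangents P \<subseteq> tangents_in P \<alpha> \<union> tangents_in P \<beta>"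
  proof (rule ccontr)
    assume "\<not> ?thesis"
    then obtain f where f: "f \<in> tangents P" "\<not> f \<subseteq> \<alpha>" "\<not> f \<subseteq> \<beta>" by (auto simp: tangents_in_def)
    obtain \<gamma> where c: "\<gamma> \<in> Pls" "f \<subseteq> \<gamma>" "s \<gamma> \<ge> int q - 2" using long_plane[OF f(1)] by auto
    have Pc: "P \<in> \<gamma>" using c tangentsD[OF f(1)] by auto
    have ne: "\<alpha> \<noteq> \<gamma>" "\<beta> \<noteq> \<gamma>" using f c by auto
    let ?A = "tangents_in P \<alpha>" and ?B = "tangents_in P \<beta>" and ?C = "tangents_in P \<gamma>"
    note F = fin_tangents(2)
    have 1: "card ?A + card ?B \<le> card (?A \<union> ?B) + 1"
      using card_Un_Int[OF F F, of P \<alpha> P \<beta>] card_tangents_in_Int[OF a(1) b(1) ab, of P] by simp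
    have "card ((?A \<union> ?B) \<inter> ?C) \<le> card (?A \<inter> ?C) + card (?B \<inter> ?C)"
      using card_Un_le[of "?A \<inter> ?C" "?B \<inter> ?C"] by (simp add: Int_Un_distrib2)
    then have "card ((?A \<union> ?B) \<inter> ?C) \<le> 2"
      using card_tangents_in_Int[OF a(1) c(1) ne(1), of P] card_tangents_in_Int[OF b(1) c(1) ne(2), of P] by simp
    then have 2: "card (?A \<union> ?B) + card ?C \<le> card (?A \<union> ?B \<union> ?C) + 2"
      using card_Un_Int[of "?A \<union> ?B" ?C] F by simp
    have "card (?A \<union> ?B \<union> ?C) \<le> t"
      unfolding card_tangents_t[OF P, symmetric]
      using fin_tangents by (intro card_mono) (auto simp: tangents_in_def)
    then have "int (card ?A) + int (card ?B) + int (card ?C) \<le> int t + 3" using 1 2 by simp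
    then show False using card_tangents_in_s[OF a(1) P Pa] card_tangents_in_s[OF b(1) P Pb]
      card_tangents_in_s[OF c(1) P Pc] a b c t_numbers(3) by simp
  qed
  then have "tangents P = tangents_in P \<alpha> \<union> tangents_in P \<beta>" by (auto simp: tangents_in_def)
  then show ?thesis using that a b Pa Pb ab by blast
qed

text \<open>Covering gives \<open>t \<le> s \<alpha> + q + 1\<close>. Inserted in
  \<open>long_plane_ineq\<close> this forces \<open>s \<alpha> \<ge> q\<close>, and for
  \<open>s \<alpha> = q\<close> the same inequality reads \<open>4 q \<le> 2 t\<close>.\<close>

lemma long_plane_s:
  assumes ab: "\<alpha> \<in> Pls" "\<beta> \<in> Pls" "P \<in> \<alpha>" "P \<in> \<beta>" "P \<in> K" "\<alpha> \<noteq> \<beta>"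
    and s: "s \<alpha> \<ge> int q - 2"
    and cover: "tangents P = tangents_in P \<alpha> \<union> tangents_in P \<beta>"
  shows "s \<alpha> = int q + 1 \<or> s \<alpha> = int q \<and> t \<ge> 2 * q"
proof -
  have ineq: "int q * (int q + 1) \<le> s \<alpha> * s \<alpha> - 3 * s \<alpha> + 2 * int t"
    by (rule long_plane_ineq[OF ab s cover])
  have "int t \<le> s \<alpha> + s \<beta>" using card_two_planes[OF ab(1-5) cover] by simp
  then have "int t \<le> s \<alpha> + int q + 1" using s_le[OF ab(5,4)] by simp
  then have le: "int q * (int q + 1) \<le> s \<alpha> * (s \<alpha> - 1) + 2 * int q + 2"
    using ineq by (simp add: algebra_simps)
  have "s \<alpha> \<ge> int q"
  proof (rule ccontr)
    assume "\<not> ?thesis"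
    then have "s \<alpha> * (s \<alpha> - 1) \<le> (int q - 1) * (int q - 2)"
      using s q_ge8 by (intro mult_mono) auto
    then show False using le q_ge8 by (simp add: algebra_simps)
  qed
  then have "s \<alpha> = int q + 1 \<or> s \<alpha> = int q" using s_le[OF ab(5,3)] by auto
  moreover have "t \<ge> 2 * q" if "s \<alpha> = int q" using ineq unfolding that by (simp add: algebra_simps)
  ultimately show ?thesis by blast
qed

text \<open>Let \<open>L\<close> be the common line. If it is a tangent, then
  \<open>t + 1 = s \<alpha> + s \<beta>\<close>, and two values \<open>q\<close> would give
  \<open>t = 2 q - 1\<close>, against \<open>long_plane_s\<close>. If not, neither plane is full, so
  both values are \<open>q\<close> and \<open>t = 2 q\<close>; every tangent at \<open>P\<close>
  then lies in one of the two planes and differs from \<open>L\<close>, which leaves none for the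
  other planes on \<open>L\<close>.\<close>

lemma point_cases:
  assumes P: "P \<in> K"
  shows "(\<exists>\<alpha>\<in>Pls. \<exists>\<beta>\<in>Pls. P \<in> \<alpha> \<and> P \<in> \<beta> \<and> \<alpha> \<noteq> \<beta> \<and> m \<alpha> = 1 \<and> (m \<beta> = 1 \<or> m \<beta> = 2) \<and> (t = 2 * q \<or> t = 2 * q + 1))
    \<or> (t = 2 * q \<and> (\<exists>L. hyper_line P L))"
proof -
  obtain \<alpha> \<beta> where ab: "\<alpha> \<in> Pls" "\<beta> \<in> Pls" "P \<in> \<alpha>" "P \<in> \<beta>" "\<alpha> \<noteq> \<beta>"
    "s \<alpha> \<ge> int q - 2" "s \<beta> \<ge> int q - 2" "tangents P = tangents_in P \<alpha> \<union> tangents_in P \<beta>"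
    using two_long_planes[OF P] by metis
  have sa: "s \<alpha> = int q + 1 \<or> s \<alpha> = int q \<and> t \<ge> 2 * q"
    using long_plane_s[of \<alpha> \<beta> P] ab P by auto
  have sb: "s \<beta> = int q + 1 \<or> s \<beta> = int q \<and> t \<ge> 2 * q"
    using long_plane_s[of \<beta> \<alpha> P] ab P by auto
  obtain L where L: "L \<in> Lns" "P \<in> L" "L \<subseteq> \<alpha>" "L \<subseteq> \<beta>" using planes_meet[OF ab(1-4)] by auto
  let ?I = "tangents_in P \<alpha> \<inter> tangents_in P \<beta>"
  have ct: "int t + int (card ?I) = s \<alpha> + s \<beta>" using card_two_planes[OF ab(1-4) P ab(8)] .
  have I1: "card ?I \<le> 1" using card_tangents_in_Int[OF ab(1,2,5)] .
  show ?thesis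
  proof (cases "L \<in> tangents P")
    case True
    then have "L \<in> ?I" using L by (simp add: tangents_in_def)
    then have "card ?I \<noteq> 0" using fin_tangents by auto
    then have tt: "int t + 1 = s \<alpha> + s \<beta>" using ct I1 by simp
    have ms: "m \<pi> = 1 \<longleftrightarrow> s \<pi> = int q + 1" "m \<pi> = 2 \<longleftrightarrow> s \<pi> = int q" for \<pi> by (auto simp: s_def)
    have "(s \<alpha> = int q + 1 \<and> (s \<beta> = int q + 1 \<or> s \<beta> = int q)
        \<or> s \<beta> = int q + 1 \<and> (s \<alpha> = int q + 1 \<or> s \<alpha> = int q)) \<and> (t = 2 * q \<or> t = 2 * q + 1)"
      using sa sb tt by auto
    then show ?thesis unfolding ms[symmetric] using ab(1-5) by metis
  next
    case False
    have "s \<pi> \<noteq> int q + 1" if "\<pi> = \<alpha> \<or> \<pi> = \<beta>" for \<pi>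
    proof
      assume "s \<pi> = int q + 1"
      then have "L \<in> tangents_in P \<pi>" using full_plane[of \<pi> P] that ab P L by auto
      then show False using False by (simp add: tangents_in_def)
    qed
    then have sq: "s \<alpha> = int q" "s \<beta> = int q" "t \<ge> 2 * q" using sa sb by auto
    then have t2: "t = 2 * q" using ct by simp
    \<comment> \<open>Of the \<open>q + 1\<close> lines through \<open>P\<close> in such a plane
      \<open>q\<close> are tangents, so \<open>L\<close> is the only exception.\<close>
    have only: "h = L" if h: "\<pi> = \<alpha> \<or> \<pi> = \<beta>" "h \<in> Lns" "P \<in> h" "h \<subseteq> \<pi>" "h \<notin> tangents P" for h \<pi>
    proof (rule ccontr)
      assume "h \<noteq> L"
      have pi: "\<pi> \<in> Pls" "P \<in> \<pi>" "s \<pi> = int q" "L \<subseteq> \<pi>" using h ab sq L by auto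
      let ?D = "{L \<in> Lns. P \<in> L \<and> L \<subseteq> \<pi>}"
      have "tangents_in P \<pi> \<subseteq> ?D - {h, L}"
        using h False by (auto simp: tangents_in_def tangents_def)
      then have "card (tangents_in P \<pi>) \<le> card (?D - {h, L})" using fin_Lns by (intro card_mono) auto
      also have "\<dots> = card ?D - card {h, L}"
        using h L pi by (intro card_Diff_subset) auto
      finally have "card (tangents_in P \<pi>) \<le> q + 1 - 2"
        using card_lines_pt_plane[OF pi(1,2)] \<open>h \<noteq> L\<close> by simp
      then show False using card_tangents_in_s[OF pi(1) P pi(2)] pi(3) q_ge8 by simp
    qed
    have "hyper_line P L"
      unfolding hyper_line_def
    proof (intro conjI ballI impI)
      show "card (L \<inter> K) = 2" using secant_card L P False by auto
    next
      fix \<pi> assume pi: "\<pi> \<in> Pls" "L \<subseteq> \<pi>"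
      then have Ppi: "P \<in> \<pi>" using L by auto
      show "m \<pi> = 2 \<or> m \<pi> = q + 2"
      proof (cases "\<pi> = \<alpha> \<or> \<pi> = \<beta>")
        case True
        then show ?thesis using sq by (auto simp: s_def)
      next
        case no: False
        have "tangents_in P \<pi> = {}"
        proof (rule ccontr)
          assume "tangents_in P \<pi> \<noteq> {}"
          then obtain g where g: "g \<in> tangents P" "g \<subseteq> \<pi>" by (auto simp: tangents_in_def)
          have "g \<in> tangents_in P \<alpha> \<union> tangents_in P \<beta>" using g(1) unfolding ab(8) .
          then obtain \<gamma> where c: "\<gamma> = \<alpha> \<or> \<gamma> = \<beta>" "g \<subseteq> \<gamma>" by (auto simp: tangents_in_def)
          have "g \<noteq> L" using g False by auto
          then have "\<pi> = \<gamma>" using plane_unique_lines[of \<pi> \<gamma> g L P] g c pi L ab tangentsD[OF g(1)] by auto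
          then show False using no c by simp
        qed
        then show ?thesis using card_tangents_in[OF pi(1) P Ppi] by simp
      qed
    next
      fix \<pi> assume pi: "\<pi> \<in> Pls" "P \<in> \<pi> \<and> m \<pi> = q + 2"
      then have "tangents_in P \<pi> = {}"
        using card_tangents_in[OF pi(1) P] fin_tangents(2)[of P \<pi>] by auto
      obtain h where h: "h \<in> Lns" "P \<in> h" "h \<subseteq> \<pi>" "h \<subseteq> \<alpha>" using planes_meet[of \<pi> \<alpha> P] pi ab by auto
      then have "h \<notin> tangents P" using \<open>tangents_in P \<pi> = {}\<close> by (auto simp: tangents_in_def)
      then show "L \<subseteq> \<pi>" using only[of \<alpha> h] h by auto
    qed (use L in auto)
    then show ?thesis using t2 by blast
  qed
qed

text \<open>A plane through \<open>R\<close> with \<open>m = 1\<close> would meet \<open>H\<close>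
  in a tangent, but \<open>H\<close> contains none. So the first alternative of
  \<open>point_cases\<close> fails at \<open>R\<close>.\<close>

lemma hyper_line_inherits:
  assumes H: "H \<in> Pls" "m H = q + 2" and R: "R \<in> H" "R \<in> K"
  shows "\<exists>L. hyper_line R L \<and> L \<subseteq> H"
proof -
  have no: "m \<alpha> \<noteq> 1" if a: "\<alpha> \<in> Pls" "R \<in> \<alpha>" for \<alpha>
  proof
    assume "m \<alpha> = 1"
    then have full: "tangents_in R \<alpha> = {L \<in> Lns. R \<in> L \<and> L \<subseteq> \<alpha>}"
      using full_plane[OF a(1) R(2) a(2)] by (simp add: s_def)
    obtain h where h: "h \<in> Lns" "R \<in> h" "h \<subseteq> H" "h \<subseteq> \<alpha>" using planes_meet[of H \<alpha> R] H R a by auto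
    then have "h \<in> tangents_in R \<alpha>" using full by simp
    then have "h \<in> tangents_in R H" using h by (simp add: tangents_in_def)
    moreover have "tangents_in R H = {}"
      using card_tangents_in[OF H(1) R(2,1)] H(2) fin_tangents(2)[of R H] by simp
    ultimately show False by simp
  qed
  have "\<exists>L. hyper_line R L"
    using point_cases[OF R(2)] by (elim disjE bexE conjE) (auto dest: no)
  then obtain L where L: "hyper_line R L" ..
  then have "L \<subseteq> H" using H R by (simp add: hyper_line_def)
  then show ?thesis using L by blast
qed

text \<open>A hyperoval plane \<open>H\<close> would contain three such bisecants, all of whose points have no tangents.\<close>

lemma no_hyper_line:
  assumes P: "P \<in> K" and t2: "t = 2 * q" and L: "hyper_line P L"
  shows False
proof -
  have LL: "L \<in> Lns" "P \<in> L" "card (L \<inter> K) = 2" using L by (auto simp: hyper_line_def)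
  have kK: "card K + q = q^2 + 2" using t_card t2 by simp
  have "q^2 \<ge> 8 * q" using q_ge8 by (simp add: power2_eq_square)
  then have "card K > 2" using kK q_ge8 by linarith
  \<comment> \<open>A third point of \<open>K\<close> is needed to reach a plane on \<open>L\<close>
    with \<open>m \<noteq> 2\<close>.\<close>
  then have "\<not> K \<subseteq> L \<inter> K" using LL(3) fin_K card_mono[of "L \<inter> K" K] by auto
  then obtain S where S: "S \<in> K" "S \<notin> L" by auto
  obtain H where H: "H \<in> Pls" "L \<subseteq> H" "S \<in> H" using plane_of_line_pt[OF LL(1) S] by auto
  have "card (insert S (L \<inter> K)) \<le> m H"
    unfolding m_def using H S fin_K by (intro card_mono) auto
  then have "m H \<noteq> 2" using S LL(3) fin_K by simp
  then have mH: "m H = q + 2" using L H by (auto simp: hyper_line_def)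
  have ex: "\<exists>L. hyper_line R L \<and> L \<subseteq> H" if "R \<in> H \<inter> K" for R
    using hyper_line_inherits[OF H(1) mH] that by auto
  have hl: "L' \<in> Lns" "card (L' \<inter> K) = 2" "card L' = q + 1" "finite L'" "R \<in> L'" if "hyper_line R L'" for R L'
    using that card_line fin_line by (auto simp: hyper_line_def)
  have big: "card (H \<inter> K) \<ge> 10" using mH q_ge8 by (simp add: m_def)
  have "H \<inter> K \<noteq> {}" using big by (intro notI) simp
  then obtain R1 where R1: "R1 \<in> H \<inter> K" by blast
  obtain L1 where L1: "hyper_line R1 L1" "L1 \<subseteq> H" using ex[OF R1] by auto
  have "\<not> H \<inter> K \<subseteq> L1 \<inter> K"
    using card_mono[of "L1 \<inter> K" "H \<inter> K"] big hl[OF L1(1)] by auto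
  then obtain R2 where R2: "R2 \<in> H \<inter> K" "R2 \<notin> L1" by auto
  obtain L2 where L2: "hyper_line R2 L2" "L2 \<subseteq> H" using ex[OF R2(1)] by auto
  have "\<not> H \<inter> K \<subseteq> (L1 \<inter> K) \<union> (L2 \<inter> K)"
  proof
    assume "H \<inter> K \<subseteq> (L1 \<inter> K) \<union> (L2 \<inter> K)"
    then have "card (H \<inter> K) \<le> card ((L1 \<inter> K) \<union> (L2 \<inter> K))" using fin_K by (intro card_mono) auto
    also have "\<dots> \<le> card (L1 \<inter> K) + card (L2 \<inter> K)" by (rule card_Un_le)
    finally show False using big hl(2)[OF L1(1)] hl(2)[OF L2(1)] by simp
  qed
  then obtain R3 where R3: "R3 \<in> H \<inter> K" "R3 \<notin> L1" "R3 \<notin> L2" by auto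
  obtain L3 where L3: "hyper_line R3 L3" "L3 \<subseteq> H" using ex[OF R3(1)] by auto
  note h1 = hl[OF L1(1)] and h2 = hl[OF L2(1)] and h3 = hl[OF L3(1)]
  have ne: "L1 \<noteq> L2" "L1 \<noteq> L3" "L2 \<noteq> L3" using R2 R3 h1 h2 h3 by auto
  let ?U = "L1 \<union> L2 \<union> L3"
  have 1: "card L1 + card L2 \<le> card (L1 \<union> L2) + 1"
    using card_Un_Int[of L1 L2] card_lines_meet[of L1 L2] h1 h2 ne by simp
  have "card ((L1 \<union> L2) \<inter> L3) \<le> card (L1 \<inter> L3) + card (L2 \<inter> L3)"
    using card_Un_le[of "L1 \<inter> L3" "L2 \<inter> L3"] by (simp add: Int_Un_distrib2)
  also have "\<dots> \<le> 1 + 1"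
    using card_lines_meet[of L1 L3] card_lines_meet[of L2 L3] h1 h2 h3 ne by (intro add_mono) auto
  finally have 2: "card (L1 \<union> L2) + card L3 \<le> card ?U + 2"
    using card_Un_Int[of "L1 \<union> L2" L3] h1 h2 h3 by simp
  have U: "card ?U \<ge> 3 * q" using 1 2 h1 h2 h3 by simp
  have "?U \<inter> K = (L1 \<inter> K) \<union> (L2 \<inter> K) \<union> (L3 \<inter> K)" by auto
  then have "card (?U \<inter> K) \<le> card (L1 \<inter> K) + card (L2 \<inter> K) + card (L3 \<inter> K)"
    using card_Un_le[of "(L1 \<inter> K) \<union> (L2 \<inter> K)" "L3 \<inter> K"] card_Un_le[of "L1 \<inter> K" "L2 \<inter> K"] by simp
  then have UK: "card (?U \<inter> K) \<le> 6" using h1 h2 h3 by simp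
  \<comment> \<open>Three lines cover at least \<open>3 q\<close> points, at most 6 of them in
    \<open>K\<close>. Two lines would only guarantee \<open>2 q - 3\<close> points, fewer than the
    \<open>2 q - 1\<close> that \<open>plane_ineq\<close> permits.\<close>
  define Z where "Z = ?U - K"
  have "card ?U = card (?U \<inter> K) + card Z"
    unfolding Z_def using h1 h2 h3 by (subst card_Un_disjoint[symmetric]) (auto intro: arg_cong[of _ _ card])
  then have cZ: "3 * q \<le> card Z + 6" using U UK by simp
  have "Z \<subseteq> H - K" using L1 L2 L3 by (auto simp: Z_def)
  moreover have "\<sigma> Q = 0" if "Q \<in> Z" for Q
    using that hyper_line_sigma[OF L1(1)] hyper_line_sigma[OF L2(1)] hyper_line_sigma[OF L3(1)] by (auto simp: Z_def)
  ultimately have "m H * ((q + 2 - m H) * q) + t * card K + t * card Z \<le> t * (q^2 + q + 1)"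
    by (rule plane_ineq[OF H(1)])
  \<comment> \<open>The first term vanishes for a hyperoval. Since
    \<open>card K = q^2 - q + 2\<close>, at most \<open>2 q - 1\<close> points of \<open>H\<close>
    can be without tangents.\<close>
  then have "t * (card K + card Z) \<le> t * (q^2 + q + 1)" using mH by (simp add: distrib_left)
  then have "card K + card Z \<le> q^2 + q + 1" using t_pos by (simp only: nat_mult_le_cancel1)
  then show False using kK cZ q_ge8 by linarith
qed

text \<open>With hyper lines excluded, every point lies on the two sparse planes of
  \<open>sum_weights_ge\<close>. Its left side is about \<open>3 q^4\<close>, but twice the total
  weight is only about \<open>2 q^4\<close>.\<close>

lemma no_large_cap: False
proof -
  have "\<exists>\<alpha>\<in>Pls. \<exists>\<beta>\<in>Pls. P \<in> \<alpha> \<and> P \<in> \<beta> \<and> \<alpha> \<noteq> \<beta> \<and> m \<alpha> = 1 \<and> (m \<beta> = 1 \<or> m \<beta> = 2)"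
    and tt: "t = 2 * q \<or> t = 2 * q + 1" if P: "P \<in> K" for P
    using point_cases[OF P] no_hyper_line[OF P] by blast+
  then have le: "int (card K) * ((int q - 1) * (3 * int q - 2))
      \<le> 2 * (int q * (int q + 1) * ((int q ^ 2 + 1) * (int q + 1)) - 2 * int q * (int (card K) * (int q ^ 2 + int q + 1))
      + int (card K) * (int (card K) - 1) * (int q + 1))"
    using sum_weights_ge unfolding sum_weights_eq by blast
  define x where "x = int q"
  have x: "x \<ge> 8" using q_ge8 by (simp add: x_def)
  have k: "int (card K) = x^2 + x + 2 - int t"
    using arg_cong[OF t_card, of int] by (simp add: x_def)
  \<comment> \<open>Both cases end with \<open>x^4\<close> against \<open>8 x^3\<close>, which
    \<open>x \<ge> 8\<close> decides.\<close>
  have cube: "x ^ 4 \<ge> 8 * x ^ 3" "x ^ 3 \<ge> 8 * x ^ 2" "x ^ 2 \<ge> 8 * x"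
    using x by (simp_all add: power_numeral_reduce mult_right_mono)
  have "t = 2 * q \<or> t = 2 * q + 1" using tt K_nonempty by blast
  then show False
  proof
    assume "t = 2 * q"
    then have k: "int (card K) = x^2 - x + 2" using k by (simp add: x_def)
    from le[unfolded k x_def[symmetric]] have "x ^ 4 + 11 * x ^ 2 \<le> 8 * x ^ 3 + 4 * x"
      by (simp add: algebra_simps power_numeral_reduce)
    then show False using cube x by linarith
  next
    assume "t = 2 * q + 1"
    then have k: "int (card K) = x^2 - x + 1" using k by (simp add: x_def)
    from le[unfolded k x_def[symmetric]] have "x ^ 4 + 4 * x ^ 2 + 2 \<le> 8 * x ^ 3 + 3 * x"
      by (simp add: algebra_simps power_numeral_reduce)
    then show False using cube x by linarith
  qed
qed

end

lemma t_cases: "t = q + 1 \<or> 5 * q^2 < (t + 3)^2"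
proof (rule ccontr)
  assume "\<not> ?thesis"
  then have "q + 1 < t" "(t + 3)^2 \<le> 5 * q^2" using t_ge by auto
  then show False by (rule no_large_cap)
qed

end

section \<open>The projective space of a vector space\<close>

text \<open>Translates incidence by inclusion of subspaces into the membership of points that
  \<open>pg3\<close> uses.\<close>

definition ptset :: "('a::{field,finite} ^ 'n) set \<Rightarrow> ('a ^ 'n) set set" where
  "ptset S = {P \<in> pg_points. P \<subseteq> S}"

lemma span_singleton_point: "v \<noteq> 0 \<Longrightarrow> vec.span {v} \<in> pg_points"
  by (simp add: pg_points_def vec.subspace_span)

lemma point_eq_span:
  assumes P: "P \<in> pg_points" and v: "v \<in> P" "v \<noteq> 0"
  shows "P = vec.span {v}"
proof -
  have "vec.span {v} \<subseteq> P" using P v by (intro vec.span_minimal) (auto simp: pg_points_def)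
  then show ?thesis
    using vec.subspace_dim_equal[of "vec.span {v}" P] P v by (simp add: pg_points_def vec.subspace_span)
qed

lemma point_obtain:
  assumes "P \<in> pg_points"
  obtains v where "v \<noteq> 0" "P = vec.span {v}"
proof -
  have "P \<noteq> {0}" using assms by (auto simp: pg_points_def)
  moreover have "0 \<in> P" using assms by (auto simp: pg_points_def vec.subspace_0)
  ultimately obtain v where "v \<in> P" "v \<noteq> 0" by blast
  then show ?thesis using that point_eq_span[OF assms] by blast
qed

lemma span_singleton_subset:
  assumes "vec.subspace S"
  shows "vec.span {v} \<subseteq> S \<longleftrightarrow> v \<in> S"
proof
  show "v \<in> S" if "vec.span {v} \<subseteq> S" using that vec.span_base[of v "{v}"] by auto
  show "vec.span {v} \<subseteq> S" if "v \<in> S" using that assms by (intro vec.span_minimal) auto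
qed

lemma span_singleton_eqD:
  assumes "vec.span {v} = vec.span {w}"
  obtains k where "w = k *s v"
proof -
  have "w \<in> vec.span {v}" using assms vec.span_base[of w "{w}"] by simp
  then show ?thesis using that by (auto simp: vec.span_singleton)
qed

lemma span_singleton_mem_ptset:
  assumes "vec.subspace S" "v \<in> S" "v \<noteq> 0"
  shows "vec.span {v} \<in> ptset S"
  using assms span_singleton_point[of v] by (simp add: ptset_def span_singleton_subset)

lemma ptset_subset_iff:
  assumes "vec.subspace S" "vec.subspace T"
  shows "ptset S \<subseteq> ptset T \<longleftrightarrow> S \<subseteq> T"
proof
  assume sub: "ptset S \<subseteq> ptset T"
  show "S \<subseteq> T"
  proof
    fix v assume "v \<in> S"
    show "v \<in> T"
    proof (cases "v = 0")
      case False
      then have "vec.span {v} \<in> ptset T" using sub span_singleton_mem_ptset[OF assms(1) \<open>v \<in> S\<close>] by auto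
      then show ?thesis by (simp add: ptset_def span_singleton_subset[OF assms(2)])
    qed (simp add: vec.subspace_0 assms)
  qed
qed (auto simp: ptset_def)

text \<open>Each new basis vector \<open>b\<close> multiplies the size by \<open>CARD('a)\<close>,
  as \<open>k *s b + x\<close> determines \<open>k\<close> and \<open>x\<close>.\<close>

lemma card_span_independent:
  fixes B :: "('a::{field,finite} ^ 'n) set"
  assumes "finite B" "vec.independent B"
  shows "card (vec.span B) = CARD('a) ^ card B"
  using assms
proof (induction B rule: finite_induct)
  case (insert b B)
  have ind: "vec.independent B" "b \<notin> vec.span B"
    using insert.prems insert.hyps by (simp_all add: vec.independent_insert)
  have "bij_betw (\<lambda>(k, x). k *s b + x) (UNIV \<times> vec.span B) (vec.span (insert b B))"
    unfolding bij_betw_def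
  proof
    show "inj_on (\<lambda>(k, x). k *s b + x) (UNIV \<times> vec.span B)"
    proof (rule inj_onI, clarsimp)
      fix k x l y assume xy: "x \<in> vec.span B" "y \<in> vec.span B" "k *s b + x = l *s b + y"
      then have eq: "(k - l) *s b = y - x" by (simp add: vec.scale_left_diff_distrib algebra_simps)
      have "k = l"
      proof (rule ccontr)
        assume "k \<noteq> l"
        then have "b = inverse (k - l) *s ((k - l) *s b)" by (simp only: vector_smult_assoc) simp
        then have "b = inverse (k - l) *s (y - x)" unfolding eq .
        then show False using ind(2) xy by (metis vec.span_diff vec.span_scale)
      qed
      then show "k = l \<and> x = y" using xy by simp
    qed
    show "(\<lambda>(k, x). k *s b + x) ` (UNIV \<times> vec.span B) = vec.span (insert b B)"
    proof (intro equalityI subsetI)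
      fix z assume "z \<in> vec.span (insert b B)"
      then obtain k where "z - k *s b \<in> vec.span B" by (auto simp: vec.span_insert)
      then show "z \<in> (\<lambda>(k, x). k *s b + x) ` (UNIV \<times> vec.span B)"
        by (intro image_eqI[of _ _ "(k, z - k *s b)"]) auto
    next
      fix z assume "z \<in> (\<lambda>(k, x). k *s b + x) ` (UNIV \<times> vec.span B)"
      then obtain k x where "x \<in> vec.span B" "z = k *s b + x" by auto
      then have "z - k *s b \<in> vec.span B" by simp
      then show "z \<in> vec.span (insert b B)" by (auto simp: vec.span_insert)
    qed
  qed
  then have "card (vec.span (insert b B)) = CARD('a) * card (vec.span B)"
    by (simp add: bij_betw_same_card[symmetric] card_cartesian_product)
  then show ?case using insert ind by simp
qed simp

lemma card_subspace:
  fixes S :: "('a::{field,finite} ^ 'n) set"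
  assumes "vec.subspace S"
  shows "card S = CARD('a) ^ vec.dim S"
proof -
  obtain B where B: "B \<subseteq> S" "vec.independent B" "S \<subseteq> vec.span B" "card B = vec.dim S"
    using vec.basis_exists[of S] by metis
  then have "vec.span B = S" using assms vec.span_minimal[of B S] by auto
  then show ?thesis using card_span_independent[of B] B by simp
qed

lemma card_field_gt1: "CARD('a::{field,finite}) > 1"
proof -
  have "card {0, 1 :: 'a} \<le> CARD('a)" by (intro card_mono) auto
  then show ?thesis by simp
qed

text \<open>The nonzero vectors of \<open>S\<close> are partitioned by its points, with
  \<open>CARD('a) - 1\<close> vectors in each.\<close>

lemma card_ptset:
  fixes S :: "('a::{field,finite} ^ 'n) set"
  assumes S: "vec.subspace S"
  shows "card (ptset S) * (CARD('a) - 1) + 1 = CARD('a) ^ vec.dim S"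
proof -
  have sub: "vec.subspace P" if "P \<in> ptset S" for P using that by (auto simp: ptset_def pg_points_def)
  have cardP: "card (P - {0}) = CARD('a) - 1" if P: "P \<in> ptset S" for P
    using card_subspace[OF sub[OF P]] P vec.subspace_0[OF sub[OF P]]
    by (simp add: ptset_def pg_points_def)
  have "S - {0} = (\<Union>P\<in>ptset S. P - {0})"
  proof (intro equalityI subsetI)
    fix v assume "v \<in> S - {0}"
    then have "vec.span {v} \<in> ptset S" "v \<in> vec.span {v} - {0}"
      using span_singleton_mem_ptset[OF S] by (auto simp: vec.span_base)
    then show "v \<in> (\<Union>P\<in>ptset S. P - {0})" by blast
  qed (auto simp: ptset_def)
  then have "card (S - {0}) = card (\<Union>P\<in>ptset S. P - {0})" by simp
  also have "\<dots> = (\<Sum>P\<in>ptset S. card (P - {0}))"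
  proof (rule card_UN_disjoint)
    show "\<forall>P\<in>ptset S. \<forall>R\<in>ptset S. P \<noteq> R \<longrightarrow> (P - {0}) \<inter> (R - {0}) = {}"
    proof (intro ballI impI, rule ccontr)
      fix P R assume PR: "P \<in> ptset S" "R \<in> ptset S" "P \<noteq> R" "(P - {0}) \<inter> (R - {0}) \<noteq> {}"
      then obtain v where "v \<in> P" "v \<in> R" "v \<noteq> 0" by auto
      then show False using PR point_eq_span[of P v] point_eq_span[of R v] by (auto simp: ptset_def)
    qed
  qed auto
  also have "\<dots> = card (ptset S) * (CARD('a) - 1)" using cardP by simp
  finally have "card (S - {0}) = card (ptset S) * (CARD('a) - 1)" .
  moreover have "card (S - {0}) + 1 = card S"
    using vec.subspace_0[OF S] by (metis Suc_eq_plus1 card_Suc_Diff1 finite)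
  ultimately show ?thesis using card_subspace[OF S] by simp
qed

lemma card_ptset_dims:
  fixes S :: "('a::{field,finite} ^ 'n) set"
  assumes S: "vec.subspace S"
  defines "q \<equiv> CARD('a)"
  shows "vec.dim S = 2 \<Longrightarrow> card (ptset S) = q + 1"
    and "vec.dim S = 3 \<Longrightarrow> card (ptset S) = q ^ 2 + q + 1"
    and "vec.dim S = 4 \<Longrightarrow> card (ptset S) = (q ^ 2 + 1) * (q + 1)"
proof -
  define r where "r = q - 1"
  have r: "q = r + 1" "r > 0" using card_field_gt1[where 'a='a] by (simp_all add: r_def q_def)
  have e: "card (ptset S) * r + 1 = q ^ vec.dim S" using card_ptset[OF S] by (simp add: q_def r_def)
  have *: "card (ptset S) = c" if "q ^ vec.dim S = c * r + 1" for c using that e r(2) by simp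
  show "card (ptset S) = q + 1" if "vec.dim S = 2"
    by (rule *) (simp add: that r(1) algebra_simps power_numeral_reduce)
  show "card (ptset S) = q ^ 2 + q + 1" if "vec.dim S = 3"
    by (rule *) (simp add: that r(1) algebra_simps power_numeral_reduce)
  show "card (ptset S) = (q ^ 2 + 1) * (q + 1)" if "vec.dim S = 4"
    by (rule *) (simp add: that r(1) algebra_simps power_numeral_reduce)
qed

lemma dim_span_insert:
  assumes "vec.subspace S" "v \<notin> S"
  shows "vec.dim (vec.span (insert v S)) = vec.dim S + 1"
proof -
  have "vec.span S = S" using assms(1) by (rule vec.span_eq_iff[THEN iffD2])
  then show ?thesis using assms(2) by (simp only: vec.dim_span vec.dim_insert) simp
qed

lemma subspace_eq_span_insert:
  assumes S: "vec.subspace S" and v: "v \<notin> S" "v \<in> T" and T: "vec.subspace T" "S \<subseteq> T" "vec.dim T = vec.dim S + 1"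
  shows "T = vec.span (insert v S)"
proof -
  have "vec.span (insert v S) \<subseteq> T" using T v by (intro vec.span_minimal) auto
  then show ?thesis
    using vec.subspace_dim_equal[of "vec.span (insert v S)" T] dim_span_insert[OF S v(1)] T
    by (simp add: vec.subspace_span)
qed

lemma span_insert_span: "vec.span (insert v (vec.span S)) = vec.span (insert v S)"
  by (simp only: vec.span_insert vec.span_span)

lemma span_two_line:
  assumes "u \<noteq> 0" "v \<notin> vec.span {u}"
  shows "vec.span {u, v} \<in> pg_lines"
proof -
  have "vec.span (insert v (vec.span {u})) = vec.span {u, v}"
    by (simp only: span_insert_span insert_commute[of v u])
  then have "vec.dim (vec.span {u, v}) = vec.dim (vec.span {u}) + 1"
    using dim_span_insert[of "vec.span {u}" v, OF vec.subspace_span assms(2)] by metis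
  moreover have "vec.dim (vec.span {u}) = 1" using assms(1) by simp
  ultimately have "vec.dim (vec.span {u, v}) = 2" by linarith
  then show ?thesis unfolding pg_lines_def using vec.subspace_span by blast
qed

lemma line_eq_span:
  assumes L: "L \<in> pg_lines" and u: "u \<in> L" "u \<noteq> 0" and v: "v \<in> L" "v \<notin> vec.span {u}"
  shows "L = vec.span {u, v}"
proof -
  have "L = vec.span (insert v (vec.span {u}))"
    using L u v by (intro subspace_eq_span_insert)
      (auto simp: pg_lines_def vec.subspace_span span_singleton_subset)
  then show ?thesis by (simp add: span_insert_span insert_commute)
qed

lemma line_through:
  assumes P: "P \<in> pg_points" and R: "R \<in> pg_points" and ne: "P \<noteq> R"
  shows "\<exists>!L. L \<in> pg_lines \<and> P \<subseteq> L \<and> R \<subseteq> L"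
proof -
  obtain u where u: "u \<noteq> 0" "P = vec.span {u}" using point_obtain[OF P] .
  obtain v where v: "v \<noteq> 0" "R = vec.span {v}" using point_obtain[OF R] .
  have vu: "v \<notin> vec.span {u}" using point_eq_span[OF P, of v] v u ne by auto
  have "vec.span {u} \<subseteq> vec.span {u, v}" "vec.span {v} \<subseteq> vec.span {u, v}" by (auto intro!: vec.span_mono)
  moreover have "L = vec.span {u, v}" if "L \<in> pg_lines" "P \<subseteq> L" "R \<subseteq> L" for L
    using that u v vu vec.span_base[of u "{u}"] vec.span_base[of v "{v}"] by (intro line_eq_span) auto
  ultimately show ?thesis using span_two_line[OF u(1) vu] u v by blast
qed

text \<open>Dimension formula for the sum inside \<open>W\<close>. It is applied with
  \<open>2 + 3 > 4\<close> to a line and a plane, and with \<open>2 + 2 > 3\<close> to two lines in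
  a plane.\<close>

lemma exists_common_point:
  assumes "vec.subspace S" "vec.subspace T" "vec.subspace W" "S \<subseteq> W" "T \<subseteq> W"
    "vec.dim W < vec.dim S + vec.dim T"
  shows "ptset S \<inter> ptset T \<noteq> {}"
proof -
  let ?U = "{x + y |x y. x \<in> S \<and> y \<in> T}"
  have "?U \<subseteq> W" using vec.subspace_add[OF assms(3)] assms(4,5) by auto
  then have "vec.dim ?U \<le> vec.dim W" by (rule vec.dim_subset)
  then have "vec.dim (S \<inter> T) \<noteq> 0" using vec.dim_sums_Int[OF assms(1,2)] assms(6) by linarith
  then have "\<not> S \<inter> T \<subseteq> {0}" using vec.dim_eq_0[of "S \<inter> T"] by metis
  then obtain v where "v \<in> S" "v \<in> T" "v \<noteq> 0" by auto
  then have "vec.span {v} \<in> ptset S \<inter> ptset T" using span_singleton_mem_ptset assms(1,2) by auto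
  then show ?thesis by auto
qed

definition pg_planes :: "('a::{field,finite} ^ 'n) set set" where
  "pg_planes = {W. vec.subspace W \<and> vec.dim W = 3}"

lemma pg3_pts:
  assumes q: "CARD('a::{field,finite}) = q"
  shows "pg3 (pg_points :: ('a ^ 4) set set) (ptset ` pg_lines) (ptset ` pg_planes) q"
proof
  have UN: "ptset (UNIV :: ('a ^ 4) set) = pg_points" by (auto simp: ptset_def)
  have dimU: "vec.dim (UNIV :: ('a ^ 4) set) = 4" using vec_dim_card[where 'a='a and 'n=4] by simp
  show "finite (pg_points :: ('a ^ 4) set set)" by simp
  show "2 \<le> q" using card_field_gt1[where 'a='a] q by simp
  show "card (pg_points :: ('a ^ 4) set set) = (q\<^sup>2 + 1) * (q + 1)"
    using card_ptset_dims(3)[OF vec.subspace_UNIV, where 'a='a and 'n=4] dimU q UN by simp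
  fix L :: "('a ^ 4) set set"
  show "L \<subseteq> pg_points" if "L \<in> ptset ` pg_lines" using that by (auto simp: ptset_def)
  show "L \<subseteq> pg_points" if "L \<in> ptset ` pg_planes" using that by (auto simp: ptset_def)
  show "card L = q + 1" if "L \<in> ptset ` pg_lines"
    using that card_ptset_dims(1) q by (auto simp: pg_lines_def)
  show "card L = q\<^sup>2 + q + 1" if "L \<in> ptset ` pg_planes"
    using that card_ptset_dims(2) q by (auto simp: pg_planes_def)
next
  fix P R :: "('a ^ 4) set"
  assume PR: "P \<in> pg_points" "R \<in> pg_points" "P \<noteq> R"
  obtain L where L: "L \<in> pg_lines" "P \<subseteq> L" "R \<subseteq> L" 
    and uniq: "\<And>L'. L' \<in> pg_lines \<Longrightarrow> P \<subseteq> L' \<Longrightarrow> R \<subseteq> L' \<Longrightarrow> L' = L" using line_through[OF PR] by blast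
  show "\<exists>!L. L \<in> ptset ` pg_lines \<and> P \<in> L \<and> R \<in> L"
  proof (rule ex1I)
    show "ptset L \<in> ptset ` pg_lines \<and> P \<in> ptset L \<and> R \<in> ptset L" using L PR by (simp add: ptset_def)
  qed (use uniq in \<open>auto simp: ptset_def\<close>)
next
  fix L :: "('a ^ 4) set set" and R :: "('a ^ 4) set"
  assume L: "L \<in> ptset ` pg_lines" and R: "R \<in> pg_points" "R \<notin> L"
  obtain M where M: "M \<in> pg_lines" "L = ptset M" using L by auto
  have Ms: "vec.subspace M" "vec.dim M = 2" using M by (auto simp: pg_lines_def)
  obtain v where v: "v \<noteq> 0" "R = vec.span {v}" using point_obtain[OF R(1)] .
  have vM: "v \<notin> M" using R M v span_singleton_subset[OF Ms(1)] by (auto simp: ptset_def)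
  let ?W = "vec.span (insert v M)"
  have W: "?W \<in> pg_planes" using dim_span_insert[OF Ms(1) vM] Ms by (simp add: pg_planes_def vec.subspace_span)
  show "\<exists>!\<pi>. \<pi> \<in> ptset ` pg_planes \<and> L \<subseteq> \<pi> \<and> R \<in> \<pi>"
  proof (rule ex1I)
    have "R \<subseteq> ?W" unfolding v by (rule vec.span_mono) auto
    moreover have "M \<subseteq> ?W" using vec.span_superset[of "insert v M"] by auto
    ultimately show "ptset ?W \<in> ptset ` pg_planes \<and> L \<subseteq> ptset ?W \<and> R \<in> ptset ?W"
      using W R(1) unfolding M by (auto simp: ptset_def)
  next
    fix \<pi> assume "\<pi> \<in> ptset ` pg_planes \<and> L \<subseteq> \<pi> \<and> R \<in> \<pi>"
    then obtain T where T: "T \<in> pg_planes" "\<pi> = ptset T" "ptset M \<subseteq> ptset T" "R \<subseteq> T" unfolding M by (auto simp: ptset_def)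
    have Ts: "vec.subspace T" "vec.dim T = 3" using T by (auto simp: pg_planes_def)
    have "M \<subseteq> T" using T(3) ptset_subset_iff[OF Ms(1) Ts(1)] by simp
    moreover have "v \<in> T" using T(4) v span_singleton_subset[OF Ts(1)] by simp
    ultimately show "\<pi> = ptset ?W" using subspace_eq_span_insert[OF Ms(1) vM _ Ts(1)] Ts Ms T by simp
  qed
next
  fix \<pi> L :: "('a ^ 4) set set" and P R :: "('a ^ 4) set"
  assume A: "\<pi> \<in> ptset ` pg_planes" "L \<in> ptset ` pg_lines" "P \<in> \<pi>" "R \<in> \<pi>" "P \<noteq> R" "P \<in> L" "R \<in> L"
  obtain M W where MW: "M \<in> pg_lines" "L = ptset M" "W \<in> pg_planes" "\<pi> = ptset W" using A by auto
  have pts: "P \<in> pg_points" "R \<in> pg_points" using A MW by (auto simp: ptset_def)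
  obtain u where u: "u \<noteq> 0" "P = vec.span {u}" using point_obtain[OF pts(1)] .
  obtain v where v: "v \<noteq> 0" "R = vec.span {v}" using point_obtain[OF pts(2)] .
  have vu: "v \<notin> vec.span {u}" using point_eq_span[OF pts(1), of v] v u A(5) by auto
  have Ws: "vec.subspace W" and Ms: "vec.subspace M" using MW by (auto simp: pg_planes_def pg_lines_def)
  have "u \<in> M" "v \<in> M" "u \<in> W" "v \<in> W"
    using A MW u v span_singleton_subset[OF Ws] span_singleton_subset[OF Ms] by (auto simp: ptset_def)
  then have "M \<subseteq> W" using line_eq_span[OF MW(1) _ u(1) _ vu] vec.span_minimal[of "{u, v}" W] Ws by auto
  then show "L \<subseteq> \<pi>" unfolding MW by (auto simp: ptset_def)
next
  fix \<pi> L :: "('a ^ 4) set set"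
  assume A: "L \<in> ptset ` pg_lines" "\<pi> \<in> ptset ` pg_planes"
  then obtain M W where MW: "M \<in> pg_lines" "L = ptset M" "W \<in> pg_planes" "\<pi> = ptset W" by auto
  have dimU: "vec.dim (UNIV :: ('a ^ 4) set) = 4" using vec_dim_card[where 'a='a and 'n=4] by simp
  have "ptset M \<inter> ptset W \<noteq> {}"
    by (rule exists_common_point[OF _ _ vec.subspace_UNIV])
      (use MW dimU in \<open>auto simp: pg_planes_def pg_lines_def\<close>)
  then show "L \<inter> \<pi> \<noteq> {}" unfolding MW .
next
  fix \<pi> L L' :: "('a ^ 4) set set"
  assume A: "\<pi> \<in> ptset ` pg_planes" "L \<in> ptset ` pg_lines" "L' \<in> ptset ` pg_lines" "L \<subseteq> \<pi>" "L' \<subseteq> \<pi>"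
  then obtain M M' W where MW: "M \<in> pg_lines" "L = ptset M" "M' \<in> pg_lines" "L' = ptset M'"
    "W \<in> pg_planes" "\<pi> = ptset W" by auto
  have "ptset M \<inter> ptset M' \<noteq> {}"
    by (rule exists_common_point[of _ _ W])
      (use MW A ptset_subset_iff[of _ W] in \<open>auto simp: pg_planes_def pg_lines_def\<close>)
  then show "L \<inter> L' \<noteq> {}" unfolding MW .
qed

lemma is_cap_iff:
  fixes K :: "('a::{field,finite} ^ 'n) set set"
  shows "is_cap k K \<longleftrightarrow> K \<subseteq> pg_points \<and> card K = k \<and> (\<forall>L\<in>pg_lines. card (ptset L \<inter> K) \<le> 2)"
proof -
  have eq: "(\<forall>T\<subseteq>K. card T = 3 \<longrightarrow> \<not> pg_collinear T) \<longleftrightarrow> (\<forall>L\<in>pg_lines. card (ptset L \<inter> K) \<le> 2)"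
    if K: "K \<subseteq> pg_points"
  proof (intro iffI ballI allI impI)
    fix L :: "('a ^ 'n) set"
    assume no: "\<forall>T\<subseteq>K. card T = 3 \<longrightarrow> \<not> pg_collinear T" and L: "L \<in> pg_lines"
    show "card (ptset L \<inter> K) \<le> 2"
    proof (rule ccontr)
      assume "\<not> ?thesis"
      then have "3 \<le> card (ptset L \<inter> K)" by simp
      then obtain T where "T \<subseteq> ptset L \<inter> K" "card T = 3" by (rule obtain_subset_with_card_n)
      then show False using no L by (auto simp: pg_collinear_def ptset_def)
    qed
  next
    fix T assume le: "\<forall>L\<in>pg_lines. card (ptset L \<inter> K) \<le> 2" and T: "T \<subseteq> K" "card T = 3"
    show "\<not> pg_collinear T"
    proof
      assume "pg_collinear T"
      then obtain L where L: "L \<in> pg_lines" "\<forall>P\<in>T. P \<subseteq> L" by (auto simp: pg_collinear_def)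
      then have "T \<subseteq> ptset L \<inter> K" using T K by (auto simp: ptset_def)
      then have "card T \<le> card (ptset L \<inter> K)" by (intro card_mono) auto
      then show False using le L T by fastforce
    qed
  qed
  show ?thesis
  proof (cases "K \<subseteq> pg_points")
    case True
    then show ?thesis using eq[OF True] by (simp only: is_cap_def)
  next
    case False
    then show ?thesis by (simp add: is_cap_def)
  qed
qed

lemma pg3_cap_pts:
  assumes "CARD('a::{field,finite}) = q" "is_cap k (K :: ('a ^ 4) set set)"
  shows "pg3_cap pg_points (ptset ` pg_lines) (ptset ` pg_planes) q K"
proof -
  interpret pg3 "pg_points :: ('a ^ 4) set set" "ptset ` pg_lines" "ptset ` pg_planes" q
    by (rule pg3_pts[OF assms(1)])
  have "K \<subseteq> pg_points" "\<And>L. L \<in> pg_lines \<Longrightarrow> card (ptset L \<inter> K) \<le> 2"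
    using assms(2) unfolding is_cap_iff by blast+
  then show ?thesis by unfold_locales auto
qed

section \<open>Coordinates for a plane section, and tangents through a point on a bisecant\<close>

lemma cap_vectors_independent:
  fixes K :: "('a::{field,finite} ^ 'n) set set"
  assumes cap: "\<And>L. L \<in> pg_lines \<Longrightarrow> card (ptset L \<inter> K) \<le> 2"
    and K: "vec.span {u} \<in> K" "vec.span {v} \<in> K" "vec.span {w} \<in> K"
    and nz: "u \<noteq> 0" "v \<noteq> 0" "w \<noteq> 0"
    and ne: "vec.span {u} \<noteq> vec.span {v}" "vec.span {u} \<noteq> vec.span {w}" "vec.span {v} \<noteq> vec.span {w}"
    and w: "w = x *s u + y *s v"
  shows False
proof -
  have "v \<notin> vec.span {u}"
    using point_eq_span[OF span_singleton_point[OF nz(1)], of v] nz ne by auto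
  then have L: "vec.span {u, v} \<in> pg_lines" using span_two_line nz by blast
  have sub: "vec.subspace (vec.span {u, v})" by (rule vec.subspace_span)
  have uv: "u \<in> vec.span {u, v}" "v \<in> vec.span {u, v}" by (simp_all add: vec.span_base)
  then have "w \<in> vec.span {u, v}" unfolding w by (intro vec.span_add vec.span_scale)
  then have "{vec.span {u}, vec.span {v}, vec.span {w}} \<subseteq> ptset (vec.span {u, v}) \<inter> K"
    using span_singleton_mem_ptset[OF sub] uv nz K by auto
  then have "card {vec.span {u}, vec.span {v}, vec.span {w}} \<le> card (ptset (vec.span {u, v}) \<inter> K)"
    by (intro card_mono) auto
  then show False using cap[OF L] ne by simp
qed

lemma scale_eq_imp_inverse:
  fixes v w :: "'a::field ^ 'n"
  assumes "w = k *s v" "k \<noteq> 0"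
  shows "v = inverse k *s w"
proof -
  have "inverse k *s w = (inverse k * k) *s v" unfolding assms(1) by (rule vector_smult_assoc)
  then show ?thesis using assms(2) by simp
qed

text \<open>Take the bisecant as line at infinity, its two points \<open>A\<close>, \<open>B\<close>
  of \<open>K\<close> as directions of the axes and \<open>Q\<close> as direction of slope 1. In
  characteristic 2 the affine lines through \<open>Q\<close> are those on which \<open>x + y\<close>
  is constant, so tangents through \<open>Q\<close> become unique sums in
  \<open>few_unique_sums\<close>.\<close>

lemma planar_tangents_le:
  fixes K :: "('a::{field,finite} ^ 'n) set set"
  assumes ev: "even CARD('a)"
    and cap: "\<And>L. L \<in> pg_lines \<Longrightarrow> card (ptset L \<inter> K) \<le> 2"
    and K: "K \<subseteq> pg_points"
    and W: "W \<in> pg_planes" and L: "L \<in> pg_lines" "L \<subseteq> W" and two: "card (ptset L \<inter> K) = 2"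
    and Q: "Q \<in> ptset L" "Q \<notin> K"
  shows "card {g \<in> ptset ` pg_lines. g \<subseteq> ptset W \<and> Q \<in> g \<and> card (g \<inter> K) = 1} + card (ptset W \<inter> K)
    \<le> CARD('a) + 2"
proof -
  have one: "(1::'a) + 1 = 0" by (rule char_two[OF ev])
  have dbl: "z + z = 0" for z :: 'a
    using one by (metis mult_2 mult_zero_left one_add_one)
  have Ws: "vec.subspace W" "vec.dim W = 3" and Ls: "vec.subspace L" "vec.dim L = 2"
    using W L by (auto simp: pg_planes_def pg_lines_def)
  obtain A B where AB: "ptset L \<inter> K = {A, B}" "A \<noteq> B" using two by (auto simp: card_2_iff)
  then have ABK: "A \<in> K" "B \<in> K" "A \<in> ptset L" "B \<in> ptset L" by auto
  then have pts: "A \<in> pg_points" "B \<in> pg_points" "Q \<in> pg_points" using Q by (auto simp: ptset_def)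
  obtain a' where a': "a' \<noteq> 0" "A = vec.span {a'}" using point_obtain[OF pts(1)] .
  obtain b' where b': "b' \<noteq> 0" "B = vec.span {b'}" using point_obtain[OF pts(2)] .
  obtain z where z: "z \<noteq> 0" "Q = vec.span {z}" using point_obtain[OF pts(3)] .
  have inL: "a' \<in> L" "b' \<in> L" "z \<in> L"
    using ABK Q a' b' z span_singleton_subset[OF Ls(1)] by (auto simp: ptset_def)
  have b'a': "b' \<notin> vec.span {a'}" using point_eq_span[OF pts(1), of b'] a' b' AB(2) by auto
  have L_eq: "L = vec.span {a', b'}" using line_eq_span[OF L(1) inL(1) a'(1) inL(2) b'a'] .
  have "z \<in> vec.span {a', b'}" using inL(3) unfolding L_eq .
  then obtain \<alpha> \<beta> where \<alpha>\<beta>: "z = \<alpha> *s a' + \<beta> *s b'"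
    by (auto simp: vec.span_insert vec.span_singleton) (metis add.commute diff_add_cancel)
  have "Q \<noteq> A" "Q \<noteq> B" using Q ABK by auto
  have "\<alpha> \<noteq> 0"
  proof
    assume "\<alpha> = 0"
    then have "z \<in> B" using \<alpha>\<beta> b' by (auto simp: vec.span_singleton)
    then show False using point_eq_span[OF pts(2), of z] z \<open>Q \<noteq> B\<close> by auto
  qed
  have "\<beta> \<noteq> 0"
  proof
    assume "\<beta> = 0"
    then have "z \<in> A" using \<alpha>\<beta> a' by (auto simp: vec.span_singleton)
    then show False using point_eq_span[OF pts(1), of z] z \<open>Q \<noteq> A\<close> by auto
  qed
  \<comment> \<open>Rescaling the representatives of \<open>A\<close> and \<open>B\<close> makes
    \<open>Q\<close> the point of \<open>a + b\<close>; this needs both coefficients nonzero, that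
    is \<open>Q\<close> different from \<open>A\<close> and \<open>B\<close>.\<close>
  define a b where "a = \<alpha> *s a'" and "b = \<beta> *s b'"
  have a: "a \<noteq> 0" "A = vec.span {a}" and b: "b \<noteq> 0" "B = vec.span {b}"
  proof -
    show "a \<noteq> 0" "b \<noteq> 0" using a' b' \<open>\<alpha> \<noteq> 0\<close> \<open>\<beta> \<noteq> 0\<close> by (auto simp: a_def b_def)
    moreover have "a \<in> A" "b \<in> B" using a' b' by (auto simp: a_def b_def vec.span_singleton)
    ultimately show "A = vec.span {a}" "B = vec.span {b}" using point_eq_span pts by auto
  qed
  have z_ab: "z = a + b" using \<alpha>\<beta> by (simp add: a_def b_def)
  have abL: "a \<in> L" "b \<in> L" using inL Ls by (auto simp: a_def b_def intro: vec.subspace_scale)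
  have ba: "b \<notin> vec.span {a}" using point_eq_span[OF pts(1), of b] a b AB(2) by auto
  have L_ab: "L = vec.span {a, b}" using line_eq_span[OF L(1) abL(1) a(1) abL(2) ba] .
  have "\<not> W \<subseteq> L" using vec.dim_subset[of W L] Ws Ls by auto
  then obtain c where c: "c \<in> W" "c \<notin> L" by auto
  have W_eq: "W = vec.span (insert c L)"
    using subspace_eq_span_insert[OF Ls(1) c(2,1) Ws(1) L(2)] Ws Ls by simp
  \<comment> \<open>The affine points of the plane: \<open>c\<close> is the origin, and by
    \<open>inj\<close> and \<open>surj\<close> each point off the bisecant occurs exactly
    once.\<close>
  define p where "p s = fst s *s a + snd s *s b + c" for s :: "'a \<times> 'a"
  have comb_L: "x *s a + y *s b \<in> L" for x y
    using abL Ls by (intro vec.subspace_add vec.subspace_scale) auto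
  have pW: "p s \<in> W" for s
    using vec.subspace_add[OF Ws(1), of "fst s *s a + snd s *s b" c] comb_L L(2) c by (auto simp: p_def)
  have pL: "k *s p s \<notin> L" if "k \<noteq> 0" for k s
  proof
    assume "k *s p s \<in> L"
    then have "inverse k *s (k *s p s) \<in> L" by (rule vec.subspace_scale[OF Ls(1)])
    then have "p s \<in> L" using that by (simp add: vector_smult_assoc)
    then have "p s - (fst s *s a + snd s *s b) \<in> L" using comb_L by (rule vec.subspace_diff[OF Ls(1)])
    then show False using c(2) by (simp add: p_def)
  qed
  have p0: "p s \<noteq> 0" for s using pL[of 1 s] vec.subspace_0[OF Ls(1)] by auto
  define \<phi> where "\<phi> s = vec.span {p s}" for s
  have inj: "s = s'" if e: "\<phi> s = \<phi> s'" for s s'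
  proof -
    obtain k where k: "p s' = k *s p s" using span_singleton_eqD[OF e[unfolded \<phi>_def]] .
    have "(1 - k) *s p s \<in> L"
    proof -
      have "(1 - k) *s p s = p s - p s'" unfolding k by (simp add: vec.scale_left_diff_distrib)
      also have "\<dots> = (fst s - fst s') *s a + (snd s - snd s') *s b"
        by (simp add: p_def vec.scale_left_diff_distrib)
      finally show ?thesis by (simp only: comb_L)
    qed
    then have "k = 1" using pL[of "1 - k" s] by auto
    then have "p s' = p s" using k by simp
    then have eq: "(fst s' - fst s) *s a = (snd s - snd s') *s b"
      by (simp add: p_def vec.scale_left_diff_distrib algebra_simps)
    have "snd s = snd s'"
    proof (rule ccontr)
      assume "snd s \<noteq> snd s'"
      then have "b = inverse (snd s - snd s') *s ((snd s - snd s') *s b)"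
        by (simp only: vector_smult_assoc) simp
      then have "b = (inverse (snd s - snd s') * (fst s' - fst s)) *s a"
        unfolding eq[symmetric] by (simp only: vector_smult_assoc)
      then show False using ba by (auto simp: vec.span_singleton)
    qed
    moreover then have "(fst s' - fst s) *s a = 0" using eq by simp
    then have "fst s' - fst s = 0" using a(1) by (simp only: vec.scale_eq_0_iff) simp
    ultimately show "s = s'" by (simp add: prod_eq_iff)
  qed
  have surj: "\<exists>s. P = \<phi> s" if P: "P \<in> ptset W" "P \<notin> ptset L" for P
  proof -
    have Pp: "P \<in> pg_points" using P by (auto simp: ptset_def)
    obtain w where w: "w \<noteq> 0" "P = vec.span {w}" using point_obtain[OF Pp] .
    have "w \<in> W" using P w span_singleton_subset[OF Ws(1)] by (auto simp: ptset_def)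
    then obtain k where k: "w - k *s c \<in> vec.span L" unfolding W_eq by (auto simp: vec.span_insert)
    moreover have "vec.span L = L" using Ls(1) by (rule vec.span_eq_iff[THEN iffD2])
    ultimately have "w - k *s c \<in> vec.span {a, b}" using L_ab by metis
    then obtain x y where xy: "w = x *s a + y *s b + k *s c"
      by (auto simp: vec.span_insert vec.span_singleton) (metis add.commute diff_add_cancel)
    have "k \<noteq> 0"
    proof
      assume "k = 0"
      then have "w \<in> L" using xy comb_L by simp
      then show False using P w Pp span_singleton_subset[OF Ls(1)] by (auto simp: ptset_def)
    qed
    then have "w = k *s p (x / k, y / k)"
      unfolding xy p_def by (simp add: vec.scale_right_distrib vector_smult_assoc)
    then have "p (x / k, y / k) = inverse k *s w" using \<open>k \<noteq> 0\<close> by (simp add: vector_smult_assoc)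
    then have "p (x / k, y / k) \<in> P" using w by (auto simp: vec.span_singleton)
    then show ?thesis using point_eq_span[OF Pp _ p0] unfolding \<phi>_def by blast
  qed
  have phi_W: "\<phi> s \<in> ptset W" "\<phi> s \<notin> ptset L" for s
    using span_singleton_mem_ptset[OF Ws(1) pW p0] pL[of 1 s] span_singleton_subset[OF Ls(1)]
    by (auto simp: \<phi>_def ptset_def)
  define S where "S = {s. \<phi> s \<in> K}"
  have "\<phi> ` S = ptset W \<inter> K - {A, B}"
  proof (intro equalityI subsetI)
    fix P assume "P \<in> \<phi> ` S"
    then obtain s where s: "P = \<phi> s" "\<phi> s \<in> K" by (auto simp: S_def)
    then show "P \<in> ptset W \<inter> K - {A, B}" using phi_W[of s] ABK by auto
  next
    fix P assume P: "P \<in> ptset W \<inter> K - {A, B}"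
    then have "P \<notin> ptset L" using AB(1) by blast
    then obtain s where "P = \<phi> s" using surj[of P] P by blast
    then show "P \<in> \<phi> ` S" using P by (simp add: S_def)
  qed
  then have "card S = card (ptset W \<inter> K - {A, B})"
    using card_image[of \<phi> S] inj by (metis inj_onI)
  also have "\<dots> = card (ptset W \<inter> K) - 2"
    using ABK L(2) AB(2) by (subst card_Diff_subset) (auto simp: ptset_def)
  finally have cS: "card (ptset W \<inter> K) \<le> card S + 2" by simp
  have collinear: False
    if "s \<in> S" "s' \<in> S" "s \<noteq> s'" "P \<in> K" "P = vec.span {v}" "v \<noteq> 0" "P \<noteq> \<phi> s" "P \<noteq> \<phi> s'"
      "v = x *s p s + y *s p s'" for s s' P v x y
    using cap_vectors_independent[OF cap, of "p s" "p s'" v x y] that p0 inj unfolding S_def \<phi>_def by blast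
  have phi_AB: "\<phi> s \<noteq> A" "\<phi> s \<noteq> B" for s using phi_W(2)[of s] ABK by auto
  \<comment> \<open>Two points with the same first coordinate are collinear with \<open>B\<close>;
    those with the same second coordinate are collinear with \<open>A\<close>.\<close>
  have injx: "inj_on fst S"
  proof (rule inj_onI, rule ccontr)
    fix s s' assume s: "s \<in> S" "s' \<in> S" "fst s = fst s'" "s \<noteq> s'"
    have "snd s \<noteq> snd s'" using s by (auto simp: prod_eq_iff)
    then have nz: "snd s - snd s' \<noteq> 0" by simp
    have e: "p s - p s' = (snd s - snd s') *s b" using s by (simp add: p_def vec.scale_left_diff_distrib)
    have "b = inverse (snd s - snd s') *s (p s - p s')" by (rule scale_eq_imp_inverse[OF e nz])
    then have "b = inverse (snd s - snd s') *s p s + (- inverse (snd s - snd s')) *s p s'"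
      unfolding vec.scale_right_diff_distrib vec.scale_minus_left by simp
    then show False using collinear[OF s(1,2,4) ABK(2) b(2,1)] phi_AB by metis
  qed
  have injy: "inj_on snd S"
  proof (rule inj_onI, rule ccontr)
    fix s s' assume s: "s \<in> S" "s' \<in> S" "snd s = snd s'" "s \<noteq> s'"
    have "fst s \<noteq> fst s'" using s by (auto simp: prod_eq_iff)
    then have nz: "fst s - fst s' \<noteq> 0" by simp
    have e: "p s - p s' = (fst s - fst s') *s a" using s by (simp add: p_def vec.scale_left_diff_distrib)
    have "a = inverse (fst s - fst s') *s (p s - p s')" by (rule scale_eq_imp_inverse[OF e nz])
    then have "a = inverse (fst s - fst s') *s p s + (- inverse (fst s - fst s')) *s p s'"
      unfolding vec.scale_right_diff_distrib vec.scale_minus_left by simp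
    then show False using collinear[OF s(1,2,4) ABK(1) a(2,1)] phi_AB by metis
  qed
  have minus: "z - w = z + w" for z w :: 'a
    using dbl[of w] by (simp add: diff_eq_eq add.assoc)
  have nocol: "(fst s + fst r) * (snd s + snd w) + (snd s + snd r) * (fst s + fst w) \<noteq> 0"
    if s: "s \<in> S" "r \<in> S" "w \<in> S" "s \<noteq> r" "s \<noteq> w" "r \<noteq> w" for s r w
  proof
    assume "(fst s + fst r) * (snd s + snd w) + (snd s + snd r) * (fst s + fst w) = 0"
    then have D: "(fst r - fst s) * (snd w - snd s) = (snd r - snd s) * (fst w - fst s)"
      using minus by (metis add.commute eq_iff_diff_eq_0)
    \<comment> \<open>A vanishing determinant makes \<open>w - s\<close> the multiple
      \<open>l\<close> of \<open>r - s\<close>, so the three points lie on a line.\<close>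
    define l where "l = (fst w - fst s) / (fst r - fst s)"
    have ne: "fst r - fst s \<noteq> 0" using injx s by (auto simp: inj_on_def)
    have 1: "fst w - fst s = l * (fst r - fst s)" using ne by (simp add: l_def)
    have 2: "snd w - snd s = l * (snd r - snd s)" using ne D by (simp add: l_def field_simps)
    have "p w - p s = (fst w - fst s) *s a + (snd w - snd s) *s b"
      by (simp add: p_def vec.scale_left_diff_distrib)
    also have "\<dots> = l *s ((fst r - fst s) *s a + (snd r - snd s) *s b)"
      unfolding 1 2 by (simp only: vec.scale_right_distrib vector_smult_assoc)
    also have "(fst r - fst s) *s a + (snd r - snd s) *s b = p r - p s"
      by (simp add: p_def vec.scale_left_diff_distrib)
    finally have "p w = (1 - l) *s p s + l *s p r"
      by (simp add: vec.scale_right_diff_distrib vec.scale_left_diff_distrib algebra_simps)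
    moreover have "\<phi> w \<noteq> \<phi> s" "\<phi> w \<noteq> \<phi> r" using inj[of w s] inj[of w r] s(5,6) by metis+
    moreover have "\<phi> w \<in> K" using s by (simp add: S_def)
    moreover have "\<phi> w = vec.span {p w}" by (simp only: \<phi>_def)
    ultimately show False using collinear[OF s(1,2,4) _ _ p0] by metis
  qed
  let ?U = "{s \<in> S. \<forall>r\<in>S. fst r + snd r = fst s + snd s \<longrightarrow> r = s}"
  let ?G = "{g \<in> ptset ` pg_lines. g \<subseteq> ptset W \<and> Q \<in> g \<and> card (g \<inter> K) = 1}"
  \<comment> \<open>Each tangent through \<open>Q\<close> is recovered from the affine point at
    which it touches \<open>K\<close>, and the sum at that point is unique.\<close>
  have "?G \<subseteq> (\<lambda>s. ptset (vec.span {z, p s})) ` ?U"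
  proof
    fix g assume "g \<in> ?G"
    then obtain G where G: "G \<in> pg_lines" "g = ptset G" "ptset G \<subseteq> ptset W" "Q \<in> ptset G" "card (ptset G \<inter> K) = 1"
      by auto
    have Gs: "vec.subspace G" using G by (auto simp: pg_lines_def)
    obtain P where P: "ptset G \<inter> K = {P}" using G(5) by (auto simp: card_1_singleton_iff)
    then have PG: "P \<in> ptset G" "P \<in> K" by auto
    have Pp: "P \<in> pg_points" using PG by (auto simp: ptset_def)
    have zG: "z \<in> G" using G(4) z span_singleton_subset[OF Gs] by (auto simp: ptset_def)
    have "P \<noteq> Q" using PG Q by auto
    have "P \<notin> ptset L"
    proof
      assume "P \<in> ptset L"
      then have "G = L" using line_through[OF Pp pts(3) \<open>P \<noteq> Q\<close>] G L PG Q by (auto simp: ptset_def)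
      then show False using G(5) two by simp
    qed
    then obtain s where s: "P = \<phi> s" using surj PG G(3) by blast
    have sS: "s \<in> S" using s PG by (simp add: S_def)
    have psG: "p s \<in> G" using PG s span_singleton_subset[OF Gs] by (auto simp: ptset_def \<phi>_def)
    have psz: "p s \<notin> vec.span {z}"
      using point_eq_span[OF pts(3), of "p s"] z p0 s \<open>P \<noteq> Q\<close> by (auto simp: \<phi>_def)
    have "G = vec.span {z, p s}" by (rule line_eq_span[OF G(1) zG z(1) psG psz])
    moreover have "s \<in> ?U"
    proof -
      have "r = s" if r: "r \<in> S" "fst r + snd r = fst s + snd s" for r
      proof -
        define l where "l = fst r - fst s"
        have l2: "snd r - snd s = l"
          using r(2) minus unfolding l_def by (metis add.commute add_diff_cancel_left' diff_add_cancel add_diff_eq)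
        have "p r - p s = (fst r - fst s) *s a + (snd r - snd s) *s b"
          by (simp add: p_def vec.scale_left_diff_distrib)
        then have "p r - p s = l *s z" unfolding l2 l_def[symmetric] z_ab by (simp add: vec.scale_right_distrib)
        then have "p r = p s + l *s z" by (simp add: algebra_simps)
        then have "p r \<in> G" using psG zG Gs by (auto intro: vec.subspace_add vec.subspace_scale)
        then have "\<phi> r \<in> ptset G \<inter> K"
          using span_singleton_mem_ptset[OF Gs _ p0] r(1) by (auto simp: \<phi>_def S_def)
        then have "\<phi> r = \<phi> s" using P s by auto
        then show "r = s" by (rule inj)
      qed
      then show ?thesis using sS by blast
    qed
    ultimately show "g \<in> (\<lambda>s. ptset (vec.span {z, p s})) ` ?U" using G(2) by auto
  qed
  then have "card ?G \<le> card ((\<lambda>s. ptset (vec.span {z, p s})) ` ?U)" by (intro card_mono) auto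
  also have "\<dots> \<le> card ?U" by (intro card_image_le) auto
  finally have "card ?G + card S \<le> CARD('a)"
    using few_unique_sums[OF one _ injx injy nocol] by simp
  then show ?thesis using cS by linarith
qed

section \<open>Complete caps of two different sizes\<close>

lemma pg3_complete_cap_pts:
  fixes K :: "('a::{field,finite} ^ 4) set set"
  assumes q: "CARD('a) = q" "even q" "q \<ge> 8" and K: "is_complete_cap k K"
  shows "pg3_complete_cap pg_points (ptset ` pg_lines) (ptset ` pg_planes) q K"
proof -
  have capK: "is_cap k K" and noext: "\<not> (\<exists>K'. is_cap (k + 1) K' \<and> K \<subseteq> K')"
    using K by (auto simp: is_complete_cap_def)
  have Kp: "K \<subseteq> pg_points" "card K = k" and le2: "\<And>L. L \<in> pg_lines \<Longrightarrow> card (ptset L \<inter> K) \<le> 2"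
    using capK unfolding is_cap_iff by blast+
  interpret pg3_cap "pg_points :: ('a ^ 4) set set" "ptset ` pg_lines" "ptset ` pg_planes" q K
    by (rule pg3_cap_pts[OF q(1) capK])
  show ?thesis
  proof
    show "8 \<le> q" "even q" by fact+
  next
    fix \<pi> L and Q :: "('a ^ 4) set"
    assume A: "\<pi> \<in> ptset ` pg_planes" "L \<in> ptset ` pg_lines" "L \<subseteq> \<pi>" "card (L \<inter> K) = 2" "Q \<in> L" "Q \<notin> K"
    then obtain W M where WM: "W \<in> pg_planes" "\<pi> = ptset W" "M \<in> pg_lines" "L = ptset M" by auto
    then have "M \<subseteq> W" using A(3) ptset_subset_iff[of M W] by (auto simp: pg_planes_def pg_lines_def)
    then show "card {g \<in> ptset ` pg_lines. g \<subseteq> \<pi> \<and> Q \<in> g \<and> card (g \<inter> K) = 1} + card (\<pi> \<inter> K) \<le> q + 2"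
      using planar_tangents_le[OF _ le2 Kp(1), of W M Q] WM A q by simp
  next
    fix Q :: "('a ^ 4) set"
    assume Q: "Q \<in> pg_points" "Q \<notin> K"
    have "\<not> is_cap (k + 1) (insert Q K)" using noext by auto
    moreover have "insert Q K \<subseteq> pg_points" "card (insert Q K) = k + 1" using Q Kp by auto
    ultimately obtain L where L: "L \<in> pg_lines" "\<not> card (ptset L \<inter> insert Q K) \<le> 2"
      unfolding is_cap_iff by blast
    have "Q \<in> ptset L"
    proof (rule ccontr)
      assume "Q \<notin> ptset L"
      then have "ptset L \<inter> insert Q K = ptset L \<inter> K" by auto
      then show False using L le2[OF L(1)] by simp
    qed
    then have "ptset L \<inter> insert Q K = insert Q (ptset L \<inter> K)" by auto
    then have "card (ptset L \<inter> K) = 2" using L(2) le2[OF L(1)] Q by simp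
    then show "\<exists>L\<in>ptset ` pg_lines. Q \<in> L \<and> card (L \<inter> K) = 2"
      using L(1) \<open>Q \<in> ptset L\<close> by auto
  qed
qed

lemma complete_cap_card:
  fixes K :: "('a::{field,finite} ^ 4) set set"
  assumes q: "CARD('a) = q" "even q" "q \<ge> 8" and K: "is_complete_cap k K"
  shows "k = q\<^sup>2 + 1 \<or> real k < (real q)\<^sup>2 - (sqrt 5 - 1) * real q + 5"
proof -
  interpret c: pg3_complete_cap "pg_points :: ('a ^ 4) set set" "ptset ` pg_lines" "ptset ` pg_planes" q K
    by (rule pg3_complete_cap_pts[OF assms])
  have k: "c.t + k = q\<^sup>2 + q + 2" using c.t_card K by (simp add: is_complete_cap_def is_cap_def)
  show ?thesis
  proof (cases "c.t = q + 1")
    case False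
    then have "5 * q^2 < (c.t + 3)^2" using c.t_cases by blast
    then have "real (5 * q^2) < real ((c.t + 3)^2)" by (simp only: of_nat_less_iff)
    then have "(sqrt 5 * real q)\<^sup>2 < (real c.t + 3)\<^sup>2" by (simp add: power_mult_distrib)
    then have "sqrt 5 * real q < real c.t + 3" by (rule power_less_imp_less_base) simp
    moreover have "real c.t + real k = (real q)\<^sup>2 + real q + 2"
      using arg_cong[OF k, of real] by simp
    ultimately show ?thesis by (simp add: algebra_simps)
  qed (use k in simp)
qed

lemma maximal_cap_plane:
  fixes K :: "('a::{field,finite} ^ 4) set set"
  assumes q: "CARD('a) = q" "even q" "q \<ge> 8" and K: "is_complete_cap (q\<^sup>2 + 1) K"
    and W: "W \<in> pg_planes"
  shows "card (ptset W \<inter> K) \<le> q + 1"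
proof -
  interpret c: pg3_complete_cap "pg_points :: ('a ^ 4) set set" "ptset ` pg_lines" "ptset ` pg_planes" q K
    by (rule pg3_complete_cap_pts[OF q K])
  have "c.t = q + 1" using c.t_card K by (simp add: is_complete_cap_def is_cap_def)
  then show ?thesis using c.plane_ovoid[of "ptset W"] W by (simp add: c.m_def)
qed

lemma cap_extends_to_complete_cap:
  assumes "is_cap k (K :: ('a::{field,finite} ^ 'n) set set)"
  shows "\<exists>k' K'. is_complete_cap k' K' \<and> K \<subseteq> K'"
proof -
  define C where "C = {K'. is_cap (card K') K' \<and> K \<subseteq> K'}"
  have "card K = k" using assms by (simp add: is_cap_def)
  then have "K \<in> C" using assms by (simp add: C_def)
  moreover have "finite C" by simp
  ultimately obtain K' where K': "K' \<in> C" "\<And>K''. K'' \<in> C \<Longrightarrow> card K'' \<le> card K'"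
    using Max_in[of "card ` C"] Max_ge[of "card ` C"] by (metis (no_types, lifting) empty_iff finite_imageI image_iff image_is_empty)
  have "\<not> (\<exists>K''. is_cap (card K' + 1) K'' \<and> K' \<subseteq> K'')"
  proof
    assume "\<exists>K''. is_cap (card K' + 1) K'' \<and> K' \<subseteq> K''"
    then obtain K'' where K'': "is_cap (card K' + 1) K''" "K' \<subseteq> K''" by blast
    then have c: "card K'' = card K' + 1" by (simp add: is_cap_def)
    then have "K'' \<in> C" using K'' K'(1) by (auto simp: C_def)
    then show False using K'(2) c by fastforce
  qed
  then show ?thesis using K'(1) by (auto simp: C_def is_complete_cap_def)
qed

section \<open>Caps given by explicit vectors\<close>

lemma is_cap_span_image:
  fixes V :: "('a::{field,finite} ^ 'n) set"
  assumes nz: "0 \<notin> V"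
    and inj: "\<And>u v k. \<lbrakk>u \<in> V; v \<in> V; v = k *s u\<rbrakk> \<Longrightarrow> u = v"
    and indep: "\<And>u v w x y. \<lbrakk>u \<in> V; v \<in> V; w \<in> V; u \<noteq> v; u \<noteq> w; v \<noteq> w\<rbrakk> \<Longrightarrow> w \<noteq> x *s u + y *s v"
  shows "is_cap (card V) ((\<lambda>v. vec.span {v}) ` V)"
proof -
  have inj': "u = v" if "u \<in> V" "v \<in> V" "vec.span {u} = vec.span {v}" for u v
    using span_singleton_eqD[OF that(3)] inj[OF that(1,2)] by metis
  have "card (ptset L \<inter> (\<lambda>v. vec.span {v}) ` V) \<le> 2" if L: "L \<in> pg_lines" for L
  proof (rule ccontr)
    assume "\<not> ?thesis"
    then have "3 \<le> card (ptset L \<inter> (\<lambda>v. vec.span {v}) ` V)" by simp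
    then obtain T where T: "T \<subseteq> ptset L \<inter> (\<lambda>v. vec.span {v}) ` V" "card T = 3"
      by (rule obtain_subset_with_card_n)
    obtain A B C where ABC: "T = {A, B, C}" "A \<noteq> B" "A \<noteq> C" "B \<noteq> C" using T(2) by (auto simp: card_3_iff)
    obtain u v w where uvw: "u \<in> V" "v \<in> V" "w \<in> V" "A = vec.span {u}" "B = vec.span {v}" "C = vec.span {w}"
      using T(1) ABC(1) by auto
    have Ls: "vec.subspace L" using L by (simp add: pg_lines_def)
    have inL: "u \<in> L" "v \<in> L" "w \<in> L"
      using T(1) ABC(1) uvw span_singleton_subset[OF Ls] by (auto simp: ptset_def)
    have ne: "u \<noteq> v" "u \<noteq> w" "v \<noteq> w" using uvw ABC by auto
    have "u \<noteq> 0" using uvw nz by auto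
    have "v \<notin> vec.span {u}" using inj[OF uvw(1,2)] ne by (auto simp: vec.span_singleton)
    then have "L = vec.span {u, v}" using line_eq_span[OF L inL(1) \<open>u \<noteq> 0\<close> inL(2)] by simp
    then have "w \<in> vec.span {u, v}" using inL by simp
    then obtain x y where "w = x *s u + y *s v"
      by (auto simp: vec.span_insert vec.span_singleton) (metis add.commute diff_add_cancel)
    then show False using indep[OF uvw(1-3) ne] by blast
  qed
  moreover have "(\<lambda>v. vec.span {v}) ` V \<subseteq> pg_points"
  proof
    fix P assume "P \<in> (\<lambda>v. vec.span {v}) ` V"
    then obtain v where "v \<in> V" "P = vec.span {v}" by auto
    then show "P \<in> pg_points" using nz span_singleton_point[of v] by metis
  qed
  moreover have "card ((\<lambda>v. vec.span {v}) ` V) = card V"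
    using inj' by (intro card_image inj_onI)
  ultimately show ?thesis unfolding is_cap_iff by blast
qed

definition vec4 :: "'a::zero \<Rightarrow> 'a \<Rightarrow> 'a \<Rightarrow> 'a \<Rightarrow> 'a ^ 4" where
  "vec4 a b c d = vector [a, b, c, d]"

lemma vec4_nth [simp]:
  "vec4 a b c d $ 1 = a" "vec4 a b c d $ 2 = b" "vec4 a b c d $ 3 = c" "vec4 a b c d $ 4 = d"
  by (simp_all add: vec4_def vector_def)

lemma vec4_eq_iff: "v = w \<longleftrightarrow> v $ 1 = w $ 1 \<and> v $ 2 = w $ 2 \<and> v $ 3 = w $ 3 \<and> v $ 4 = w $ 4" for v w :: "'a ^ 4"
  by (simp add: vec_eq_iff forall_4)

text \<open>The map \<open>z * z + z\<close> takes the value 0 at both 0 and -1, so on a finite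
  field it misses some \<open>e\<close>. A zero of the form with nonzero \<open>y\<close> would make
  \<open>e\<close> the value at \<open>x / y\<close>.\<close>

lemma exists_anisotropic:
  "\<exists>e :: 'a::{field,finite}. \<forall>x y. x * x + x * y - e * (y * y) = 0 \<longrightarrow> x = 0 \<and> y = 0"
proof -
  have "\<not> inj (\<lambda>z::'a. z * z + z)"
  proof
    assume "inj (\<lambda>z::'a. z * z + z)"
    then have "0 = (- 1 :: 'a)" by (rule injD) simp
    then show False by simp
  qed
  then have "\<not> surj (\<lambda>z::'a. z * z + z)" by (metis finite_UNIV_surj_inj finite_code)
  then obtain e :: 'a where e: "\<And>z. e \<noteq> z * z + z" by (auto simp: surj_def)
  have "x = 0 \<and> y = 0" if eq: "x * x + x * y - e * (y * y) = 0" for x y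
  proof (cases "y = 0")
    case False
    then have "e = (x / y) * (x / y) + x / y" using eq by (simp add: field_simps)
    then show ?thesis using e by blast
  qed (use eq in simp)
  then show ?thesis by blast
qed

text \<open>The quadric \<open>X1 X4 = f(X2, X3)\<close> for an anisotropic form \<open>f\<close>:
  the graph of \<open>f\<close> over the affine plane together with the point
  \<open>(0, 0, 0, 1)\<close>.\<close>

lemma elliptic_quadric:
  "\<exists>K :: ('a::{field,finite} ^ 4) set set. is_cap (CARD('a)\<^sup>2 + 1) K"
proof -
  obtain e :: 'a where e: "\<And>x y. x * x + x * y - e * (y * y) = 0 \<Longrightarrow> x = 0 \<and> y = 0"
    using exists_anisotropic[where 'a='a] by blast
  define f where "f x y = x * x + x * y - e * (y * y)" for x y
  define g where "g = (\<lambda>(x, y). vec4 1 x y (f x y))"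
  define V where "V = insert (vec4 0 0 0 1) (range g)"
  have key: "w = u \<or> w = v" if "g w = l *s g u + k *s g v" for w u v l k
  proof -
    obtain w1 w2 u1 u2 v1 v2 where wuv: "w = (w1, w2)" "u = (u1, u2)" "v = (v1, v2)" by (metis surj_pair)
    have c: "g w $ i = l * g u $ i + k * g v $ i" for i using that by simp
    have gn: "g (a, b) $ 1 = 1" "g (a, b) $ 2 = a" "g (a, b) $ 3 = b" "g (a, b) $ 4 = f a b" for a b
      by (simp_all add: g_def)
    have 1: "l + k = 1" "w1 = l * u1 + k * v1" "w2 = l * u2 + k * v2" "f w1 w2 = l * f u1 u2 + k * f v1 v2"
      using c[of 1] c[of 2] c[of 3] c[of 4] by (simp_all only: wuv gn mult_1_right)
    have k: "k = 1 - l" using 1(1) by (simp add: algebra_simps)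
    \<comment> \<open>For a quadratic form,
      \<open>l f(u) + (1 - l) f(v) - f(l u + (1 - l) v)\<close> equals
      \<open>l (1 - l) f(u - v)\<close>. Hence a third point of the graph on a line forces
      \<open>l\<close> to be 0 or 1, or \<open>u = v\<close> by anisotropy.\<close>
    have "l * (1 - l) * f (u1 - v1) (u2 - v2) = l * f u1 u2 + (1 - l) * f v1 v2 - f w1 w2"
      unfolding 1(2,3) k f_def by (simp add: algebra_simps)
    also have "\<dots> = 0" using 1(4) k by simp
    finally have "l = 0 \<or> l = 1 \<or> f (u1 - v1) (u2 - v2) = 0" by auto
    then show ?thesis
    proof (elim disjE)
      assume "f (u1 - v1) (u2 - v2) = 0"
      then have "u1 = v1" "u2 = v2" using e[of "u1 - v1" "u2 - v2"] by (auto simp: f_def)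
      then show ?thesis using 1 k wuv by (simp add: algebra_simps)
    qed (use 1 k wuv in auto)
  qed
  have injg: "inj g" by (rule injI) (auto simp: g_def vec4_eq_iff)
  have g1: "g s $ 1 = 1" for s by (simp add: g_def split: prod.split)
  have "is_cap (card V) ((\<lambda>v. vec.span {v}) ` V)"
  proof (rule is_cap_span_image)
    show "0 \<notin> V" using g1 by (auto simp: V_def vec4_eq_iff)
  next
    fix u v k assume A: "u \<in> V" "v \<in> V" "v = k *s u"
    show "u = v"
    proof (cases "u \<in> range g")
      case True
      then have u1: "u $ 1 = 1" using g1 by auto
      then have "v $ 1 = k" using A(3) by simp
      show ?thesis
      proof (cases "v \<in> range g")
        case True
        then have "k = 1" using g1 \<open>v $ 1 = k\<close> by auto
        then show ?thesis using A(3) by simp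
      next
        case False
        then have v: "v = vec4 0 0 0 1" using A(2) by (simp add: V_def)
        then have "k = 0" using \<open>v $ 1 = k\<close> by simp
        then show ?thesis using A(3) v by (simp add: vec4_eq_iff)
      qed
    next
      case False
      then have u: "u = vec4 0 0 0 1" using A(1) by (simp add: V_def)
      then have "v $ 1 = 0" using A(3) by simp
      then have "v \<notin> range g" using g1 by auto
      then show ?thesis using A(2) u by (simp add: V_def)
    qed
  next
    fix u v w x y
    assume A: "u \<in> V" "v \<in> V" "w \<in> V" "u \<noteq> v" "u \<noteq> w" "v \<noteq> w"
    show "w \<noteq> x *s u + y *s v"
    proof
      assume eq: "w = x *s u + y *s v"
      \<comment> \<open>A line through \<open>(0, 0, 0, 1)\<close> and a point of the graph has
        constant affine part, so it meets the graph only once.\<close>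
      have aux: False
        if h: "u = vec4 0 0 0 1" "w = x *s u + y *s v" "v \<in> range g" "w \<in> range g" "v \<noteq> w" for u v w x y
      proof -
        obtain s r where sr: "v = g s" "w = g r" using h by auto
        have "y = 1" using h(1,2) g1 unfolding sr by (simp add: vec4_eq_iff)
        then show False using h(1,2,5) unfolding sr by (auto simp: vec4_eq_iff g_def split: prod.splits)
      qed
      consider "w = vec4 0 0 0 1" | "u = vec4 0 0 0 1" | "v = vec4 0 0 0 1"
        | "u \<in> range g" "v \<in> range g" "w \<in> range g" using A(1-3) by (auto simp: V_def)
      then show False
      proof cases
        case 1
        then have "u \<in> range g" "v \<in> range g" using A by (auto simp: V_def)
        then obtain s r where sr: "u = g s" "v = g r" by auto
        have c: "x + y = 0" using eq g1 unfolding 1 sr by (simp add: vec4_eq_iff)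
        then have y: "y = - x" by (simp add: eq_neg_iff_add_eq_0 add.commute)
        then show False using eq A(4) unfolding 1 sr y
          by (cases s; cases r) (auto simp: vec4_eq_iff g_def simp flip: right_diff_distrib)
      next
        case 2
        then show False using aux[of u w x y v] eq A by (auto simp: V_def)
      next
        case 3
        then show False using aux[of v w y x u] eq A by (auto simp: V_def add.commute)
      next
        case 4
        then obtain s r p where "u = g s" "v = g r" "w = g p" by auto
        then show False using key[of p x s y r] eq A by auto
      qed
    qed
  qed
  moreover have "card V = CARD('a)\<^sup>2 + 1"
  proof -
    have "vec4 0 0 0 1 \<notin> range g" using g1 by (metis rangeE vec4_nth(1) zero_neq_one)
    then have "card V = card (range g) + 1" by (simp add: V_def)
    also have "card (range g) = CARD('a \<times> 'a)" using injg by (simp add: card_image)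
    finally show ?thesis by (simp add: card_prod power2_eq_square)
  qed
  ultimately show ?thesis by metis
qed

text \<open>A conic in the plane \<open>X4 = 0\<close> with its nucleus \<open>n\<close>, through
  which all its tangents pass in characteristic 2; \<open>i\<close> is the point of the conic at
  infinity. Injectivity of squaring keeps \<open>n\<close> off the secants.\<close>

lemma hyperoval:
  assumes ev: "even CARD('a::{field,finite})"
  shows "\<exists>W \<in> pg_planes. \<exists>K :: ('a ^ 4) set set. is_cap (CARD('a) + 2) K \<and> K \<subseteq> ptset W"
proof -
  have one: "(1::'a) + 1 = 0" by (rule char_two[OF ev])
  have dbl: "z + z = 0" for z :: 'a
    using one by (metis mult_2 mult_zero_left one_add_one)
  have sq: "x = y" if "x * x = y * y" for x y :: 'a
  proof -
    have "x = y \<or> x = - y" using that by (metis square_eq_iff)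
    moreover have "- y = y" using dbl[of y] by (metis minus_unique)
    ultimately show ?thesis by auto
  qed
  define h :: "'a \<Rightarrow> 'a ^ 4" where "h x = vec4 1 x (x * x) 0" for x
  define n i :: "'a ^ 4" where "n = vec4 0 1 0 0" and "i = vec4 0 0 1 0"
  define V where "V = insert n (insert i (range h))"
  have nth: "h x $ 1 = 1" "h x $ 2 = x" "h x $ 3 = x * x" "h x $ 4 = 0"
    "n $ 1 = 0" "n $ 2 = 1" "n $ 3 = 0" "n $ 4 = 0" "i $ 1 = 0" "i $ 2 = 0" "i $ 3 = 1" "i $ 4 = 0" for x
    by (simp_all add: h_def n_def i_def)
  have hhh: "a = c \<or> b = c" if "h c = x *s h a + y *s h b" for a b c x y
  proof -
    have e: "x + y = 1" "c = x * a + y * b" "c * c = x * (a * a) + y * (b * b)"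
      using arg_cong[OF that, of "\<lambda>v. v $ 1"] arg_cong[OF that, of "\<lambda>v. v $ 2"]
        arg_cong[OF that, of "\<lambda>v. v $ 3"] by (simp_all only: nth vector_add_component vector_smult_component mult_1_right)
    have y: "y = 1 - x" using e(1) by (simp add: algebra_simps)
    \<comment> \<open>The identity used for the elliptic quadric, here for the form
      \<open>x * x\<close>.\<close>
    have "x * (1 - x) * ((a - b) * (a - b)) = x * (a * a) + y * (b * b) - c * c"
      unfolding e(2) y by (simp add: algebra_simps)
    then have "x = 0 \<or> x = 1 \<or> a = b" using e(3) by simp
    then show ?thesis using e y by (auto simp: algebra_simps)
  qed
  have hh0: "a = b \<or> x = 0" if "0 = x + y" "0 = x * (a * a) + y * (b * b)" for a b x y :: 'a
  proof -
    have y: "y = - x" using that(1) by (metis add.inverse_unique)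
    then have "x * (a * a) = x * (b * b)" using that(2) by simp
    then show ?thesis using sq[of a b] by (metis mult_cancel_left)
  qed
  have indep: "w \<noteq> x *s u + y *s v"
    if A: "u \<in> V" "v \<in> V" "w \<in> V" "u \<noteq> v" "u \<noteq> w" "v \<noteq> w" for u v w x y
  proof
    assume eq: "w = x *s u + y *s v"
    have c: "w $ 1 = x * u $ 1 + y * v $ 1" "w $ 2 = x * u $ 2 + y * v $ 2" "w $ 3 = x * u $ 3 + y * v $ 3"
      using eq by simp_all
    consider a b d where "u = h a" "v = h b" "w = h d" | a b where "u = h a" "v = h b" "w = n"
      | a b where "u = h a" "v = h b" "w = i" | a where "u = h a" "v = n" "w = i"
      | a where "u = h a" "v = i" "w = n" | a where "u = n" "v = h a" "w = i"
      | a where "u = i" "v = h a" "w = n" | a b where "u = h a" "v = n" "w = h b"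
      | a b where "u = h a" "v = i" "w = h b" | a b where "u = n" "v = h a" "w = h b"
      | a b where "u = i" "v = h a" "w = h b" | a where "u = n" "v = i" "w = h a"
      | a where "u = i" "v = n" "w = h a"
      using A by (auto simp: V_def)
    then show False
    proof cases
      case 1
      then show False using hhh[of d x a y b] eq A by auto
    next
      case 2
      then show False using hh0[of x y a b] c A by (auto simp: nth)
    next
      case 3
      then have e: "0 = x + y" "0 = x * a + y * b" "1 = x * (a * a) + y * (b * b)" using c by (auto simp: nth)
      then have y: "y = - x" by (metis add.inverse_unique)
      have "x * a = x * b" using e(2) unfolding y by simp
      then have "x = 0 \<or> a = b" by auto
      then show False using e(3) y A 3 by auto
    next
      case 8
      then have "x = 1" "b * b = a * a" using c by (auto simp: nth)
      then show False using sq[of b a] A 8 by auto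
    next
      case 10
      then have "y = 1" "b * b = a * a" using c by (auto simp: nth)
      then show False using sq[of b a] A 10 by auto
    qed (use c A in \<open>auto simp: nth\<close>)
  qed
  have ni: "n \<noteq> i" "n \<notin> range h" "i \<notin> range h" "n \<noteq> 0" "i \<noteq> 0" "h x \<noteq> 0" for x
    by (auto simp: vec4_eq_iff nth)
  have "is_cap (card V) ((\<lambda>v. vec.span {v}) ` V)"
  proof (rule is_cap_span_image)
    show "0 \<notin> V" using ni by (auto simp: V_def)
  next
    fix u v k assume "u \<in> V" "v \<in> V" "v = k *s u"
    then show "u = v" by (auto simp: V_def vec4_eq_iff nth)
  qed (rule indep)
  moreover have "card V = CARD('a) + 2"
  proof -
    have "inj h" by (rule injI) (auto simp: vec4_eq_iff nth)
    then show ?thesis using ni by (simp add: V_def card_image)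
  qed
  \<comment> \<open>The plane \<open>X4 = 0\<close>, written with an index set so that
    \<open>dim_substandard_cart\<close> applies.\<close>
  moreover define W :: "('a ^ 4) set" where "W = {x. \<forall>j. j \<notin> {1, 2, 3} \<longrightarrow> x $ j = 0}"
  have W: "vec.subspace W" unfolding W_def vec.subspace_def by simp
  have "W \<in> pg_planes"
    using W dim_substandard_cart[of "{1, 2, 3 :: 4}", where 'a='a] by (simp add: pg_planes_def W_def)
  moreover have "(\<lambda>v. vec.span {v}) ` V \<subseteq> ptset W"
  proof
    fix P assume "P \<in> (\<lambda>v. vec.span {v}) ` V"
    then obtain v where v: "v \<in> V" "P = vec.span {v}" by auto
    have "v \<in> W" using v(1) by (auto simp: V_def W_def nth forall_4)
    moreover have "v \<noteq> 0" using v(1) ni by (auto simp: V_def)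
    ultimately show "P \<in> ptset W" unfolding v by (rule span_singleton_mem_ptset[OF W])
  qed
  ultimately show ?thesis by metis
qed

theorem theorem1p6:
  fixes q :: nat
  assumes "CARD('a::{field,finite}) = q"
    and "even q"
    and "q \<ge> 8"
  shows "real (m2' TYPE('a) TYPE(4)) < (real q)\<^sup>2 - (sqrt 5 - 1) * real q + 5"
proof -
  let ?N = "complete_cap_sizes TYPE('a) TYPE(4)"
  let ?b = "(real q)\<^sup>2 - (sqrt 5 - 1) * real q + 5"
  have bound: "k = q\<^sup>2 + 1 \<or> real k < ?b" if "k \<in> ?N" for k
    using that complete_cap_card[OF assms] by (auto simp: complete_cap_sizes_def)
  \<comment> \<open>For \<open>q \<ge> 8\<close> the bound lies below \<open>q^2 + 1\<close>, so
    \<open>complete_cap_card\<close> makes \<open>q^2 + 1\<close> an upper bound for all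
    sizes.\<close>
  have "sqrt 5 \<ge> 2" by (rule real_le_rsqrt) simp
  then have "1 * real q \<le> (sqrt 5 - 1) * real q" by (intro mult_right_mono) auto
  then have "4 < (sqrt 5 - 1) * real q" using assms(3) by linarith
  then have b: "?b < real (q\<^sup>2 + 1)" by simp
  have "?N \<subseteq> {..card (pg_points :: ('a ^ 4) set set)}"
    by (auto simp: complete_cap_sizes_def is_complete_cap_def is_cap_def intro!: card_mono)
  then have fin: "finite ?N" using finite_subset by blast
  have max: "k \<le> q\<^sup>2 + 1" if "k \<in> ?N" for k
    using bound[OF that]
  proof
    assume "real k < ?b"
    then have "real k < real (q\<^sup>2 + 1)" using b by linarith
    then show ?thesis by (simp only: of_nat_less_iff less_imp_le)
  qed simp
  obtain E :: "('a ^ 4) set set" where "is_cap (q\<^sup>2 + 1) E" using elliptic_quadric assms(1) by metis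
  then obtain k E' where E: "is_complete_cap k E'" "E \<subseteq> E'" "card E = q\<^sup>2 + 1"
    using cap_extends_to_complete_cap by (metis is_cap_def)
  then have "q\<^sup>2 + 1 \<le> k" using card_mono[of E' E] by (simp add: is_complete_cap_def is_cap_def)
  moreover have kN: "k \<in> ?N" using E by (auto simp: complete_cap_sizes_def)
  ultimately have "q\<^sup>2 + 1 \<in> ?N" using max[OF kN] by simp
  then have m2: "m2 TYPE('a) TYPE(4) = q\<^sup>2 + 1"
    unfolding m2_def using max fin by (intro Max_eqI) auto
  obtain W H where H: "W \<in> pg_planes" "is_cap (q + 2) (H :: ('a ^ 4) set set)" "H \<subseteq> ptset W"
    using hyperoval[where 'a='a] assms(1,2) by metis
  then obtain j H' where H': "is_complete_cap j H'" "H \<subseteq> H'" using cap_extends_to_complete_cap by metis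
  have "j \<noteq> q\<^sup>2 + 1"
  proof
    assume "j = q\<^sup>2 + 1"
    then have "card (ptset W \<inter> H') \<le> q + 1" using maximal_cap_plane[OF assms _ H(1)] H'(1) by simp
    moreover have "card H \<le> card (ptset W \<inter> H')" using H(3) H'(2) by (intro card_mono) auto
    ultimately show False using H(2) by (simp add: is_cap_def)
  qed
  moreover have "j \<in> ?N" using H'(1) by (auto simp: complete_cap_sizes_def)
  \<comment> \<open>\<open>Max\<close> is specified only on nonempty sets, so \<open>Max_in\<close>
    needs the size \<open>j\<close> of the completed hyperoval.\<close>
  ultimately have "?N - {q\<^sup>2 + 1} \<noteq> {}" by blast
  then have "m2' TYPE('a) TYPE(4) \<in> ?N - {q\<^sup>2 + 1}"
    unfolding m2'_def m2 using fin by (intro Max_in) auto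
  then show ?thesis using bound by blast
qed

end
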